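(* Let $(X_0,a_0),\dots,(X_n,a_n)$ be a sample from a controlled Markov chain with finite state space $\mathcal S=\{1,\dots,d\}$, finite action space $\mathcal A=\{1,\dots,k\}$ and transition probabilities $M^{(l)}_{s,t}$, under a logging policy for which the following three conditions hold. (1) For all $(s,l)\in\mathcal S\times\mathcal A$ there exist $0<\beta<1$ and a deterministic sequence $(T_i)_{i\ge1}$ with $T_i=O(i^{\beta})$ such that for all $i\ge1$, $\mathbb E\big[\tau^{(i)}_{s,l}\mid\mathcal F_{\sum_{p=1}^{i-1}\tau^{(p)}_{s,l}}\big]\le T_i$ almost surely. (2) There exists a constant $C_\Delta>1$ independent of $n$ such that $\|\Delta_n\|:=\max_{1\le i\le n}\big(1+\bar\eta_{i,i+1}(n)+\dots+\bar\eta_{i,n}(n)\big)\le C_\Delta$ for all $n$. (3) For every $(s,l)$ the limit $p_s^{(l)}=\lim_{n\to\infty}\frac1n\sum_{i=0}^{n-1}\mathbb P(X_i=s,a_i=l)$ exists, and $\min_{s,l}p_s^{(l)}>0$. Let $\pi:\mathcal S\to\Delta(\mathcal A)$ be a stationary target policy and $0<\alpha<1$ the discount factor, with $V_\Pi,Q_\Pi,A_\Pi$ and the plug-in estimates $\hat V_\Pi,\hat Q_\Pi,\hat A_\Pi$ defined in the context. Then, as $n\to\infty$, $$\sqrt n\,(\hat V_\Pi-V_\Pi)\overset{d}{\rightarrow}\mathcal N(0,\Sigma_V^\Pi),\qquad \sqrt n\,(\hat Q_\Pi-Q_\Pi)\overset{d}{\rightarrow}\mathcal N(0,\Sigma_Q^\Pi),\qquad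 \sqrt n\,(\hat A_\Pi-A_\Pi)\overset{d}{\rightarrow}\mathcal N(0,\Sigma_A^\Pi),$$ and each estimator is consistent: $\hat V_\Pi\overset{p}{\to}V_\Pi$, $\hat Q_\Pi\overset{p}{\to}Q_\Pi$, $\hat A_\Pi\overset{p}{\to}A_\Pi$. Here $$\Sigma_V^\Pi=\alpha^2\big[(I-\alpha\Pi\mathbf M)^{-1}\Pi\otimes V_\Pi^\top\big]\bar\Lambda\big[\Pi^\top(I-\alpha\mathbf M^\top\Pi^\top)^{-1}\otimes V_\Pi\big],$$ $$\Sigma_Q^\Pi=\alpha^2\big[(I-\alpha\mathbf M\Pi)^{-1}\otimes Q_\Pi^\top\Pi^\top\big]\bar\Lambda\big[(I-\alpha\Pi^\top\mathbf M^\top)^{-1}\otimes\Pi Q_\Pi\big],$$ $$\Sigma_A^\Pi=\alpha^2\big[(I-\alpha\mathbf M\Pi)^{-1}\otimes Q_\Pi^\top\Pi^\top-K\big((I-\alpha\Pi\mathbf M)^{-1}\Pi\otimes V_\Pi^\top\big)\big]\bar\Lambda\big[(I-\alpha\Pi^\top\mathbf M^\top)^{-1}\otimes\Pi Q_\Pi-\big(\Pi^\top(I-\alpha\mathbf M^\top\Pi^\top)^{-1}\otimes V_\Pi\big)K^\top\big],$$ and $\bar\Lambda$ is the $d^2k\times d^2k$ matrix whose entry in row $(s-1)dk+(l-1)d+t$ and column $(s'-1)dk+(l'-1)d+t'$ is $$\bar\lambda_{slt,s'l't'}=\frac{\mathbb 1[(s,l)=(s',l')]\big(\mathbb 1[t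=t']M^{(l)}_{s,t}-M^{(l)}_{s,t}M^{(l')}_{s',t'}\big)}{\sqrt{p_s^{(l)}p_{s'}^{(l')}}}.$$
   Context: Controlled Markov chain (CMC): let $\mathcal F_j=\sigma(X_0,a_0,\dots,X_j,a_j)$. A CMC is a process $\{(X_i,a_i)\}_{i\ge0}$ with values in $\mathcal S\times\mathcal A$ such that for all times $i$ and all histories $(s_0,l_0,\dots,s_i,l_i)$ of positive probability, $\mathbb P(X_{i+1}=t\mid X_0=s_0,a_0=l_0,\dots,X_i=s_i,a_i=l_i)=\mathbb P(X_{i+1}=t\mid X_i=s_i,a_i=l_i)=M^{(l_i)}_{s_i,t}$, with $M^{(l)}_{s,t}$ not depending on $i$. The law of $a_i$ given $(X_0,a_0,\dots,X_{i-1},a_{i-1},X_i)$ (the logging policy) may be history-dependent and time-inhomogeneous. Estimator: $N_s^{(l)}=\sum_{i=0}^{n-1}\mathbb 1[X_i=s,a_i=l]$, $N_{s,t}^{(l)}=\sum_{i=0}^{n-1}\mathbb 1[X_i=s,X_{i+1}=t,a_i=l]$, $\hat M^{(l)}_{s,t}=N^{(l)}_{s,t}/N^{(l)}_s$ (set to $0$ when $N_s^{(l)}=0$). $\mathbf M$ is the $dk\times d$ matrix whose $((s-1)k+l,\,t)$ entry is $M^{(l)}_{s,t}$; $\hat{\mathbf M}$ is the same with $\hat M^{(l)}_{s,t}$. Return times: $\tau^{(1)}_{s,l}=\min\{i>0:X_i=s,a_i=l\}$ and, for $i\ge2$, $\tau^{(i)}_{s,l}=\min\{m>0: X_{\sum_{j=1}^{i-1}\tau^{(j)}_{s,l}+m}=s,\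 a_{\sum_{j=1}^{i-1}\tau^{(j)}_{s,l}+m}=l\}$. $\mathcal F_{\sum_{p=1}^{i-1}\tau^{(p)}_{s,l}}$ is the $\sigma$-algebra of the corresponding stopping time. Weak mixing coefficients: for $i<j\le n$, $\bar\eta_{i,j}(n)=\sup\big|\mathbb P((X_j,a_j,\dots,X_n,a_n)\in\mathcal T\mid X_i=s_1,a_i=l_1,\mathcal H_0^{i-1}=h)-\mathbb P((X_j,a_j,\dots,X_n,a_n)\in\mathcal T\mid X_i=s_2,a_i=l_2,\mathcal H_0^{i-1}=h)\big|$, where $\mathcal H_0^{i-1}=((X_0,a_0),\dots,(X_{i-1},a_{i-1}))$ and the supremum is over $\mathcal T\subseteq(\mathcal S\times\mathcal A)^{n-j+1}$, $s_1,s_2\in\mathcal S$, $l_1,l_2\in\mathcal A$, $h\in(\mathcal S\times\mathcal A)^i$ such that both conditioning events have positive probability. Policy quantities: $\Delta(\mathcal A)$ is the probability simplex over $\mathcal A$. For each $s$, $\pi_s=[\pi(s,1),\dots,\pi(s,k)]$ (row vector), and $\Pi=\operatorname{diag}(\pi_1,\dots,\pi_d)$ is the $d\times dk$ block-diagonal matrix. Given a fixed reward vector $\tilde g=(\tilde g(x,a))_{(x,a)\in\mathcal S\times\mathcal A}$, set $g(x)=\sum_{a}\pi(x,a)\tilde g(x,a)$, $g\in\mathbb R^d$; $V_\Pi=(I-\alpha\Pi\mathbf M)^{-1}g$ and $\hat V_\Pi=(I-\alpha\Pi\hat{\mathbf M})^{-1}g$. Given fixed transition rewards $\tilde r(x,a,y)$,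 set $r(x,a)=\sum_{y}M^{(a)}_{x,y}\tilde r(x,a,y)$, $r\in\mathbb R^{dk}$ (the coordinate of $(x,a)$ being $(x-1)k+a$); $Q_\Pi=(I-\alpha\mathbf M\Pi)^{-1}r$ and $\hat Q_\Pi=(I-\alpha\hat{\mathbf M}\Pi)^{-1}r$ (same $r$). With $K=\operatorname{diag}(\mathbf 1_k,\dots,\mathbf 1_k)$ the $dk\times d$ block-diagonal matrix with blocks the all-ones column vector $\mathbf 1_k\in\mathbb R^k$, $A_\Pi=Q_\Pi-KV_\Pi$ and $\hat A_\Pi=\hat Q_\Pi-K\hat V_\Pi$. $\otimes$ is the Kronecker product; ordinary matrix products are performed before $\otimes$, and $\otimes$ before addition/subtraction.
   Formalization: In condition (2) the maximum defining the mixing norm is taken over 0≤i≤n instead of 1≤i≤n; without the row i=0 the claim is false, since a policy that picks one of two action laws by a_0 and keeps it gives random visit frequencies and a non-normal limit. *)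

theory Defs
  imports "HOL-Probability.Probability" "HOL-Library.Landau_Symbols"
begin

text \<open>
  The state space \<open>{1,\<dots>,d}\<close> and the action space \<open>{1,\<dots>,k}\<close> are arbitrary nonempty finite types
  \<open>'s\<close> and \<open>'a\<close>. The row index \<open>(s-1)k+l\<close> is the pair \<open>(s,l)\<close>, and the index \<open>(s-1)dk+(l-1)d+t\<close>
  is \<open>((s,l),t)\<close>.
\<close>

section \<open>Controlled Markov chains\<close>

definition path :: "(nat \<Rightarrow> 'w \<Rightarrow> 's) \<Rightarrow> (nat \<Rightarrow> 'w \<Rightarrow> 'a) \<Rightarrow> nat \<Rightarrow> nat \<Rightarrow> 'w \<Rightarrow> ('s \<times> 'a) list" where
  "path X a i j w = map (\<lambda>m. (X m w, a m w)) [i..<j]"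

text \<open>
  The law of \<open>a\<^sub>i\<close> given the past is unrestricted. Rows of \<open>M\<close> belonging to pairs \<open>(s,l)\<close> that are
  visited with positive probability are automatically stochastic.
\<close>

locale controlled_markov_chain = prob_space P
  for P :: "'w measure" +
  fixes X :: "nat \<Rightarrow> 'w \<Rightarrow> 's::finite"
    and a :: "nat \<Rightarrow> 'w \<Rightarrow> 'a::finite"
    and M :: "real^'s^('s \<times> 'a)"
  assumes measurable_state: "\<And>i. X i \<in> P \<rightarrow>\<^sub>M count_space UNIV"
    and measurable_action: "\<And>i. a i \<in> P \<rightarrow>\<^sub>M count_space UNIV"
    and markov: "\<And>i h s l t.
      \<P>(w in P. path X a 0 i w = h \<and> X i w = s \<and> a i w = l) > 0 \<Longrightarrow>
        \<P>(w in P. X (Suc i) w = t \<bar> path X a 0 i w = h \<and> X i w = s \<and> a i w = l)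
          = \<P>(w in P. X (Suc i) w = t \<bar> X i w = s \<and> a i w = l)"
    and transition: "\<And>i s l t.
      \<P>(w in P. X i w = s \<and> a i w = l) > 0 \<Longrightarrow>
        \<P>(w in P. X (Suc i) w = t \<bar> X i w = s \<and> a i w = l) = M $ (s, l) $ t"

section \<open>Return times\<close>

text \<open>
  Time is indexed by \<^typ>\<open>enat\<close> so that the partial sums of the return times are stopping times
  also where they are infinite; the \<open>\<sigma>\<close>-algebra at \<open>\<infinity>\<close> is generated by the whole process.
\<close>

definition history_filtration ::
    "'w measure \<Rightarrow> (nat \<Rightarrow> 'w \<Rightarrow> 's) \<Rightarrow> (nat \<Rightarrow> 'w \<Rightarrow> 'a) \<Rightarrow> enat \<Rightarrow> 'w measure" where
  "history_filtration P X a n =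
     sigma (space P) {{w \<in> space P. X i w = s \<and> a i w = l} | i s l. enat i \<le> n}"

text \<open>
  The value is \<open>\<infinity>\<close> if there is no further visit. Only indices \<open>i \<ge> 1\<close> are meaningful.
\<close>

function return_time ::
    "(nat \<Rightarrow> 'w \<Rightarrow> 's) \<Rightarrow> (nat \<Rightarrow> 'w \<Rightarrow> 'a) \<Rightarrow> 's \<Rightarrow> 'a \<Rightarrow> nat \<Rightarrow> 'w \<Rightarrow> enat" where
  "return_time X a s l i w =
     (case (\<Sum>j\<in>{1..<i}. return_time X a s l j w) of
        enat N \<Rightarrow> Inf {enat m | m. m > 0 \<and> X (N + m) w = s \<and> a (N + m) w = l}
      | \<infinity> \<Rightarrow> \<infinity>)"
  by pat_completeness auto
termination
  by (relation "Wellfounded.measure (\<lambda>(X, a, s, l, i, w). i)") auto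

declare return_time.simps [simp del]

definition return_sum ::
    "(nat \<Rightarrow> 'w \<Rightarrow> 's) \<Rightarrow> (nat \<Rightarrow> 'w \<Rightarrow> 'a) \<Rightarrow> 's \<Rightarrow> 'a \<Rightarrow> nat \<Rightarrow> 'w \<Rightarrow> enat" where
  "return_sum X a s l i w = (\<Sum>p\<in>{1..<i}. return_time X a s l p w)"

definition cond_return_time ::
    "'w measure \<Rightarrow> (nat \<Rightarrow> 'w \<Rightarrow> 's) \<Rightarrow> (nat \<Rightarrow> 'w \<Rightarrow> 'a) \<Rightarrow> 's \<Rightarrow> 'a \<Rightarrow> nat \<Rightarrow> 'w \<Rightarrow> ennreal" where
  "cond_return_time P X a s l i =
     nn_cond_exp P
       (filtration.pre_sigma (space P) (history_filtration P X a) (return_sum X a s l i))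
       (\<lambda>w. ennreal_of_enat (return_time X a s l i w))"

text \<open>
  \<^const>\<open>nn_cond_exp\<close> is \<open>0\<close> by definition unless its \<open>\<sigma>\<close>-algebra is a subalgebra and its integrand is
  measurable. Lemmas \<open>subalgebra_return\<close> and \<open>return_time_measurable\<close> show that this is the case here.
\<close>

lemma Inf_enat_eq:
  "Inf {enat m | m. m > 0 \<and> Q m} = enat k \<longleftrightarrow> k > 0 \<and> Q k \<and> (\<forall>q. 0 < q \<and> q < k \<longrightarrow> \<not> Q q)"
  (is "Inf ?A = _ \<longleftrightarrow> _")
proof
  assume I: "Inf ?A = enat k"
  then have "?A \<noteq> {}" by (metis Inf_enat_def enat.distinct(1))
  then have "Inf ?A \<in> ?A" by (auto simp: Inf_enat_def intro: LeastI)
  moreover have "\<not> Q q" if "0 < q" "q < k" for q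
  proof
    assume "Q q"
    then have "Inf ?A \<le> enat q" using that by (intro Inf_lower) auto
    then show False using I that by simp
  qed
  ultimately show "k > 0 \<and> Q k \<and> (\<forall>q. 0 < q \<and> q < k \<longrightarrow> \<not> Q q)" using I by auto
next
  assume k: "k > 0 \<and> Q k \<and> (\<forall>q. 0 < q \<and> q < k \<longrightarrow> \<not> Q q)"
  show "Inf ?A = enat k"
  proof (rule antisym)
    show "Inf ?A \<le> enat k" using k by (intro Inf_lower) auto
    show "enat k \<le> Inf ?A" using k by (intro Inf_greatest) (auto simp: not_less[symmetric])
  qed
qed

context controlled_markov_chain
begin

lemma history_generators:
  "{{w \<in> space P. X i w = s \<and> a i w = l} | i s l. enat i \<le> n} \<subseteq> Pow (space P)"
  by auto

lemma space_history: "space (history_filtration P X a n) = space P"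
  unfolding history_filtration_def using history_generators by (rule space_measure_of)

lemma sets_history: "sets (history_filtration P X a n) =
    sigma_sets (space P) {{w \<in> space P. X i w = s \<and> a i w = l} | i s l. enat i \<le> n}"
  unfolding history_filtration_def using history_generators by (rule sets_measure_of)

lemma sets_history_mono:
  "m \<le> n \<Longrightarrow> sets (history_filtration P X a m) \<subseteq> sets (history_filtration P X a n)"
  unfolding sets_history by (intro sigma_sets_mono') (auto intro: order_trans)

lemma visit_in_history:
  "enat i \<le> n \<Longrightarrow> {w \<in> space P. X i w = s \<and> a i w = l} \<in> sets (history_filtration P X a n)"
  unfolding sets_history by (intro sigma_sets.Basic) auto

lemma filtration_history: "filtration (space P) (history_filtration P X a)"
  by standard (auto simp: space_history dest: sets_history_mono)

lemma sets_history_subset: "sets (history_filtration P X a n) \<subseteq> sets P"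
  unfolding sets_history
proof (rule sets.sigma_sets_subset, safe)
  fix i s l
  note measurable_state[measurable] measurable_action[measurable]
  show "{w \<in> space P. X i w = s \<and> a i w = l} \<in> events" by measurable
qed

lemma return_time_eq:
  "return_time X a s l i w = enat k \<longleftrightarrow> (\<exists>N. return_sum X a s l i w = enat N \<and> k > 0 \<and>
     X (N+k) w = s \<and> a (N+k) w = l \<and> (\<forall>q. 0 < q \<and> q < k \<longrightarrow> \<not> (X (N+q) w = s \<and> a (N+q) w = l)))"
  unfolding return_time.simps[of X a s l i] return_sum_def[symmetric]
  by (cases "return_sum X a s l i w") (simp_all add: Inf_enat_eq)

lemma return_sum_Suc:
  "i \<ge> 1 \<Longrightarrow> return_sum X a s l (Suc i) w = return_sum X a s l i w + return_time X a s l i w"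
  unfolding return_sum_def by (simp add: add.commute)

lemma return_sum_Suc_eq:
  assumes "i \<ge> 1"
  shows "return_sum X a s l (Suc i) w = enat n \<longleftrightarrow> (\<exists>N<n. return_sum X a s l i w = enat N \<and>
     (X n w = s \<and> a n w = l) \<and> (\<forall>q. N < q \<and> q < n \<longrightarrow> \<not> (X q w = s \<and> a q w = l)))" (is "_ \<longleftrightarrow> ?R")
proof
  assume "return_sum X a s l (Suc i) w = enat n"
  then obtain N k where Nk: "return_sum X a s l i w = enat N" "return_time X a s l i w = enat k" "n = N + k"
    unfolding return_sum_Suc[OF assms]
    by (cases "return_sum X a s l i w"; cases "return_time X a s l i w") auto
  then have v: "k > 0" "X n w = s \<and> a n w = l"
    "\<And>q. 0 < q \<Longrightarrow> q < k \<Longrightarrow> \<not> (X (N+q) w = s \<and> a (N+q) w = l)"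
    using return_time_eq[of s l i w k] by auto
  have "\<not> (X q w = s \<and> a q w = l)" if "N < q" "q < n" for q
    using v(3)[of "q - N"] that Nk(3) by auto
  with v Nk show ?R by (intro exI[of _ N]) auto
next
  assume ?R
  then obtain N where N: "N < n" "return_sum X a s l i w = enat N" "X n w = s \<and> a n w = l"
    "\<forall>q. N < q \<and> q < n \<longrightarrow> \<not> (X q w = s \<and> a q w = l)" by blast
  then have "return_time X a s l i w = enat (n - N)"
    unfolding return_time_eq by (intro exI[of _ N]) auto
  then show "return_sum X a s l (Suc i) w = enat n"
    unfolding return_sum_Suc[OF assms] using N by simp
qed

lemma return_sum_in_history: "i \<ge> 1 \<Longrightarrow> {w \<in> space P. return_sum X a s l i w = enat n} \<in> sets (history_filtration P X a (enat n))"
proof (induction i arbitrary: n rule: dec_induct)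
  case base
  have "{w \<in> space P. return_sum X a s l 1 w = enat n} = (if n = 0 then space (history_filtration P X a (enat n)) else {})"
    by (auto simp: return_sum_def space_history zero_enat_def)
  then show ?case by simp
next
  case (step i)
  have eq: "{w \<in> space P. return_sum X a s l (Suc i) w = enat n} =
    (\<Union>N\<in>{..<n}. {w \<in> space P. return_sum X a s l i w = enat N} \<inter> {w \<in> space P. X n w = s \<and> a n w = l}
      - (\<Union>q\<in>{N<..<n}. {w \<in> space P. X q w = s \<and> a q w = l}))"
    using return_sum_Suc_eq[OF step.hyps(1), of s l] by auto
  have "{w \<in> space P. return_sum X a s l i w = enat N} \<in> sets (history_filtration P X a (enat n))" if "N < n" for N
    using step.IH[of N] sets_history_mono[of "enat N" "enat n"] that by auto
  then show ?case unfolding eq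
    by (intro sets.finite_UN sets.Diff sets.Int visit_in_history) auto
qed

lemma return_sum_stopping_time:
  assumes "i \<ge> 1" shows "stopping_time (history_filtration P X a) (return_sum X a s l i)"
proof
  fix t
  show "Measurable.pred (history_filtration P X a t) (\<lambda>w. return_sum X a s l i w \<le> t)"
  proof (cases t)
    case (enat n)
    have "{w \<in> space P. return_sum X a s l i w \<le> t} = (\<Union>m\<in>{..n}. {w \<in> space P. return_sum X a s l i w = enat m})"
      unfolding enat
    proof safe
      fix w assume "return_sum X a s l i w \<le> enat n"
      then show "w \<in> (\<Union>m\<in>{..n}. {w \<in> space P. return_sum X a s l i w = enat m})" if "w \<in> space P"
        using that by (cases "return_sum X a s l i w") auto
    qed auto
    moreover have "{w \<in> space P. return_sum X a s l i w = enat m} \<in> sets (history_filtration P X a t)" if "m \<le> n" for m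
      using return_sum_in_history[OF assms, of s l m] sets_history_mono[of "enat m" t] that enat by auto
    ultimately show ?thesis unfolding pred_def space_history by auto
  qed simp
qed

lemma subalgebra_return:
  assumes "i \<ge> 1"
  shows "subalgebra P (filtration.pre_sigma (space P) (history_filtration P X a) (return_sum X a s l i))"
proof -
  interpret f: filtration "space P" "history_filtration P X a" by (rule filtration_history)
  have "A \<in> sets P" if "A \<in> sets (f.pre_sigma (return_sum X a s l i))" for A
    using f.sets_pre_sigmaD[OF return_sum_stopping_time[OF assms] that, of \<infinity>] sets_history_subset by auto
  then show ?thesis unfolding subalgebra_def f.space_pre_sigma by auto
qed

lemma return_time_measurable:
  assumes "i \<ge> 1"
  shows "(\<lambda>w. ennreal_of_enat (return_time X a s l i w)) \<in> borel_measurable P"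
proof -
  note measurable_state[measurable] measurable_action[measurable]
  have [measurable]: "Measurable.pred P (\<lambda>w. return_sum X a s l i w = enat N)" for N
    unfolding pred_def using return_sum_in_history[OF assms, of s l N] sets_history_subset by auto
  have fin: "return_time X a s l i -` {enat k} \<inter> space P \<in> sets P" for k
  proof -
    have "Measurable.pred P (\<lambda>w. return_time X a s l i w = enat k)"
      unfolding return_time_eq by measurable
    then show ?thesis by (simp add: pred_def vimage_def Int_def conj_commute)
  qed
  have "return_time X a s l i -` {\<infinity>} \<inter> space P = space P - (\<Union>k. return_time X a s l i -` {enat k} \<inter> space P)"
    by auto
  also have "\<dots> \<in> events" using fin by (intro sets.Diff sets.countable_UN' sets.top) auto
  finally have "return_time X a s l i -` {x} \<inter> space P \<in> events" for x
    using fin by (cases x) auto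
  then have "return_time X a s l i \<in> P \<rightarrow>\<^sub>M count_space UNIV"
    by (subst measurable_count_space_eq_countable) auto
  then show ?thesis by (rule measurable_compose) simp
qed

end

section \<open>Weak mixing coefficients\<close>

definition eta_bar ::
    "'w measure \<Rightarrow> (nat \<Rightarrow> 'w \<Rightarrow> 's) \<Rightarrow> (nat \<Rightarrow> 'w \<Rightarrow> 'a) \<Rightarrow> nat \<Rightarrow> nat \<Rightarrow> nat \<Rightarrow> real" where
  "eta_bar P X a n i j = Sup
     {\<bar>\<P>(w in P. path X a j (Suc n) w \<in> B \<bar> X i w = s1 \<and> a i w = l1 \<and> path X a 0 i w = h)
       - \<P>(w in P. path X a j (Suc n) w \<in> B \<bar> X i w = s2 \<and> a i w = l2 \<and> path X a 0 i w = h)\<bar>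
      | B s1 l1 s2 l2 h.
        B \<subseteq> {xs. length xs = n - j + 1} \<and> length h = i \<and>
        \<P>(w in P. X i w = s1 \<and> a i w = l1 \<and> path X a 0 i w = h) > 0 \<and>
        \<P>(w in P. X i w = s2 \<and> a i w = l2 \<and> path X a 0 i w = h) > 0}"

text \<open>
  The maximum is over all sampling times \<open>0, \<dots>, n\<close>. The rows \<open>1, \<dots>, n\<close>, over which it is
  sometimes written, do not suffice for a process started at time \<open>0\<close>: with i.i.d. states and a
  logging policy that picks one of two i.i.d. action laws according to \<open>a\<^sub>0\<close> and then keeps it, all
  these rows have \<open>\<eta>\<^bsub>i,j\<^esub> = 0\<close>, but the visit frequencies have a random limit and the limit law of
  the estimators is a mixture of different normal laws.
\<close>

definition Delta_norm ::
    "'w measure \<Rightarrow> (nat \<Rightarrow> 'w \<Rightarrow> 's) \<Rightarrow> (nat \<Rightarrow> 'w \<Rightarrow> 'a) \<Rightarrow> nat \<Rightarrow> real" where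
  "Delta_norm P X a n = (MAX i\<in>{0..n}. 1 + (\<Sum>j\<in>{i<..n}. eta_bar P X a n i j))"

section \<open>Transition estimator\<close>

definition visits ::
    "(nat \<Rightarrow> 'w \<Rightarrow> 's) \<Rightarrow> (nat \<Rightarrow> 'w \<Rightarrow> 'a) \<Rightarrow> nat \<Rightarrow> 'w \<Rightarrow> 's \<Rightarrow> 'a \<Rightarrow> nat" where
  "visits X a n w s l = (\<Sum>i<n. of_bool (X i w = s \<and> a i w = l))"

definition transitions ::
    "(nat \<Rightarrow> 'w \<Rightarrow> 's) \<Rightarrow> (nat \<Rightarrow> 'w \<Rightarrow> 'a) \<Rightarrow> nat \<Rightarrow> 'w \<Rightarrow> 's \<Rightarrow> 'a \<Rightarrow> 's \<Rightarrow> nat" where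
  "transitions X a n w s l t = (\<Sum>i<n. of_bool (X i w = s \<and> X (Suc i) w = t \<and> a i w = l))"

definition M_hat ::
    "(nat \<Rightarrow> 'w \<Rightarrow> 's::finite) \<Rightarrow> (nat \<Rightarrow> 'w \<Rightarrow> 'a::finite) \<Rightarrow> nat \<Rightarrow> 'w \<Rightarrow> real^'s^('s \<times> 'a)" where
  "M_hat X a n w =
     (\<chi> sl t. if visits X a n w (fst sl) (snd sl) = 0 then 0
       else real (transitions X a n w (fst sl) (snd sl) t) / real (visits X a n w (fst sl) (snd sl)))"

section \<open>Value, action-value and advantage of a stationary policy\<close>

definition prob_simplex :: "(real^'a::finite) set" where
  "prob_simplex = {v. (\<forall>l. 0 \<le> v $ l) \<and> (\<Sum>l\<in>UNIV. v $ l) = 1}"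

definition policy_matrix :: "('s::finite \<Rightarrow> real^'a::finite) \<Rightarrow> real^('s \<times> 'a)^'s" where
  "policy_matrix \<pi> = (\<chi> s sl. if fst sl = s then \<pi> s $ snd sl else 0)"

definition state_reward :: "('s::finite \<Rightarrow> real^'a::finite) \<Rightarrow> ('s \<Rightarrow> 'a \<Rightarrow> real) \<Rightarrow> real^'s" where
  "state_reward \<pi> gt = (\<chi> x. \<Sum>l\<in>UNIV. \<pi> x $ l * gt x l)"

definition action_reward ::
    "real^'s^('s::finite \<times> 'a::finite) \<Rightarrow> ('s \<Rightarrow> 'a \<Rightarrow> 's \<Rightarrow> real) \<Rightarrow> real^('s \<times> 'a)" where
  "action_reward M rt = (\<chi> xl. \<Sum>y\<in>UNIV. M $ xl $ y * rt (fst xl) (snd xl) y)"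

definition V_fun ::
    "real \<Rightarrow> real^('s \<times> 'a)^'s \<Rightarrow> real^'s^('s::finite \<times> 'a::finite) \<Rightarrow> real^'s \<Rightarrow> real^'s" where
  "V_fun \<alpha> Pm M g = matrix_inv (mat 1 - \<alpha> *\<^sub>R (Pm ** M)) *v g"

definition Q_fun ::
    "real \<Rightarrow> real^('s \<times> 'a)^'s \<Rightarrow> real^'s^('s::finite \<times> 'a::finite) \<Rightarrow> real^('s \<times> 'a)
      \<Rightarrow> real^('s \<times> 'a)" where
  "Q_fun \<alpha> Pm M r = matrix_inv (mat 1 - \<alpha> *\<^sub>R (M ** Pm)) *v r"

definition K_mat :: "real^'s^('s::finite \<times> 'a::finite)" where
  "K_mat = (\<chi> sl t. if fst sl = t then 1 else 0)"

definition A_fun ::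
    "real \<Rightarrow> real^('s \<times> 'a)^'s \<Rightarrow> real^'s^('s::finite \<times> 'a::finite) \<Rightarrow> real^'s \<Rightarrow> real^('s \<times> 'a)
      \<Rightarrow> real^('s \<times> 'a)" where
  "A_fun \<alpha> Pm M g r = Q_fun \<alpha> Pm M r - K_mat *v V_fun \<alpha> Pm M g"

section \<open>Asymptotic covariance matrices\<close>

definition kronecker :: "real^'n^'m \<Rightarrow> real^'q^'p \<Rightarrow> real^('n::finite \<times> 'q::finite)^('m::finite \<times> 'p::finite)"
  where "kronecker A B = (\<chi> i j. A $ fst i $ fst j * B $ snd i $ snd j)"

text \<open>
  Kronecker products with a row or a column; the one-element factor of the resulting index type is
  dropped.
\<close>

definition kronecker_row :: "real^'n^'m \<Rightarrow> real^'q^1 \<Rightarrow> real^('n::finite \<times> 'q::finite)^'m::finite" where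
  "kronecker_row A B = (\<chi> i j. kronecker A B $ (i, 1) $ j)"

definition kronecker_col :: "real^'n^'m \<Rightarrow> real^1^'p \<Rightarrow> real^'n::finite^('m::finite \<times> 'p::finite)" where
  "kronecker_col A B = (\<chi> i j. kronecker A B $ i $ (j, 1))"

definition Lambda_bar ::
    "real^'s^('s::finite \<times> 'a::finite) \<Rightarrow> ('s \<times> 'a \<Rightarrow> real)
      \<Rightarrow> real^(('s \<times> 'a) \<times> 's)^(('s \<times> 'a) \<times> 's)" where
  "Lambda_bar M p = (\<chi> x y. case (x, y) of ((sl, t), (sl', t')) \<Rightarrow>
     of_bool (sl = sl') * (of_bool (t = t') * M $ sl $ t - M $ sl $ t * M $ sl' $ t')
       / sqrt (p sl * p sl'))"

definition Sigma_V ::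
    "real \<Rightarrow> real^('s \<times> 'a)^'s \<Rightarrow> real^'s^('s::finite \<times> 'a::finite) \<Rightarrow> ('s \<times> 'a \<Rightarrow> real)
      \<Rightarrow> real^'s \<Rightarrow> real^'s^'s" where
  "Sigma_V \<alpha> Pm M p V = \<alpha>\<^sup>2 *\<^sub>R
     (kronecker_row (matrix_inv (mat 1 - \<alpha> *\<^sub>R (Pm ** M)) ** Pm) (rowvector V)
      ** Lambda_bar M p
      ** kronecker_col (transpose Pm ** matrix_inv (mat 1 - \<alpha> *\<^sub>R (transpose M ** transpose Pm)))
           (columnvector V))"

definition Sigma_Q ::
    "real \<Rightarrow> real^('s \<times> 'a)^'s \<Rightarrow> real^'s^('s::finite \<times> 'a::finite) \<Rightarrow> ('s \<times> 'a \<Rightarrow> real)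
      \<Rightarrow> real^('s \<times> 'a) \<Rightarrow> real^('s \<times> 'a)^('s \<times> 'a)" where
  "Sigma_Q \<alpha> Pm M p Q = \<alpha>\<^sup>2 *\<^sub>R
     (kronecker_row (matrix_inv (mat 1 - \<alpha> *\<^sub>R (M ** Pm))) (rowvector Q ** transpose Pm)
      ** Lambda_bar M p
      ** kronecker_col (matrix_inv (mat 1 - \<alpha> *\<^sub>R (transpose Pm ** transpose M)))
           (Pm ** columnvector Q))"

definition Sigma_A ::
    "real \<Rightarrow> real^('s \<times> 'a)^'s \<Rightarrow> real^'s^('s::finite \<times> 'a::finite) \<Rightarrow> ('s \<times> 'a \<Rightarrow> real)
      \<Rightarrow> real^'s \<Rightarrow> real^('s \<times> 'a) \<Rightarrow> real^('s \<times> 'a)^('s \<times> 'a)" where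
  "Sigma_A \<alpha> Pm M p V Q = \<alpha>\<^sup>2 *\<^sub>R
     ((kronecker_row (matrix_inv (mat 1 - \<alpha> *\<^sub>R (M ** Pm))) (rowvector Q ** transpose Pm)
        - K_mat ** kronecker_row (matrix_inv (mat 1 - \<alpha> *\<^sub>R (Pm ** M)) ** Pm) (rowvector V))
      ** Lambda_bar M p
      ** (kronecker_col (matrix_inv (mat 1 - \<alpha> *\<^sub>R (transpose Pm ** transpose M)))
            (Pm ** columnvector Q)
          - kronecker_col (transpose Pm ** matrix_inv (mat 1 - \<alpha> *\<^sub>R (transpose M ** transpose Pm)))
              (columnvector V) ** transpose K_mat))"

section \<open>Normal laws and modes of convergence\<close>

text \<open>
  The library's weak convergence and characteristic functions are for laws on the real line.
  Degenerate covariance matrices are allowed; positive semidefiniteness of \<open>S\<close> follows from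
  boundedness of the characteristic function.
\<close>

definition normal_law :: "(real^'n::finite) measure \<Rightarrow> real^'n \<Rightarrow> real^'n^'n \<Rightarrow> bool" where
  "normal_law N m S \<longleftrightarrow> prob_space N \<and> sets N = sets borel \<and> transpose S = S \<and>
     (\<forall>u. (CLINT x|N. iexp (u \<bullet> x)) = exp (\<i> * of_real (u \<bullet> m) - of_real (u \<bullet> (S *v u)) / 2))"

definition converges_in_distribution ::
    "'w measure \<Rightarrow> (nat \<Rightarrow> 'w \<Rightarrow> 'b::euclidean_space) \<Rightarrow> 'b measure \<Rightarrow> bool" where
  "converges_in_distribution P Y N \<longleftrightarrow> (\<forall>n. Y n \<in> borel_measurable P) \<and>
     (\<forall>f :: 'b \<Rightarrow> real. continuous_on UNIV f \<longrightarrow> bounded (range f) \<longrightarrow>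
        (\<lambda>n. \<integral>w. f (Y n w) \<partial>P) \<longlonglongrightarrow> (\<integral>x. f x \<partial>N))"

definition converges_to_normal ::
    "'w measure \<Rightarrow> (nat \<Rightarrow> 'w \<Rightarrow> real^'n::finite) \<Rightarrow> real^'n \<Rightarrow> real^'n^'n \<Rightarrow> bool" where
  "converges_to_normal P Y m S \<longleftrightarrow> (\<exists>N. normal_law N m S \<and> converges_in_distribution P Y N)"

definition converges_in_probability ::
    "'w measure \<Rightarrow> (nat \<Rightarrow> 'w \<Rightarrow> 'b::euclidean_space) \<Rightarrow> 'b \<Rightarrow> bool" where
  "converges_in_probability P Y c \<longleftrightarrow> (\<forall>n. Y n \<in> borel_measurable P) \<and>
     (\<forall>e>0. (\<lambda>n. \<P>(w in P. dist (Y n w) c > e)) \<longlonglongrightarrow> 0)"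

end

(*
  The estimation error is driven by the martingale of centred transition counts. The weak mixing
  coefficients bound the increments of the Doob martingale of each visit count, so visit counts have
  variance O(n) and visit frequencies converge in mean square to p. This makes the conditional variance
  of the transition martingale asymptotically deterministic, which gives its central limit theorem.
  The plug-in estimators are resolvents of the estimated matrix and differ from their targets by a
  linear image of the matrix error plus a quadratic remainder; the covariances are then read off.
*)
theory Submission
  imports Defs "HOL-Real_Asymp.Real_Asymp"
begin

text \<open>The logging policy is arbitrary, so the pairs (X_i, a_i) need not form a Markov chain
  and the visit counts have no regenerative structure to exploit. What remains is that, given the
  history up to and including (X_j, a_j), the next state has law \<open>M $ (X j w, a j w)\<close>.
  The policy therefore enters the transition martingale only through the conditional variance, a
  linear function of the visit frequencies, so a law of large numbers for these frequencies
  suffices. Transitions out of distinct pairs never occur at the same time, hence the limit is block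
  diagonal; its block at z has weight p z, and replacing the random denominators N_z / n by p z
  turns this weight into the 1 / p z of \<open>Lambda_bar\<close>. Two facts keep the analysis
  elementary. For each n everything is a function of a finite history, so measurability and
  integrability hold for arbitrary functions of the estimator. And every \<open>M_hat\<close> is
  substochastic, so alpha < 1 bounds all resolvents at once: the quadratic expansion holds for all
  substochastic matrices, not only near M.\<close>

section \<open>Multivariate continuity theorem\<close>

text \<open>Finite linear combinations of characters: pointwise convergence of characteristic
  functions gives convergence of their expectations by linearity alone.\<close>

inductive trig_polynomial :: "('b::euclidean_space \<Rightarrow> complex) \<Rightarrow> bool" where
  monomial: "trig_polynomial (\<lambda>x. c * iexp (u \<bullet> x))"
| add: "trig_polynomial f \<Longrightarrow> trig_polynomial g \<Longrightarrow> trig_polynomial (\<lambda>x. f x + g x)"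

lemma trig_polynomial_const: "trig_polynomial (\<lambda>x. c)"
  using trig_polynomial.monomial[of c 0] by simp

lemma trig_polynomial_sum:
  "finite A \<Longrightarrow> (\<And>b. b \<in> A \<Longrightarrow> trig_polynomial (f b)) \<Longrightarrow> trig_polynomial (\<lambda>x. \<Sum>b\<in>A. f b x)"
  by (induction A rule: finite_induct) (auto intro: trig_polynomial_const trig_polynomial.add)

lemma trig_polynomial_mult:
  assumes "trig_polynomial f" "trig_polynomial g"
  shows "trig_polynomial (\<lambda>x. f x * g x)"
  using assms(1)
proof (induction rule: trig_polynomial.induct)
  case (monomial c u)
  show ?case
    using assms(2)
  proof (induction rule: trig_polynomial.induct)
    case (monomial c' u')
    have "(\<lambda>x. c * iexp (u \<bullet> x) * (c' * iexp (u' \<bullet> x))) = (\<lambda>x. (c * c') * iexp ((u + u') \<bullet> x))"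
      by (simp add: inner_add_left exp_add[symmetric] algebra_simps)
    then show ?case using trig_polynomial.monomial by metis
  next
    case (add f' g')
    then show ?case by (simp add: ring_distribs trig_polynomial.add)
  qed
next
  case (add f' g')
  then show ?case by (simp add: ring_distribs trig_polynomial.add)
qed

lemma trig_polynomial_sin: "trig_polynomial (\<lambda>x. c * of_real (sin (u \<bullet> x)))"
proof -
  have "(\<lambda>x. c * of_real (sin (u \<bullet> x))) =
      (\<lambda>x. (c / (2 * \<i>)) * iexp (u \<bullet> x) + (- c / (2 * \<i>)) * iexp ((- u) \<bullet> x))"
    by (rule ext) (simp add: sin_of_real[symmetric] sin_exp_eq field_simps)
  moreover have "trig_polynomial \<dots>"
    by (intro trig_polynomial.add trig_polynomial.monomial)
  ultimately show ?thesis by metis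
qed

lemma trig_polynomial_bounded_measurable:
  assumes "trig_polynomial f"
  shows "f \<in> borel_measurable borel \<and> (\<exists>B. \<forall>x. norm (f x) \<le> B)"
  using assms
proof (induction rule: trig_polynomial.induct)
  case (monomial c u)
  have "\<forall>x. norm (c * iexp (u \<bullet> x)) \<le> norm c"
    by (simp add: norm_mult)
  then show ?case by (intro conjI) (measurable, blast)
next
  case (add f g)
  then obtain B C where "\<forall>x. norm (f x) \<le> B" "\<forall>x. norm (g x) \<le> C" by blast
  then have "\<forall>x. norm (f x + g x) \<le> B + C"
    by (meson add_mono norm_triangle_le)
  with add show ?case by (intro conjI borel_measurable_add) auto
qed

text \<open>Sends the whole space into the compact cube [-1,1]^d, and its coordinates are
  trigonometric polynomials. Since these form an algebra, every polynomial in
  \<open>sin_vector q x\<close> is again one.\<close>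

definition sin_vector :: "real \<Rightarrow> 'b::euclidean_space \<Rightarrow> 'b" where
  "sin_vector q x = (\<Sum>b\<in>Basis. sin (q * (x \<bullet> b)) *\<^sub>R b)"

lemma sin_vector_inner: "b \<in> Basis \<Longrightarrow> sin_vector q x \<bullet> b = sin (q * (x \<bullet> b))"
  by (simp add: sin_vector_def)

lemma trig_polynomial_sin_vector:
  assumes "real_polynomial_function (f :: 'b::euclidean_space \<Rightarrow> real)"
  shows "trig_polynomial (\<lambda>x. of_real (f (sin_vector q x)))"
  using assms
proof (induction rule: real_polynomial_function.induct)
  case (linear f)
  interpret bounded_linear f by fact
  have "(\<lambda>x. complex_of_real (f (sin_vector q x))) =
      (\<lambda>x. \<Sum>b\<in>Basis. of_real (f b) * of_real (sin ((q *\<^sub>R b) \<bullet> x)))"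
    by (simp add: sin_vector_def sum scale inner_commute mult.commute)
  moreover have "trig_polynomial \<dots>"
    by (intro trig_polynomial_sum trig_polynomial_sin) simp
  ultimately show ?case by simp
qed (simp_all add: trig_polynomial_const trig_polynomial.add trig_polynomial_mult)

text \<open>
  With \<open>q\<close> small, \<open>x \<mapsto> \<Sum>b. arcsin (sin (q (x \<bullet> b))) / q b\<close> is the identity on a large box and takes
  values in a compact box everywhere; composing with it makes a polynomial approximation uniform on
  the whole space.
\<close>

lemma approx_by_trig_polynomial:
  fixes f :: "'b::euclidean_space \<Rightarrow> real"
  assumes f: "continuous_on UNIV f" and q: "q > 0" and e: "e > 0"
  obtains h :: "'b \<Rightarrow> real" and p
  where "range h \<subseteq> range f" "continuous_on UNIV h"
    "\<And>x. \<forall>b\<in>Basis. \<bar>x \<bullet> b\<bar> \<le> pi / (2 * q) \<Longrightarrow> h x = f x"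
    "trig_polynomial (\<lambda>x. of_real (p x))" "\<And>x. \<bar>h x - p x\<bar> < e"
proof -
  define S :: "'b set" where "S = cbox (- One) One"
  define H where "H = (\<lambda>y :: 'b. f (\<Sum>b\<in>Basis. (arcsin (y \<bullet> b) / q) *\<^sub>R b))"
  have "continuous_on S H"
    unfolding H_def S_def
    by (intro continuous_on_compose2[OF f] continuous_intros) (use q in \<open>auto simp: mem_box\<close>)
  then obtain p where p: "real_polynomial_function p" "\<And>x. x \<in> S \<Longrightarrow> \<bar>H x - p x\<bar> < e"
    using Stone_Weierstrass_real_polynomial_function[OF _ _ e, of S H] by (auto simp: S_def)
  have S: "sin_vector q x \<in> S" for x
    by (simp add: S_def mem_box sin_vector_inner)
  show thesis
  proof
    show "range (\<lambda>x. H (sin_vector q x)) \<subseteq> range f"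
      by (auto simp: H_def)
    show "continuous_on UNIV (\<lambda>x. H (sin_vector q x))"
      by (rule continuous_on_compose2[OF \<open>continuous_on S H\<close>])
        (use S in \<open>auto simp: sin_vector_def intro!: continuous_intros\<close>)
    show "H (sin_vector q x) = f x" if x: "\<forall>b\<in>Basis. \<bar>x \<bullet> b\<bar> \<le> pi / (2 * q)" for x
    proof -
      \<comment> \<open>\<open>arcsin\<close> inverts \<open>sin\<close> only on [-pi/2, pi/2]; this
        is where the half-width pi / (2 q) of the box comes from.\<close>
      have "arcsin (sin (q * (x \<bullet> b))) / q = x \<bullet> b" if "b \<in> Basis" for b
      proof -
        have "\<bar>q * (x \<bullet> b)\<bar> \<le> pi / 2"
          using mult_left_mono[OF bspec[OF x that], of q] q by (simp add: abs_mult)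
        then show ?thesis using q by (simp add: arcsin_sin abs_le_iff)
      qed
      then show ?thesis
        by (simp add: H_def sin_vector_inner euclidean_representation)
    qed
    show "trig_polynomial (\<lambda>x. of_real (p (sin_vector q x)))"
      by (rule trig_polynomial_sin_vector[OF p(1)])
    show "\<bar>H (sin_vector q x) - p (sin_vector q x)\<bar> < e" for x
      using p(2) S by blast
  qed
qed

lemma (in prob_space) tendsto_trig_polynomial:
  fixes Y :: "nat \<Rightarrow> 'a \<Rightarrow> 'b::euclidean_space"
  assumes Y: "\<And>n. Y n \<in> borel_measurable M" and N: "prob_space N" "sets N = sets borel"
    and conv: "\<And>u. (\<lambda>n. CLINT w|M. iexp (u \<bullet> Y n w)) \<longlonglongrightarrow> (CLINT x|N. iexp (u \<bullet> x))"
    and h: "trig_polynomial h"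
  shows "(\<lambda>n. CLINT w|M. h (Y n w)) \<longlonglongrightarrow> (CLINT x|N. h x)"
  using h
proof (induction rule: trig_polynomial.induct)
  case (monomial c u)
  then show ?case using conv[of u] by (simp add: tendsto_mult_left)
next
  case (add f g)
  interpret N: prob_space N by fact
  have int: "integrable M (\<lambda>w. k (Y n w))" "integrable N k" if k: "trig_polynomial k" for k n
  proof -
    obtain B where B: "k \<in> borel_measurable borel" "\<forall>x. norm (k x) \<le> B"
      using trig_polynomial_bounded_measurable[OF k] by blast
    show "integrable M (\<lambda>w. k (Y n w))"
      using B by (intro integrable_const_bound[of _ B] measurable_compose[OF Y]) auto
    show "integrable N k"
      using B by (intro N.integrable_const_bound[of _ B]) (auto simp: measurable_cong_sets[OF N(2)])
  qed
  from tendsto_add[OF add.IH] show ?case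
    using add.hyps by (simp add: Bochner_Integration.integral_add int)
qed

text \<open>In one dimension Levy's continuity theorem turns the convergence of characteristic
  functions into weak convergence, and the tail of the single law N then controls the tails of all
  late Z n. Applied to each coordinate, this supplies the tightness needed in higher
  dimension.\<close>

lemma (in prob_space) marginal_tight:
  fixes Z :: "nat \<Rightarrow> 'a \<Rightarrow> real"
  assumes Z: "\<And>n. Z n \<in> borel_measurable M" and N: "real_distribution N"
    and conv: "\<And>t. (\<lambda>n. CLINT w|M. iexp (t * Z n w)) \<longlonglongrightarrow> char N t"
    and e: "e > 0"
  shows "\<exists>L. \<forall>\<^sub>F n in sequentially. prob {w \<in> space M. \<bar>Z n w\<bar> > L} < e"
proof -
  interpret N: real_distribution N by fact
  define D where "D n = distr M borel (Z n)" for n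
  have D: "real_distribution (D n)" for n
    unfolding D_def using Z by (intro real_distribution_distr) auto
  have "char (D n) t = (CLINT w|M. iexp (t * Z n w))" for n t
    unfolding char_def D_def by (subst integral_distr) (auto intro: Z)
  then have "weak_conv_m D N"
    using conv by (intro levy_continuity D N) simp
  have "(\<lambda>L. N.prob {x \<in> space N. \<bar>x\<bar> > real L}) \<longlonglongrightarrow> N.prob (\<Inter>L. {x \<in> space N. \<bar>x\<bar> > real L})"
    by (intro N.finite_Lim_measure_decseq) (auto simp: decseq_def)
  also have "(\<Inter>L. {x \<in> space N. \<bar>x\<bar> > real L}) = {}"
    using real_arch_simple by (auto simp: not_less[symmetric])
  finally have "\<forall>\<^sub>F L in sequentially. N.prob {x \<in> space N. \<bar>x\<bar> > real L} < e"
    using e by (auto dest: order_tendstoD)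
  then obtain L :: nat where L: "N.prob {x \<in> space N. \<bar>x\<bar> > real L} < e"
    by (auto simp: eventually_sequentially)
  \<comment> \<open>A continuous function between the indicators of |x| > L + 1 and of |x| > L. The
    lower indicator serves Z n, the upper one serves N, so atoms of N at the endpoints do no
    harm.\<close>
  define f where "f x = max 0 (min 1 (\<bar>x\<bar> - real L))" for x :: real
  have fcont: "isCont f x" for x
    unfolding f_def by (intro continuous_intros)
  have fb: "norm (f x) \<le> 1" for x by (simp add: f_def)
  have fm[measurable]: "f \<in> borel_measurable borel" unfolding f_def by measurable
  have "(\<lambda>n. integral\<^sup>L (D n) f) \<longlonglongrightarrow> integral\<^sup>L N f"
    using weak_conv_imp_integral_bdd_continuous_conv[OF D N \<open>weak_conv_m D N\<close> fcont fb] .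
  moreover have "integral\<^sup>L N f < e"
  proof -
    have "integral\<^sup>L N f \<le> (\<integral>x. indicator {x \<in> space N. \<bar>x\<bar> > real L} x \<partial>N)"
      by (intro integral_mono N.integrable_const_bound[of _ 1] AE_I2 fb)
        (auto simp: f_def split: split_indicator)
    also have "\<dots> = N.prob {x \<in> space N. \<bar>x\<bar> > real L}" by simp
    finally show ?thesis using L by simp
  qed
  ultimately have "\<forall>\<^sub>F n in sequentially. integral\<^sup>L (D n) f < e"
    by (rule order_tendstoD)
  moreover have "prob {w \<in> space M. \<bar>Z n w\<bar> > real L + 1} \<le> integral\<^sup>L (D n) f" for n
  proof -
    note Z[measurable]
    have "prob {w \<in> space M. \<bar>Z n w\<bar> > real L + 1}
        = (\<integral>w. indicator {w \<in> space M. \<bar>Z n w\<bar> > real L + 1} w \<partial>M)" by simp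
    also have "\<dots> \<le> (\<integral>w. f (Z n w) \<partial>M)"
      by (intro integral_mono integrable_const_bound[of _ 1] AE_I2 fb)
        (auto simp: f_def split: split_indicator)
    also have "\<dots> = integral\<^sup>L (D n) f"
      unfolding D_def by (subst integral_distr) (auto intro: Z)
    finally show ?thesis .
  qed
  ultimately show ?thesis
    by (intro exI[of _ "real L + 1"]) (auto elim!: eventually_mono intro: le_less_trans)
qed

text \<open>Up to small probability tightness confines all late Y n and the limit N to one box.
  There f equals a function h that is uniformly close to a trigonometric polynomial p, and the
  expectations of p converge. Outside the box f and h are merely bounded by C.\<close>

theorem (in prob_space) converges_in_distributionI_char:
  fixes Y :: "nat \<Rightarrow> 'a \<Rightarrow> 'b::euclidean_space"
  assumes Y: "\<And>n. Y n \<in> borel_measurable M" and N: "prob_space N" "sets N = sets borel"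
    and conv: "\<And>u. (\<lambda>n. CLINT w|M. iexp (u \<bullet> Y n w)) \<longlonglongrightarrow> (CLINT x|N. iexp (u \<bullet> x))"
  shows "converges_in_distribution M Y N"
  unfolding converges_in_distribution_def
proof (intro conjI allI impI Y)
  fix f :: "'b \<Rightarrow> real"
  assume f: "continuous_on UNIV f" and "bounded (range f)"
  then obtain C where C: "\<And>x. \<bar>f x\<bar> \<le> C" by (auto simp: bounded_iff)
  interpret N: prob_space N by fact
  note [measurable] = Y
  note [measurable_cong] = N(2)
  have [simp]: "space N = UNIV" using sets_eq_imp_space_eq[OF N(2)] by simp
  have C0: "0 \<le> C" using C[of 0] by linarith
  define good where "good L = {x :: 'b. \<forall>b\<in>Basis. \<bar>x \<bullet> b\<bar> \<le> L}" for L :: real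
  have good_mono: "good L \<subseteq> good L'" if "L \<le> L'" for L L'
    unfolding good_def using that by fastforce
  have "good L = (\<Inter>b\<in>Basis. {x. \<bar>x \<bullet> b\<bar> \<le> L})" for L
    by (auto simp: good_def)
  moreover have "closed (\<Inter>b\<in>Basis. {x :: 'b. \<bar>x \<bullet> b\<bar> \<le> L})" for L
    by (intro closed_INT ballI closed_Collect_le continuous_intros)
  ultimately have [measurable]: "good L \<in> sets borel" for L by simp
  show "(\<lambda>n. \<integral>w. f (Y n w) \<partial>M) \<longlonglongrightarrow> (\<integral>x. f x \<partial>N)"
  proof (rule LIMSEQ_I)
    fix e :: real assume e: "e > 0"
    \<comment> \<open>Probability allowed outside the box. There f and h differ by at most 2 C,
      which costs 2 C d <= e / 3; the summand 1 keeps the denominator positive.\<close>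
    define d where "d = e / (6 * (C + 1))"
    have d: "d > 0" using e C0 by (simp add: d_def)
    have d': "d * C \<le> e / 6" using e C0 by (simp add: d_def field_simps)
    define m where "m = real (DIM('b))"
    have m: "m > 0" by (simp add: m_def)
    have "\<exists>L. \<forall>\<^sub>F n in sequentially. prob {w \<in> space M. \<bar>Y n w \<bullet> b\<bar> > L} < d / m" for b :: 'b
    proof (rule marginal_tight)
      show "real_distribution (distr N borel (\<lambda>x. x \<bullet> b))"
        by (intro N.real_distribution_distr) simp
      show "(\<lambda>n. CLINT w|M. iexp (t * (Y n w \<bullet> b))) \<longlonglongrightarrow> char (distr N borel (\<lambda>x. x \<bullet> b)) t" for t
        using conv[of "t *\<^sub>R b"]
        by (simp add: char_def integral_distr inner_commute[of b] cong: Bochner_Integration.integral_cong)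
    qed (use d m in auto)
    then have "\<forall>b. \<exists>L. \<forall>\<^sub>F n in sequentially. prob {w \<in> space M. \<bar>Y n w \<bullet> b\<bar> > L} < d / m"
      by blast
    from choice[OF this] obtain L1
      where L1: "\<And>b. \<forall>\<^sub>F n in sequentially. prob {w \<in> space M. \<bar>Y n w \<bullet> b\<bar> > L1 b} < d / m"
      by blast
    have "(\<lambda>L. N.prob (good (real L))) \<longlonglongrightarrow> N.prob (\<Union>L. good (real L))"
      by (intro N.finite_Lim_measure_incseq) (auto simp: incseq_def intro!: good_mono)
    also have "(\<Union>L. good (real L)) = UNIV"
    proof safe
      fix x :: 'b
      obtain L :: nat where "norm x \<le> L" using real_arch_simple by blast
      then have "\<bar>x \<bullet> b\<bar> \<le> real L" if "b \<in> Basis" for b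
        using Basis_le_norm[OF that, of x] by linarith
      then have "x \<in> good L" by (simp add: good_def)
      then show "x \<in> (\<Union>L. good (real L))" by blast
    qed simp
    finally have "(\<lambda>L. N.prob (good (real L))) \<longlonglongrightarrow> 1" using N.prob_space by simp
    then have "\<forall>\<^sub>F L in sequentially. N.prob (good (real L)) > 1 - d"
      using d by (intro order_tendstoD) auto
    then obtain L2 :: nat where L2: "N.prob (good (real L2)) > 1 - d"
      by (auto simp: eventually_sequentially)
    \<comment> \<open>One half-width that serves every coordinate of Y n and also N; the element 1
      ensures L > 0, so that q below is well defined.\<close>
    define L where "L = Max (insert (real L2) (insert 1 (L1 ` Basis)))"
    have L: "L1 b \<le> L" if "b \<in> Basis" for b
      unfolding L_def using that by (intro Max_ge) auto
    have L': "real L2 \<le> L" "1 \<le> L" unfolding L_def by (intro Max_ge; simp)+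
    define q where "q = pi / (2 * L)"
    have q: "q > 0" using L' by (simp add: q_def)
    have qL: "pi / (2 * q) = L" using L' by (simp add: q_def)
    have "e / 12 > 0" using e by simp
    from approx_by_trig_polynomial[OF f q this, unfolded qL] obtain h p where h: "range h \<subseteq> range f" "continuous_on UNIV h"
      and hf: "\<And>x. x \<in> good L \<Longrightarrow> h x = f x"
      and p: "trig_polynomial (\<lambda>x. of_real (p x))" and hp: "\<And>x. \<bar>h x - p x\<bar> < e / 12"
      unfolding good_def mem_Collect_eq by blast
    have hC: "\<bar>h x\<bar> \<le> C" for x using h(1) C by (metis image_subset_iff rangeE UNIV_I)
    have [measurable]: "f \<in> borel_measurable borel" "h \<in> borel_measurable borel"
      using f h(2) by (auto intro: borel_measurable_continuous_onI)
    have "(\<lambda>x. complex_of_real (p x)) \<in> borel_measurable borel"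
      using trig_polynomial_bounded_measurable[OF p] by blast
    from measurable_compose[OF this borel_measurable_Re] have [measurable]: "p \<in> borel_measurable borel"
      by simp
    have pC: "\<bar>p x\<bar> \<le> C + e" for x using hp[of x] hC[of x] e by linarith
    have close: "\<bar>f x - p x\<bar> \<le> e / 12 + 2 * C * indicator (- good L) x" for x
      using hf[of x] hp[of x] C[of x] hC[of x] unfolding indicator_def by (cases "x \<in> good L"; simp; linarith)
    \<comment> \<open>Used for Y n under M and for the identity under N. Each use costs e/12 + e/3 =
      5e/12, and the convergence for p costs e/12, in total 11e/12.\<close>
    have split: "\<bar>(\<integral>w. f (W w) \<partial>R) - (\<integral>w. p (W w) \<partial>R)\<bar> \<le> 5 * e / 12"
      if R: "prob_space R" and W[measurable]: "W \<in> borel_measurable R"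
        and bad: "measure R {w \<in> space R. W w \<notin> good L} < d" for R :: "'c measure" and W
    proof -
      interpret R: prob_space R by fact
      have int: "integrable R (\<lambda>w. f (W w))" "integrable R (\<lambda>w. p (W w))"
        using C pC by (auto intro: R.integrable_const_bound[of _ C] R.integrable_const_bound[of _ "C + e"])
      have ind: "integrable R (\<lambda>w. indicator {w \<in> space R. W w \<notin> good L} w :: real)"
        by (intro R.integrable_const_bound[of _ 1]) auto
      have "\<bar>(\<integral>w. f (W w) \<partial>R) - (\<integral>w. p (W w) \<partial>R)\<bar> = \<bar>\<integral>w. f (W w) - p (W w) \<partial>R\<bar>"
        using int by simp
      also have "\<dots> \<le> (\<integral>w. \<bar>f (W w) - p (W w)\<bar> \<partial>R)"
        by (rule integral_abs_bound)
      also have "\<dots> \<le> (\<integral>w. e / 12 + 2 * C * indicator {w \<in> space R. W w \<notin> good L} w \<partial>R)"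
        using int ind close
        by (intro integral_mono integrable_abs Bochner_Integration.integrable_diff
            Bochner_Integration.integrable_add integrable_mult_right)
          (auto simp: indicator_def split: if_splits)
      also have "\<dots> = e / 12 + 2 * C * measure R {w \<in> space R. W w \<notin> good L}"
        using ind by (subst Bochner_Integration.integral_add) (auto simp: R.prob_space)
      also have "2 * C * measure R {w \<in> space R. W w \<notin> good L} \<le> 2 * C * d"
        using bad C0 by (intro mult_left_mono) auto
      also have "2 * C * d \<le> e / 3" using d' by (simp add: mult.commute)
      finally show ?thesis using e by simp
    qed
    have "(\<lambda>n. CLINT w|M. of_real (p (Y n w))) \<longlonglongrightarrow> (CLINT x|N. of_real (p x))"
      by (rule tendsto_trig_polynomial[OF Y N conv p])
    then have "(\<lambda>n. \<integral>w. p (Y n w) \<partial>M) \<longlonglongrightarrow> (\<integral>x. p x \<partial>N)"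
      by (simp add: tendsto_of_real_iff)
    then have "\<forall>\<^sub>F n in sequentially. dist (\<integral>w. p (Y n w) \<partial>M) (\<integral>x. p x \<partial>N) < e / 12"
      using e by (intro tendstoD) auto
    moreover have "\<forall>\<^sub>F n in sequentially. \<forall>b\<in>Basis. prob {w \<in> space M. \<bar>Y n w \<bullet> b\<bar> > L1 b} < d / m"
      using L1 by (intro eventually_ball_finite) auto
    ultimately have "\<forall>\<^sub>F n in sequentially. norm ((\<integral>w. f (Y n w) \<partial>M) - (\<integral>x. f x \<partial>N)) < e"
    proof eventually_elim
      case (elim n)
      have "prob {w \<in> space M. Y n w \<notin> good L} \<le> prob (\<Union>b\<in>Basis. {w \<in> space M. \<bar>Y n w \<bullet> b\<bar> > L1 b})"
        using L by (intro finite_measure_mono) (auto simp: good_def not_le intro: le_less_trans)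
      also have "\<dots> \<le> (\<Sum>b\<in>Basis. prob {w \<in> space M. \<bar>Y n w \<bullet> b\<bar> > L1 b})"
        by (intro finite_measure_subadditive_finite) auto
      also have "\<dots> < (\<Sum>b\<in>(Basis :: 'b set). d / m)"
        using elim by (intro sum_strict_mono) auto
      also have "\<dots> = d" using m by (simp add: m_def)
      finally have 1: "\<bar>(\<integral>w. f (Y n w) \<partial>M) - (\<integral>w. p (Y n w) \<partial>M)\<bar> \<le> 5 * e / 12"
        by (intro split prob_space_axioms Y)
      have "N.prob {x \<in> space N. x \<notin> good L} = 1 - N.prob (good L)"
        using N.prob_compl[of "good L"] by (simp add: Compl_eq_Diff_UNIV[symmetric] Collect_neg_eq)
      moreover have "N.prob (good (real L2)) \<le> N.prob (good L)"
        using L' by (intro N.finite_measure_mono good_mono) auto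
      ultimately have "N.prob {x \<in> space N. x \<notin> good L} < d" using L2 by linarith
      then have 2: "\<bar>(\<integral>x. f x \<partial>N) - (\<integral>x. p x \<partial>N)\<bar> \<le> 5 * e / 12"
        by (intro split N) auto
      show ?case using 1 2 elim(1) e unfolding dist_real_def real_norm_def by linarith
    qed
    then show "\<exists>n0. \<forall>n\<ge>n0. norm ((\<integral>w. f (Y n w) \<partial>M) - (\<integral>x. f x \<partial>N)) < e"
      by (simp add: eventually_sequentially)
  qed
qed

section \<open>Existence of normal laws\<close>

lemma std_normal_exponential_integral:
  "(CLINT x|std_normal_distribution. iexp (t * x)) = of_real (exp (- t\<^sup>2 / 2))"
  using fun_cong[OF char_std_normal_distribution, of t] by (simp add: char_def)

text \<open>The law of R Z for a vector Z of independent standard normal variables. No density is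
  involved, so singular covariances are covered.\<close>

lemma normal_law_exists:
  fixes R :: "real^'k^'n"
  shows "\<exists>N. normal_law N 0 (R ** transpose R)"
proof -
  interpret G: product_prob_space "\<lambda>_ :: 'k. std_normal_distribution"
    by (intro product_prob_spaceI prob_space_normal_density) simp
  define GG where "GG = Pi\<^sub>M (UNIV :: 'k set) (\<lambda>_. std_normal_distribution)"
  define L :: "('k \<Rightarrow> real) \<Rightarrow> real^'n" where "L x = R *v (\<chi> k. x k)" for x
  interpret GG: prob_space GG
    unfolding GG_def by (rule prob_space_PiM) (rule prob_space_normal_density, simp)
  have [measurable]: "(\<lambda>x. x k) \<in> borel_measurable GG" for k
    unfolding GG_def by measurable
  have [measurable]: "L \<in> borel_measurable GG"
    unfolding L_def matrix_mult_sum scalar_mult_eq_scaleR by simp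
  \<comment> \<open>A linear form of R Z is a weighted sum of independent coordinates, so its
    characteristic function factorises.\<close>
  have inner_L: "u \<bullet> L x = (\<Sum>k\<in>UNIV. (u v* R) $ k * x k)" for u x
    by (simp add: L_def dot_lmul_matrix[of u R, symmetric]) (simp add: inner_vec_def)
  have "normal_law (distr GG borel L) 0 (R ** transpose R)"
    unfolding normal_law_def
  proof (intro conjI allI)
    show "prob_space (distr GG borel L)" by (intro GG.prob_space_distr) simp
    show "transpose (R ** transpose R) = R ** transpose R"
      by (simp add: matrix_transpose_mul)
    fix u :: "real^'n"
    define b where "b = u v* R"
    have "(CLINT x|distr GG borel L. iexp (u \<bullet> x)) = (CLINT x|GG. iexp (u \<bullet> L x))"
      by (subst integral_distr) auto
    also have "\<dots> = (CLINT x|GG. (\<Prod>k\<in>UNIV. iexp (b $ k * x k)))"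
      by (simp add: inner_L b_def[symmetric] exp_sum[symmetric] sum_distrib_left)
    also have "\<dots> = (\<Prod>k\<in>UNIV. CLINT x|std_normal_distribution. iexp (b $ k * x))"
      unfolding GG_def
      by (intro G.product_integral_prod finite_measure.integrable_const_bound[of _ _ 1] prob_space.finite_measure prob_space_normal_density) auto
    also have "\<dots> = of_real (\<Prod>k\<in>UNIV. exp (- (b $ k)\<^sup>2 / 2))"
      by (simp only: std_normal_exponential_integral of_real_prod)
    also have "(\<Prod>k\<in>UNIV. exp (- (b $ k)\<^sup>2 / 2)) = exp (- (b \<bullet> b) / 2)"
      by (simp add: exp_sum[symmetric] inner_vec_def sum_negf sum_divide_distrib power2_eq_square)
    also have "b \<bullet> b = u \<bullet> ((R ** transpose R) *v u)"
      unfolding b_def by (simp add: matrix_vector_mul_assoc[symmetric] dot_lmul_matrix)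
    finally show "(CLINT x|distr GG borel L. iexp (u \<bullet> x))
        = exp (\<i> * of_real (u \<bullet> 0) - of_real (u \<bullet> ((R ** transpose R) *v u)) / 2)"
      by (simp add: exp_of_real[symmetric])
  qed simp
  then show ?thesis by blast
qed

section \<open>Martingale structure of controlled Markov chains\<close>

text \<open>A finite history takes finitely many values, so expectations of its functions are finite
  sums and conditional expectations can be handled as elementary ratios.\<close>

lemma (in prob_space) expectation_finite_range:
  fixes g :: "'c \<Rightarrow> 'b::{banach, second_countable_topology}"
  assumes A: "finite A" "\<And>w. w \<in> space M \<Longrightarrow> Y w \<in> A"
    and ev: "\<And>y. y \<in> A \<Longrightarrow> {w \<in> space M. Y w = y} \<in> events"
  shows "integrable M (\<lambda>w. g (Y w))"
    and "expectation (\<lambda>w. g (Y w)) = (\<Sum>y\<in>A. prob {w \<in> space M. Y w = y} *\<^sub>R g y)"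
proof -
  have eq: "g (Y w) = (\<Sum>y\<in>A. indicator {w \<in> space M. Y w = y} w *\<^sub>R g y)" if "w \<in> space M" for w
  proof -
    have "(\<Sum>y\<in>A. indicator {w \<in> space M. Y w = y} w *\<^sub>R g y) = (\<Sum>y\<in>A. if y = Y w then g y else 0)"
      using that by (intro sum.cong) (auto simp: indicator_def)
    then show ?thesis using A that by simp
  qed
  have int: "integrable M (\<lambda>w. indicator {w \<in> space M. Y w = y} w *\<^sub>R g y)" if "y \<in> A" for y
    using ev[OF that] by (intro integrable_scaleR_left) (auto simp: emeasure_eq_measure)
  show "integrable M (\<lambda>w. g (Y w))"
    by (subst Bochner_Integration.integrable_cong[OF refl eq])
      (auto intro!: Bochner_Integration.integrable_sum int)
  have "expectation (\<lambda>w. g (Y w)) = expectation (\<lambda>w. \<Sum>y\<in>A. indicator {w \<in> space M. Y w = y} w *\<^sub>R g y)"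
    by (intro Bochner_Integration.integral_cong refl eq)
  also have "\<dots> = (\<Sum>y\<in>A. expectation (\<lambda>w. indicator {w \<in> space M. Y w = y} w *\<^sub>R g y))"
    by (intro Bochner_Integration.integral_sum int)
  also have "\<dots> = (\<Sum>y\<in>A. prob {w \<in> space M. Y w = y} *\<^sub>R g y)"
    using ev by (intro sum.cong) (auto simp: emeasure_eq_measure)
  finally show "expectation (\<lambda>w. g (Y w)) = (\<Sum>y\<in>A. prob {w \<in> space M. Y w = y} *\<^sub>R g y)" .
qed

section \<open>Finite histories and the one-step transition rule\<close>

context controlled_markov_chain
begin

definition hists :: "nat \<Rightarrow> ('s \<times> 'a) list set" where
  "hists n = {h. length h = n}"

abbreviation hist_prob :: "('s \<times> 'a) list \<Rightarrow> real" where
  "hist_prob h \<equiv> \<P>(w in P. path X a 0 (length h) w = h)"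

lemma finite_hists: "finite (hists n)"
  using finite_lists_length_eq[of "UNIV :: ('s \<times> 'a) set" n] by (simp add: hists_def)

lemma length_path: "length (path X a 0 n w) = n"
  by (simp add: path_def)

lemma path_in_hists: "path X a 0 n w \<in> hists n"
  by (simp add: hists_def length_path)

lemma path_Suc: "path X a 0 (Suc n) w = path X a 0 n w @ [(X n w, a n w)]"
  by (simp add: path_def)

lemma nth_path: "i < n \<Longrightarrow> path X a 0 n w ! i = (X i w, a i w)"
  by (simp add: path_def)

lemma measurable_path: "path X a 0 n \<in> P \<rightarrow>\<^sub>M count_space UNIV"
proof (induction n)
  case 0
  then show ?case by (simp add: path_def)
next
  case (Suc n)
  note [measurable] = Suc measurable_state measurable_action
  show ?case unfolding path_Suc by measurable
qed

lemma
  fixes F :: "('s \<times> 'a) list \<Rightarrow> 'b::{banach, second_countable_topology}"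
  shows integrable_path: "integrable P (\<lambda>w. F (path X a 0 n w))"
    and expectation_path: "expectation (\<lambda>w. F (path X a 0 n w)) = (\<Sum>h\<in>hists n. hist_prob h *\<^sub>R F h)"
proof -
  note [measurable] = measurable_path[of n]
  note * = expectation_finite_range[OF finite_hists path_in_hists, where g = F]
  show "integrable P (\<lambda>w. F (path X a 0 n w))" by (rule *) measurable
  show "expectation (\<lambda>w. F (path X a 0 n w)) = (\<Sum>h\<in>hists n. hist_prob h *\<^sub>R F h)"
    by (subst *) (measurable, auto simp: hists_def intro!: sum.cong)
qed

text \<open>The Markov property in product form. Without a quotient it also holds for histories of
  probability zero, where both sides vanish, so later sums may run over all histories.\<close>

lemma prob_path_state:
  assumes h: "length h = Suc j"
  shows "\<P>(w in P. path X a 0 (Suc j) w = h \<and> X (Suc j) w = t) =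
    \<P>(w in P. path X a 0 (Suc j) w = h) * M $ (last h) $ t"
proof -
  obtain h' s l where h': "h = h' @ [(s, l)]"
    using h by (metis append_butlast_last_id length_0_conv nat.distinct(1) surj_pair)
  have E: "path X a 0 (Suc j) w = h \<longleftrightarrow> path X a 0 j w = h' \<and> X j w = s \<and> a j w = l" for w
    by (auto simp: path_Suc h')
  note [measurable] = measurable_path measurable_state measurable_action
  let ?A = "\<P>(w in P. path X a 0 j w = h' \<and> X j w = s \<and> a j w = l)"
  let ?B = "\<P>(w in P. X (Suc j) w = t \<and> path X a 0 j w = h' \<and> X j w = s \<and> a j w = l)"
  have "?B = ?A * M $ (s, l) $ t"
  proof (cases "?A > 0")
    case False
    have "?B \<le> ?A" by (intro finite_measure_mono) auto
    moreover have "?A = 0" using False by (simp add: zero_less_measure_iff)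
    ultimately have "?B = 0" by (simp add: measure_le_0_iff)
    with \<open>?A = 0\<close> show ?thesis by simp
  next
    case pos: True
    have "?A \<le> \<P>(w in P. X j w = s \<and> a j w = l)"
      by (intro finite_measure_mono) auto
    with pos have "\<P>(w in P. X (Suc j) w = t \<bar> path X a 0 j w = h' \<and> X j w = s \<and> a j w = l) = M $ (s, l) $ t"
      by (subst markov[OF pos]) (rule transition, linarith)
    then show ?thesis
      using pos unfolding cond_prob_def by (simp add: divide_eq_eq mult.commute)
  qed
  moreover have "\<P>(w in P. path X a 0 (Suc j) w = h \<and> X (Suc j) w = t) = ?B"
    unfolding E by (intro arg_cong[of _ _ prob]) auto
  ultimately show ?thesis unfolding E by (simp add: h')
qed

text \<open>The martingale tool: F may depend on everything up to and including (X_j, a_j), so the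
  choice of a_j is already part of the history and only the row of M at that pair is averaged.
  Values in an algebra allow both the real and the complex use.\<close>

lemma expectation_step:
  fixes F :: "('s \<times> 'a) list \<Rightarrow> 'b::{banach, second_countable_topology, real_normed_algebra}"
  shows "expectation (\<lambda>w. F (path X a 0 (Suc j) w) * f (X j w, a j w) (X (Suc j) w)) =
    expectation (\<lambda>w. F (path X a 0 (Suc j) w) * (\<Sum>t\<in>UNIV. M $ (X j w, a j w) $ t *\<^sub>R f (X j w, a j w) t))"
    (is "?L = ?R")
proof -
  note [measurable] = measurable_path measurable_state measurable_action
  have last: "last (path X a 0 (Suc j) w) = (X j w, a j w)" for w
    by (simp add: path_Suc)
  define Y where "Y w = (path X a 0 (Suc j) w, X (Suc j) w)" for w
  define k where "k = (\<lambda>(h, t). F h * f (last h) t)"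
  have "{w \<in> space P. Y w = y} \<in> events" for y
    by (cases y) (simp add: Y_def)
  then have "expectation (\<lambda>w. k (Y w)) =
      (\<Sum>y\<in>hists (Suc j) \<times> UNIV. \<P>(w in P. Y w = y) *\<^sub>R k y)"
    by (intro expectation_finite_range) (auto simp: finite_hists Y_def path_in_hists)
  also have "(\<lambda>w. k (Y w)) = (\<lambda>w. F (path X a 0 (Suc j) w) * f (X j w, a j w) (X (Suc j) w))"
    by (simp add: k_def Y_def last)
  also have "(\<Sum>y\<in>hists (Suc j) \<times> UNIV. \<P>(w in P. Y w = y) *\<^sub>R k y) =
      (\<Sum>h\<in>hists (Suc j). \<Sum>t\<in>UNIV. \<P>(w in P. path X a 0 (Suc j) w = h \<and> X (Suc j) w = t) *\<^sub>R (F h * f (last h) t))"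
    by (simp add: sum.cartesian_product Y_def k_def case_prod_unfold prod_eq_iff)
  also have "\<dots> = (\<Sum>h\<in>hists (Suc j). hist_prob h *\<^sub>R (F h * (\<Sum>t\<in>UNIV. M $ (last h) $ t *\<^sub>R f (last h) t)))"
    by (intro sum.cong) (simp_all add: prob_path_state hists_def sum_distrib_left scaleR_sum_right)
  also have "\<dots> = ?R"
    using expectation_path[of "\<lambda>h. F h * (\<Sum>t\<in>UNIV. M $ (last h) $ t *\<^sub>R f (last h) t)" "Suc j"]
    by (simp add: last)
  finally show ?thesis .
qed

end

section \<open>Variance of the visit counts under weak mixing\<close>

text \<open>After division by the total mass this says second moment = squared mean + variance, and
  the variance is at most C^2 because each value of positive weight lies within C of the mean. The
  weights stay unnormalised since they will be probabilities of the extensions of one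
  history.\<close>

lemma weighted_variance_le:
  fixes q g :: "'i \<Rightarrow> real"
  assumes fin: "finite A" and q: "\<And>y. y \<in> A \<Longrightarrow> 0 \<le> q y" and C: "0 \<le> C"
    and diff: "\<And>y y'. y \<in> A \<Longrightarrow> y' \<in> A \<Longrightarrow> q y > 0 \<Longrightarrow> q y' > 0 \<Longrightarrow> \<bar>g y - g y'\<bar> \<le> C"
  shows "(\<Sum>y\<in>A. q y * (g y)\<^sup>2) \<le> (\<Sum>y\<in>A. q y * g y)\<^sup>2 / sum q A + C\<^sup>2 * sum q A"
\<comment> \<open>With zero mass all weights vanish, and the quotient is 0 by the convention for
  division by zero.\<close>
proof (cases "sum q A = 0")
  case True
  then have "q y = 0" if "y \<in> A" for y
    using that q fin by (simp add: sum_nonneg_eq_0_iff)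
  then show ?thesis by simp
next
  case False
  define Q where "Q = sum q A"
  have Q: "Q > 0" using False q by (simp add: Q_def sum_nonneg less_le)
  define m where "m = (\<Sum>y\<in>A. q y * g y) / Q"
  have mQ: "(\<Sum>y\<in>A. q y * g y) = m * Q" using Q by (simp add: m_def)
  have "\<bar>g y - m\<bar> \<le> C" if y: "y \<in> A" "q y > 0" for y
  proof -
    have "(g y - m) * Q = (\<Sum>y'\<in>A. q y' * (g y - g y'))"
      using mQ by (simp add: Q_def algebra_simps sum_subtractf sum_distrib_left sum_distrib_right)
    then have "\<bar>g y - m\<bar> * Q = \<bar>\<Sum>y'\<in>A. q y' * (g y - g y')\<bar>"
      using Q by (metis abs_mult abs_of_pos)
    also have "\<dots> \<le> (\<Sum>y'\<in>A. \<bar>q y' * (g y - g y')\<bar>)" by (rule sum_abs)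
    also have "\<dots> \<le> (\<Sum>y'\<in>A. q y' * C)"
    proof (rule sum_mono)
      fix y' assume y': "y' \<in> A"
      show "\<bar>q y' * (g y - g y')\<bar> \<le> q y' * C"
        using diff[OF y(1) y' y(2)] q[OF y'] by (cases "q y' = 0") (auto simp: abs_mult intro: mult_left_mono)
    qed
    also have "\<dots> = C * Q" by (simp add: Q_def sum_distrib_left mult.commute)
    finally show ?thesis using Q by simp
  qed
  then have "(\<Sum>y\<in>A. q y * (g y - m)\<^sup>2) \<le> (\<Sum>y\<in>A. q y * C\<^sup>2)"
    using q C by (intro sum_mono) (metis abs_ge_zero le_less mult_left_mono mult_zero_left order_refl power2_abs power_mono)
  also have "\<dots> = C\<^sup>2 * Q" by (simp add: Q_def sum_distrib_right[symmetric])
  also have "(\<Sum>y\<in>A. q y * (g y - m)\<^sup>2) = (\<Sum>y\<in>A. q y * (g y)\<^sup>2 - 2 * m * (q y * g y) + m\<^sup>2 * q y)"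
    by (intro sum.cong) (auto simp: power2_eq_square algebra_simps)
  also have "\<dots> = (\<Sum>y\<in>A. q y * (g y)\<^sup>2) - 2 * m * (m * Q) + m\<^sup>2 * Q"
    by (simp add: sum.distrib sum_subtractf sum_distrib_left[symmetric] mQ Q_def[symmetric])
  finally have "(\<Sum>y\<in>A. q y * (g y)\<^sup>2) \<le> m\<^sup>2 * Q + C\<^sup>2 * Q"
    by (simp add: power2_eq_square algebra_simps)
  then show ?thesis using Q unfolding mQ Q_def[symmetric] by (simp add: power2_eq_square)
qed

context controlled_markov_chain
begin

abbreviation visit_prob :: "nat \<Rightarrow> 's \<times> 'a \<Rightarrow> real" where
  "visit_prob j z \<equiv> \<P>(w in P. X j w = fst z \<and> a j w = snd z)"

text \<open>The conditional expectation of the number of visits to z before time n, given that the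
  history is h. Along the path this is the Doob martingale of the visit count; on null histories it
  is 0.\<close>

definition cond_visits :: "nat \<Rightarrow> 's \<times> 'a \<Rightarrow> ('s \<times> 'a) list \<Rightarrow> real" where
  "cond_visits n z h = (\<Sum>j<n. \<P>(w in P. (X j w, a j w) = z \<and> path X a 0 (length h) w = h)) / hist_prob h"

lemma hist_prob_append:
  "(\<Sum>y\<in>UNIV. \<P>(w in P. Q w \<and> path X a 0 (Suc (length h)) w = h @ [y])) = \<P>(w in P. Q w \<and> path X a 0 (length h) w = h)"
  if Q: "Measurable.pred P Q"
proof -
  note [measurable] = measurable_path Q
  have "{w \<in> space P. Q w \<and> path X a 0 (length h) w = h} =
      (\<Union>y\<in>UNIV. {w \<in> space P. Q w \<and> path X a 0 (Suc (length h)) w = h @ [y]})"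
    by (auto simp: path_Suc)
  then show ?thesis
    by (simp only:) (rule finite_measure_finite_Union[symmetric], auto simp: disjoint_family_on_def)
qed

lemma eta_bar_upper:
  assumes j: "i < j" "j \<le> n" and h: "length h = i"
    and pos: "hist_prob (h @ [y1]) > 0" "hist_prob (h @ [y2]) > 0"
  shows "\<bar>\<P>(w in P. (X j w, a j w) = z \<bar> path X a 0 (Suc i) w = h @ [y1])
    - \<P>(w in P. (X j w, a j w) = z \<bar> path X a 0 (Suc i) w = h @ [y2])\<bar> \<le> eta_bar P X a n i j"
proof -
  note [measurable] = measurable_path measurable_state measurable_action
  \<comment> \<open>The event (X_j, a_j) = z as a set of future paths: only the first entry is
    constrained. The path is nonempty because j <= n.\<close>
  define B where "B = {xs. length xs = n - j + 1 \<and> hd xs = z}"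
  have B: "path X a j (Suc n) w \<in> B \<longleftrightarrow> (X j w, a j w) = z" for w
    using j by (auto simp: B_def path_def upt_conv_Cons simp del: upt_Suc)
  have E: "X i w = fst y \<and> a i w = snd y \<and> path X a 0 i w = h \<longleftrightarrow> path X a 0 (Suc i) w = h @ [y]" for w y
    by (auto simp: path_Suc)
  \<comment> \<open>The supremum of a set of reals dominates its elements only if the set is bounded
    above; here 1 is a bound, since conditional probabilities lie in [0,1].\<close>
  have cond_le_1: "\<P>(w in P. Q w \<bar> R w) \<in> {0..1}" if "Measurable.pred P R" for Q R
  proof -
    have "\<P>(w in P. Q w \<and> R w) \<le> \<P>(w in P. R w)"
      using that by (intro finite_measure_mono) auto
    then show ?thesis unfolding cond_prob_def by (auto simp: divide_le_eq_1 measure_nonneg less_le)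
  qed
  have cond_diff_le_1: "\<bar>\<P>(w in P. Q w \<bar> R w) - \<P>(w in P. Q' w \<bar> R' w)\<bar> \<le> 1"
    if "Measurable.pred P R" "Measurable.pred P R'" for Q R Q' R'
    using cond_le_1[OF that(1), of Q] cond_le_1[OF that(2), of Q'] by auto
  show ?thesis
    unfolding eta_bar_def
  proof (rule cSup_upper)
    show "bdd_above
     {\<bar>\<P>(w in P. path X a j (Suc n) w \<in> B \<bar> X i w = s1 \<and> a i w = l1 \<and> path X a 0 i w = h)
       - \<P>(w in P. path X a j (Suc n) w \<in> B \<bar> X i w = s2 \<and> a i w = l2 \<and> path X a 0 i w = h)\<bar>
      | B s1 l1 s2 l2 h.
        B \<subseteq> {xs. length xs = n - j + 1} \<and> length h = i \<and>
        \<P>(w in P. X i w = s1 \<and> a i w = l1 \<and> path X a 0 i w = h) > 0 \<and>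
        \<P>(w in P. X i w = s2 \<and> a i w = l2 \<and> path X a 0 i w = h) > 0}"
      by (rule bdd_aboveI[of _ 1], clarsimp, rule cond_diff_le_1, measurable)
    show "\<bar>\<P>(w in P. (X j w, a j w) = z \<bar> path X a 0 (Suc i) w = h @ [y1])
      - \<P>(w in P. (X j w, a j w) = z \<bar> path X a 0 (Suc i) w = h @ [y2])\<bar> \<in>
     {\<bar>\<P>(w in P. path X a j (Suc n) w \<in> B \<bar> X i w = s1 \<and> a i w = l1 \<and> path X a 0 i w = h)
       - \<P>(w in P. path X a j (Suc n) w \<in> B \<bar> X i w = s2 \<and> a i w = l2 \<and> path X a 0 i w = h)\<bar>
      | B s1 l1 s2 l2 h.
        B \<subseteq> {xs. length xs = n - j + 1} \<and> length h = i \<and>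
        \<P>(w in P. X i w = s1 \<and> a i w = l1 \<and> path X a 0 i w = h) > 0 \<and>
        \<P>(w in P. X i w = s2 \<and> a i w = l2 \<and> path X a 0 i w = h) > 0}"
    proof (rule CollectI, rule exI[of _ B], rule exI[of _ "fst y1"], rule exI[of _ "snd y1"],
        rule exI[of _ "fst y2"], rule exI[of _ "snd y2"], rule exI[of _ h], intro conjI)
      show "B \<subseteq> {xs. length xs = n - j + 1}" by (auto simp: B_def)
      show "\<P>(w in P. X i w = fst y1 \<and> a i w = snd y1 \<and> path X a 0 i w = h) > 0"
        "\<P>(w in P. X i w = fst y2 \<and> a i w = snd y2 \<and> path X a 0 i w = h) > 0"
        unfolding E using pos h by simp_all
    qed (simp_all only: B E h)
  qed
qed

text \<open>When only the pair at time i is changed, visits before i are fixed by h, the visit at i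
  changes by at most 1, and a visit at j > i changes in probability by at most the mixing
  coefficient of (i, j). The total is row i of \<open>Delta_norm\<close>; row 0 belongs to the
  disclosure of (X_0, a_0).\<close>

lemma cond_visits_diff:
  assumes i: "i < n" and h: "length h = i"
    and pos: "hist_prob (h @ [y1]) > 0" "hist_prob (h @ [y2]) > 0"
  shows "\<bar>cond_visits n z (h @ [y1]) - cond_visits n z (h @ [y2])\<bar> \<le> Delta_norm P X a n"
proof -
  define D where "D y j = \<P>(w in P. (X j w, a j w) = z \<bar> path X a 0 (Suc i) w = h @ [y])" for y j
  have known: "D y j = of_bool ((h @ [y]) ! j = z)" if "j \<le> i" "hist_prob (h @ [y]) > 0" for y j
  proof -
    have "(X j w, a j w) = (h @ [y]) ! j" if "path X a 0 (Suc i) w = h @ [y]" for w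
      using nth_path[of j "Suc i" w] that \<open>j \<le> i\<close> by simp
    then have "{w \<in> space P. (X j w, a j w) = z \<and> path X a 0 (Suc i) w = h @ [y]} =
      (if (h @ [y]) ! j = z then {w \<in> space P. path X a 0 (Suc i) w = h @ [y]} else {})"
      by auto
    then show ?thesis using that(2) h by (auto simp: D_def cond_prob_def)
  qed
  define b where "b j = (if j < i then 0 else if j = i then 1 else eta_bar P X a n i j)" for j
  have le: "\<bar>D y1 j - D y2 j\<bar> \<le> b j" if "j \<le> n" for j
  proof -
    consider "j < i" | "j = i" | "i < j" by linarith
    then show ?thesis
    proof cases
      case 1
      then show ?thesis using known[of j] pos h by (simp add: b_def nth_append)
    next
      case 2
      then show ?thesis using known[of j] pos by (simp add: b_def)
    next
      case 3
      then show ?thesis using eta_bar_upper[OF 3 that h pos] by (simp add: b_def D_def)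
    qed
  qed
  have b_nonneg: "0 \<le> b j" if "j \<le> n" for j
    using le[OF that] by linarith
  have "cond_visits n z (h @ [y]) = (\<Sum>j<n. D y j)" for y
    by (simp add: cond_visits_def D_def cond_prob_def h sum_divide_distrib)
  then have "\<bar>cond_visits n z (h @ [y1]) - cond_visits n z (h @ [y2])\<bar> \<le> (\<Sum>j<n. \<bar>D y1 j - D y2 j\<bar>)"
    by (simp add: sum_subtractf[symmetric] sum_abs)
  also have "\<dots> \<le> (\<Sum>j<n. b j)"
    using le by (intro sum_mono) auto
  \<comment> \<open>Visits are counted up to n - 1, but a row of \<open>Delta_norm\<close> includes
    the coefficient for j = n; adding this nonnegative term aligns the two.\<close>
  also have "\<dots> \<le> (\<Sum>j\<le>n. b j)"
    using b_nonneg by (intro sum_mono2) auto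
  also have "\<dots> = (\<Sum>j\<in>{i} \<union> {i<..n}. b j)"
    using i by (intro sum.mono_neutral_right) (auto simp: b_def)
  also have "\<dots> = 1 + (\<Sum>j\<in>{i<..n}. eta_bar P X a n i j)"
    by (subst sum.union_disjoint) (auto simp: b_def intro!: sum.cong)
  also have "\<dots> \<le> Delta_norm P X a n"
    unfolding Delta_norm_def using i by (intro Max_ge) auto
  finally show ?thesis .
qed

lemma hist_prob_zero_joint:
  "hist_prob h = 0 \<Longrightarrow> \<P>(w in P. Q w \<and> path X a 0 (length h) w = h) = 0"
proof -
  note [measurable] = measurable_path
  have "\<P>(w in P. Q w \<and> path X a 0 (length h) w = h) \<le> hist_prob h"
    by (intro finite_measure_mono) auto
  then show "hist_prob h = 0 \<Longrightarrow> ?thesis" by (simp add: measure_le_0_iff)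
qed

lemma cond_visits_times_hist_prob:
  "hist_prob h * cond_visits n z h = (\<Sum>j<n. \<P>(w in P. (X j w, a j w) = z \<and> path X a 0 (length h) w = h))"
  by (cases "hist_prob h = 0") (auto simp: cond_visits_def hist_prob_zero_joint)

lemma sum_hists_Suc:
  fixes f :: "('s \<times> 'a) list \<Rightarrow> real"
  shows "(\<Sum>h\<in>hists (Suc i). f h) = (\<Sum>h\<in>hists i. \<Sum>y\<in>UNIV. f (h @ [y]))"
proof -
  have "bij_betw (\<lambda>(h, y). h @ [y]) (hists i \<times> UNIV) (hists (Suc i))"
    unfolding bij_betw_def hists_def
  proof (intro conjI inj_onI set_eqI)
    fix h :: "('s \<times> 'a) list"
    show "h \<in> (\<lambda>(h, y). h @ [y]) ` ({h. length h = i} \<times> UNIV) \<longleftrightarrow> h \<in> {h. length h = Suc i}"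
      by (cases h rule: rev_cases) auto
  qed auto
  from sum.reindex_bij_betw[OF this, of f] show ?thesis
    by (simp add: sum.cartesian_product case_prod_unfold)
qed

text \<open>
  The quantity summed here is the second moment of the Doob martingale of the visit count at time
  \<open>i\<close>; the weak mixing coefficients bound its increments.
\<close>

lemma cond_visits_second_moment:
  assumes C: "Delta_norm P X a n \<le> C" "0 \<le> C" and i: "i \<le> n"
  shows "(\<Sum>h\<in>hists i. hist_prob h * (cond_visits n z h)\<^sup>2) \<le> (\<Sum>j<n. visit_prob j z)\<^sup>2 + real i * C\<^sup>2"
  using i
proof (induction i)
  case 0
  have "{w \<in> space P. (X j w, a j w) = z} = {w \<in> space P. X j w = fst z \<and> a j w = snd z}" for j
    by auto
  then show ?case
    by (simp add: hists_def cond_visits_def path_def prob_space)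
next
  case (Suc i)
  note [measurable] = measurable_path measurable_state measurable_action
  have q: "(\<Sum>y\<in>UNIV. hist_prob (h @ [y])) = hist_prob h" for h
    using hist_prob_append[of "\<lambda>_. True" h] by simp
  \<comment> \<open>The martingale property: averaging over the next pair returns the value at h.
    Together with \<open>q\<close> it collapses the bound for all extensions of h to the term of h
    plus C^2 times its probability.\<close>
  have g: "(\<Sum>y\<in>UNIV. hist_prob (h @ [y]) * cond_visits n z (h @ [y])) = hist_prob h * cond_visits n z h" for h
    unfolding cond_visits_times_hist_prob
    by (subst sum.swap) (simp add: hist_prob_append)
  have "(\<Sum>h\<in>hists (Suc i). hist_prob h * (cond_visits n z h)\<^sup>2)
      = (\<Sum>h\<in>hists i. \<Sum>y\<in>UNIV. hist_prob (h @ [y]) * (cond_visits n z (h @ [y]))\<^sup>2)"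
    by (rule sum_hists_Suc)
  also have "\<dots> \<le> (\<Sum>h\<in>hists i. hist_prob h * (cond_visits n z h)\<^sup>2 + C\<^sup>2 * hist_prob h)"
  proof (rule sum_mono)
    fix h assume "h \<in> hists i"
    then have h: "length h = i" by (simp add: hists_def)
    have "\<bar>cond_visits n z (h @ [y]) - cond_visits n z (h @ [y'])\<bar> \<le> C"
      if "hist_prob (h @ [y]) > 0" "hist_prob (h @ [y']) > 0" for y y'
      using cond_visits_diff[OF Suc_le_lessD[OF Suc.prems] h that] C(1) by (rule order_trans)
    then have "(\<Sum>y\<in>UNIV. hist_prob (h @ [y]) * (cond_visits n z (h @ [y]))\<^sup>2) \<le>
        (\<Sum>y\<in>UNIV. hist_prob (h @ [y]) * cond_visits n z (h @ [y]))\<^sup>2 / (\<Sum>y\<in>UNIV. hist_prob (h @ [y]))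
          + C\<^sup>2 * (\<Sum>y\<in>UNIV. hist_prob (h @ [y]))"
      using C(2) by (intro weighted_variance_le) auto
    also have "\<dots> = hist_prob h * (cond_visits n z h)\<^sup>2 + C\<^sup>2 * hist_prob h"
      unfolding q g by (simp add: power2_eq_square)
    finally show "(\<Sum>y\<in>UNIV. hist_prob (h @ [y]) * (cond_visits n z (h @ [y]))\<^sup>2)
        \<le> hist_prob h * (cond_visits n z h)\<^sup>2 + C\<^sup>2 * hist_prob h" .
  qed
  also have "\<dots> = (\<Sum>h\<in>hists i. hist_prob h * (cond_visits n z h)\<^sup>2) + C\<^sup>2 * (\<Sum>h\<in>hists i. hist_prob h)"
    by (simp add: sum.distrib sum_distrib_left)
  also have "(\<Sum>h\<in>hists i. hist_prob h) = 1"
    using expectation_path[of "\<lambda>_. 1 :: real" i] by (simp add: prob_space)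
  finally show ?case using Suc by (simp add: algebra_simps)
qed

lemma visits_eq_path: "m \<ge> n \<Longrightarrow>
  real (visits X a n w (fst z) (snd z)) = (\<Sum>j<n. of_bool (path X a 0 m w ! j = z))"
  unfolding visits_def of_nat_sum by (intro sum.cong) (auto simp: nth_path prod_eq_iff)

text \<open>A history of length n lists the pairs at times 0, ..., n - 1, exactly those counted, so
  at time n the Doob martingale has become the visit count itself.\<close>

lemma visits_second_moment:
  assumes C: "Delta_norm P X a n \<le> C" "0 \<le> C"
  shows "expectation (\<lambda>w. (real (visits X a n w (fst z) (snd z)))\<^sup>2)
    \<le> (\<Sum>j<n. visit_prob j z)\<^sup>2 + real n * C\<^sup>2"
proof -
  have key: "hist_prob h * (cond_visits n z h)\<^sup>2 = hist_prob h * (\<Sum>j<n. of_bool (h ! j = z))\<^sup>2"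
    if "h \<in> hists n" for h
  proof (cases "hist_prob h = 0")
    case False
    have "{w \<in> space P. (X j w, a j w) = z \<and> path X a 0 n w = h}
        = (if h ! j = z then {w \<in> space P. path X a 0 n w = h} else {})" if "j < n" for j
      using nth_path[OF that] by auto
    then have "(\<Sum>j<n. \<P>(w in P. (X j w, a j w) = z \<and> path X a 0 n w = h)) = (\<Sum>j<n. hist_prob h * of_bool (h ! j = z))"
      using that by (intro sum.cong) (auto simp: hists_def)
    then show ?thesis
      using False that by (simp add: cond_visits_def hists_def sum_distrib_left[symmetric])
  qed simp
  have "expectation (\<lambda>w. (real (visits X a n w (fst z) (snd z)))\<^sup>2)
      = (\<Sum>h\<in>hists n. hist_prob h * (\<Sum>j<n. of_bool (h ! j = z))\<^sup>2)"
    unfolding visits_eq_path[OF order_refl] by (subst expectation_path) simp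
  also have "\<dots> = (\<Sum>h\<in>hists n. hist_prob h * (cond_visits n z h)\<^sup>2)"
    by (rule sum.cong[OF refl key[symmetric]])
  finally show ?thesis using cond_visits_second_moment[OF C order_refl, of z] by simp
qed

lemma expectation_visits:
  "expectation (\<lambda>w. real (visits X a n w (fst z) (snd z))) = (\<Sum>j<n. visit_prob j z)"
proof -
  note [measurable] = measurable_state measurable_action
  have ev: "{w \<in> space P. X j w = fst z \<and> a j w = snd z} \<in> events" for j
    by measurable
  have "real (visits X a n w (fst z) (snd z)) = (\<Sum>j<n. indicator {w \<in> space P. X j w = fst z \<and> a j w = snd z} w)"
    if "w \<in> space P" for w
    using that unfolding visits_def of_nat_sum by (intro sum.cong) (auto simp: indicator_def)
  then have "expectation (\<lambda>w. real (visits X a n w (fst z) (snd z)))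
      = expectation (\<lambda>w. \<Sum>j<n. indicator {w \<in> space P. X j w = fst z \<and> a j w = snd z} w)"
    by (intro Bochner_Integration.integral_cong) auto
  also have "\<dots> = (\<Sum>j<n. visit_prob j z)"
    using ev by (subst Bochner_Integration.integral_sum) (auto simp: emeasure_eq_measure)
  finally show ?thesis .
qed

lemma integrable_visits: "integrable P (\<lambda>w. f (real (visits X a n w (fst z) (snd z))) :: real)"
  unfolding visits_eq_path[OF order_refl] by (rule integrable_path)

text \<open>Split into variance and squared bias: the n increments of size at most C give a variance
  of at most C^2 / n for the frequency, and the bias tends to 0 because the mean frequencies
  converge.\<close>

lemma visit_frequency_mean_square:
  assumes C: "\<And>n. Delta_norm P X a n \<le> C" "0 \<le> C"
    and freq: "(\<lambda>n. (\<Sum>j<n. visit_prob j z) / real n) \<longlonglongrightarrow> p"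
  shows "(\<lambda>n. expectation (\<lambda>w. (real (visits X a n w (fst z) (snd z)) / real n - p)\<^sup>2)) \<longlonglongrightarrow> 0"
proof (rule tendsto_sandwich)
  show "\<forall>\<^sub>F n in sequentially. 0 \<le> expectation (\<lambda>w. (real (visits X a n w (fst z) (snd z)) / real n - p)\<^sup>2)"
    by simp
  show "\<forall>\<^sub>F n in sequentially. expectation (\<lambda>w. (real (visits X a n w (fst z) (snd z)) / real n - p)\<^sup>2)
      \<le> C\<^sup>2 / real n + ((\<Sum>j<n. visit_prob j z) / real n - p)\<^sup>2"
    using eventually_gt_at_top[of 0]
  proof eventually_elim
    case (elim n)
    let ?N = "\<lambda>w. real (visits X a n w (fst z) (snd z))"
    let ?E = "\<Sum>j<n. visit_prob j z"
    have "expectation (\<lambda>w. (?N w / real n - p)\<^sup>2)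
        = expectation (\<lambda>w. (?N w)\<^sup>2 / (real n)\<^sup>2 - 2 * p / real n * ?N w + p\<^sup>2)"
      by (intro Bochner_Integration.integral_cong) (simp_all add: power2_diff power_divide)
    also have "\<dots> = expectation (\<lambda>w. (?N w)\<^sup>2) / (real n)\<^sup>2 - 2 * p / real n * ?E + p\<^sup>2"
      using integrable_visits[of "\<lambda>x. x" n z] integrable_visits[of "\<lambda>x. x\<^sup>2" n z]
      by (simp add: expectation_visits prob_space)
    also have "\<dots> \<le> (?E\<^sup>2 + real n * C\<^sup>2) / (real n)\<^sup>2 - 2 * p / real n * ?E + p\<^sup>2"
      using visits_second_moment[OF C, of n z] by (simp add: divide_right_mono)
    also have "\<dots> = C\<^sup>2 / real n + (?E / real n - p)\<^sup>2"
      using elim by (simp add: power2_eq_square field_simps)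
    finally show ?case .
  qed
  have "(\<lambda>n. C\<^sup>2 / real n + ((\<Sum>j<n. visit_prob j z) / real n - p)\<^sup>2) \<longlonglongrightarrow> 0 + (p - p)\<^sup>2"
    by (intro tendsto_intros freq tendsto_divide_0[OF tendsto_const] filterlim_at_top_imp_at_infinity filterlim_real_sequentially)
  then show "(\<lambda>n. C\<^sup>2 / real n + ((\<Sum>j<n. visit_prob j z) / real n - p)\<^sup>2) \<longlonglongrightarrow> 0" by simp
qed simp

end

section \<open>Characteristic function of the transition martingale\<close>

text \<open>Second-order expansion of one tilted increment: the square of i c / sqrt n contributes
  -c^2 / 2 and the tilt contributes v / 2. The first-order term grows like sqrt n and is subtracted
  here; it disappears once centred increments are averaged.\<close>

lemma exponential_increment_limit:
  fixes c v :: real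
  shows "(\<lambda>n. of_nat n * (exp (\<i> * of_real (c / sqrt (real n)) + of_real (v / (2 * real n))) - 1)
      - \<i> * of_real (sqrt (real n) * c)) \<longlonglongrightarrow> complex_of_real (v / 2 - c\<^sup>2 / 2)"
  unfolding tendsto_complex_iff
proof
  have "(\<lambda>n. real n * (exp (v / (2 * real n)) * cos (c / sqrt (real n)) - 1)) \<longlonglongrightarrow> v / 2 - c\<^sup>2 / 2"
    unfolding power2_eq_square by real_asymp
  then show "(\<lambda>n. Re (of_nat n * (exp (\<i> * of_real (c / sqrt (real n)) + of_real (v / (2 * real n))) - 1)
      - \<i> * of_real (sqrt (real n) * c))) \<longlonglongrightarrow> Re (complex_of_real (v / 2 - c\<^sup>2 / 2))"
    by (simp add: Re_exp)
  have "(\<lambda>n. real n * (exp (v / (2 * real n)) * sin (c / sqrt (real n))) - sqrt (real n) * c) \<longlonglongrightarrow> 0"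
    by real_asymp
  then show "(\<lambda>n. Im (of_nat n * (exp (\<i> * of_real (c / sqrt (real n)) + of_real (v / (2 * real n))) - 1)
      - \<i> * of_real (sqrt (real n) * c))) \<longlonglongrightarrow> Im (complex_of_real (v / 2 - c\<^sup>2 / 2))"
    by (simp add: Im_exp)
qed

lemma abs_exp_neg_diff_le:
  fixes x y :: real
  assumes "0 \<le> x" "0 \<le> y"
  shows "\<bar>exp (- x) - exp (- y)\<bar> \<le> \<bar>x - y\<bar>"
proof -
  have *: "exp (- x) - exp (- y) \<le> y - x" if "0 \<le> x" "x \<le> y" for x y :: real
  proof -
    have "exp (- x) - exp (- y) = exp (- x) * (1 - exp (- (y - x)))"
      by (simp add: right_diff_distrib exp_add[symmetric])
    also have "\<dots> \<le> 1 * (y - x)"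
      using that exp_ge_add_one_self[of "- (y - x)"] by (intro mult_mono) (auto simp del: minus_diff_eq)
    finally show ?thesis by simp
  qed
  show ?thesis
    using *[of x y] *[of y x] assms by (cases "x \<le> y") auto
qed

context controlled_markov_chain
begin

lemma transition_nonneg_sum:
  assumes "visit_prob i z > 0"
  shows "0 \<le> M $ z $ t" and "(\<Sum>t\<in>UNIV. M $ z $ t) = 1"
proof -
  note [measurable] = measurable_path measurable_state measurable_action
  have M: "M $ z $ t = \<P>(w in P. X (Suc i) w = t \<bar> X i w = fst z \<and> a i w = snd z)" for t
    using transition[OF assms] by simp
  show "0 \<le> M $ z $ t" unfolding M cond_prob_def by simp
  have "(\<Sum>t\<in>UNIV. \<P>(w in P. X (Suc i) w = t \<and> X i w = fst z \<and> a i w = snd z)) =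
      prob (\<Union>t\<in>UNIV. {w \<in> space P. X (Suc i) w = t \<and> X i w = fst z \<and> a i w = snd z})"
    by (rule finite_measure_finite_Union[symmetric]) (auto simp: disjoint_family_on_def)
  also have "(\<Union>t\<in>UNIV. {w \<in> space P. X (Suc i) w = t \<and> X i w = fst z \<and> a i w = snd z})
      = {w \<in> space P. X i w = fst z \<and> a i w = snd z}" by auto
  finally show "(\<Sum>t\<in>UNIV. M $ z $ t) = 1"
    using assms unfolding M cond_prob_def by (simp add: sum_divide_distrib[symmetric])
qed

text \<open>Telescoping: conditioning on the history replaces the last factor by its mean, which is
  within d of 1, while the product of the earlier factors is bounded by B^n <= C. Each of the j
  factors thus costs at most C d.\<close>

lemma tilted_product_mean:
  fixes f :: "'s \<times> 'a \<Rightarrow> 's \<Rightarrow> complex"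
  assumes bound: "\<And>z t. norm (f z t) \<le> B" and B: "1 \<le> B" "B ^ n \<le> C"
    and mean: "\<And>z. norm ((\<Sum>t\<in>UNIV. M $ z $ t *\<^sub>R f z t) - 1) \<le> d" and j: "j \<le> n"
  shows "norm (expectation (\<lambda>w. \<Prod>i<j. f (X i w, a i w) (X (Suc i) w)) - 1) \<le> real j * (C * d)"
  using j
proof (induction j)
  case 0
  then show ?case by (simp add: prob_space)
next
  case (Suc j)
  define T where "T w = (\<Prod>i<j. f (X i w, a i w) (X (Suc i) w))" for w
  define F where "F h = (\<Prod>i<j. f (h ! i) (fst (h ! Suc i)))" for h
  define m where "m z = (\<Sum>t\<in>UNIV. M $ z $ t *\<^sub>R f z t)" for z
  have TF: "T w = F (path X a 0 (Suc j) w)" for w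
    unfolding T_def F_def by (intro prod.cong refl) (simp add: nth_path)
  have last: "last (path X a 0 (Suc j) w) = (X j w, a j w)" for w
    by (simp add: path_Suc)
  have "expectation (\<lambda>w. \<Prod>i<Suc j. f (X i w, a i w) (X (Suc i) w)) = expectation (\<lambda>w. T w * m (X j w, a j w))"
    unfolding m_def TF expectation_step[symmetric] unfolding TF[symmetric] by (simp add: T_def)
  also have "\<dots> - expectation T = expectation (\<lambda>w. T w * m (X j w, a j w) - T w)"
    unfolding TF last[symmetric]
    by (rule Bochner_Integration.integral_diff[symmetric]) (rule integrable_path)+
  also have "\<dots> = expectation (\<lambda>w. T w * (m (X j w, a j w) - 1))"
    by (simp add: right_diff_distrib)
  also have "norm \<dots> \<le> expectation (\<lambda>w. norm (T w * (m (X j w, a j w) - 1)))"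
    by (rule integral_norm_bound)
  also have "\<dots> \<le> expectation (\<lambda>w. C * d)"
  proof (rule integral_mono)
    show "integrable P (\<lambda>w. norm (T w * (m (X j w, a j w) - 1)))"
      unfolding TF last[symmetric] by (rule integrable_path)
    fix w
    have "norm (T w) \<le> (\<Prod>i<j. B)"
      unfolding T_def prod_norm[symmetric] by (intro prod_mono) (auto intro: bound)
    also have "\<dots> = B ^ j" by simp
    also have "\<dots> \<le> B ^ n" using B(1) Suc.prems by (intro power_increasing) auto
    also have "\<dots> \<le> C" by (rule B)
    finally have "norm (T w) \<le> C" .
    then show "norm (T w * (m (X j w, a j w) - 1)) \<le> C * d"
      unfolding norm_mult m_def using mean by (intro mult_mono) (auto intro: order_trans[OF norm_ge_zero])
  qed simp
  finally have "norm (expectation (\<lambda>w. \<Prod>i<Suc j. f (X i w, a i w) (X (Suc i) w)) - expectation T) \<le> C * d"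
    by (simp add: prob_space)
  moreover have "norm (expectation T - 1) \<le> real j * (C * d)"
    unfolding T_def using Suc by simp
  ultimately have "norm (expectation (\<lambda>w. \<Prod>i<Suc j. f (X i w, a i w) (X (Suc i) w)) - 1) \<le> C * d + real j * (C * d)"
    by (rule norm_diff_triangle_le)
  then show ?case by (simp add: algebra_simps)
qed

text \<open>
  Multiplying \<open>iexp (S\<^sub>j / \<surd>n)\<close> by the exponential of half the accumulated conditional variance
  gives an almost martingale. Since that variance converges to a constant, the factor can be removed
  in the limit.
\<close>

theorem martingale_clt_char:
  fixes c :: "'s \<times> 'a \<Rightarrow> 's \<Rightarrow> real"
  assumes C: "\<And>n. Delta_norm P X a n \<le> C" "0 \<le> C"
    and freq: "\<And>z. (\<lambda>n. (\<Sum>j<n. visit_prob j z) / real n) \<longlonglongrightarrow> p z"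
    and M: "\<And>z t. 0 \<le> M $ z $ t" "\<And>z. (\<Sum>t\<in>UNIV. M $ z $ t) = 1"
    and centred: "\<And>z. (\<Sum>t\<in>UNIV. M $ z $ t * c z t) = 0"
  shows "(\<lambda>n. CLINT w|P. iexp ((\<Sum>i<n. c (X i w, a i w) (X (Suc i) w)) / sqrt (real n)))
    \<longlonglongrightarrow> of_real (exp (- (\<Sum>z\<in>UNIV. p z * (\<Sum>t\<in>UNIV. M $ z $ t * (c z t)\<^sup>2)) / 2))"
proof -
  define v where "v z = (\<Sum>t\<in>UNIV. M $ z $ t * (c z t)\<^sup>2)" for z
  have v: "0 \<le> v z" for z unfolding v_def using M by (intro sum_nonneg) auto
  \<comment> \<open>A bound on the average conditional variance W that holds on every path. It keeps
    the tilt exp (W / 2) bounded, so no truncation or stopping is necessary.\<close>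
  define K where "K = (\<Sum>z\<in>UNIV. v z)"
  have vK: "v z \<le> K" for z unfolding K_def using v by (intro member_le_sum) auto
  define s2 where "s2 = (\<Sum>z\<in>UNIV. p z * v z)"
  have p: "0 \<le> p z" for z
    by (rule tendsto_lowerbound[OF freq]) (auto intro!: always_eventually divide_nonneg_nonneg sum_nonneg)
  have s2: "0 \<le> s2" unfolding s2_def using p v by (intro sum_nonneg) auto
  define f where "f n z t = exp (\<i> * of_real (c z t / sqrt (real n)) + of_real (v z / (2 * real n)))" for n z t
  define W where "W n w = (\<Sum>z\<in>UNIV. v z * (real (visits X a n w (fst z) (snd z)) / real n))" for n w
  define T where "T n w = (\<Prod>i<n. f n (X i w, a i w) (X (Suc i) w))" for n w
  define S where "S n w = (\<Sum>i<n. c (X i w, a i w) (X (Suc i) w)) / sqrt (real n)" for n w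
  define d where "d n = (\<Sum>z\<in>UNIV. norm ((\<Sum>t\<in>UNIV. M $ z $ t *\<^sub>R f n z t) - 1))" for n
  have W_nonneg: "0 \<le> W n w" for n w
    unfolding W_def using v by (intro sum_nonneg) auto
  have W: "W n w = (\<Sum>i<n. v (X i w, a i w)) / real n" for n w
  proof -
    have "(\<Sum>i<n. v (X i w, a i w)) = (\<Sum>i<n. \<Sum>z\<in>UNIV. v z * of_bool (X i w = fst z \<and> a i w = snd z))"
    proof (rule sum.cong[OF refl])
      fix i
      have "(\<Sum>z\<in>UNIV. v z * of_bool (X i w = fst z \<and> a i w = snd z)) = (\<Sum>z\<in>UNIV. if z = (X i w, a i w) then v z else 0)"
        by (intro sum.cong) auto
      then show "v (X i w, a i w) = (\<Sum>z\<in>UNIV. v z * of_bool (X i w = fst z \<and> a i w = snd z))" by simp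
    qed
    also have "\<dots> = (\<Sum>z\<in>UNIV. v z * real (visits X a n w (fst z) (snd z)))"
      unfolding visits_def of_nat_sum sum_distrib_left by (subst sum.swap) simp
    finally show ?thesis by (simp add: W_def sum_divide_distrib)
  qed
  have T: "T n w = iexp (S n w) * of_real (exp (W n w / 2))" for n w
  proof -
    have "(\<Sum>i<n. \<i> * of_real (c (X i w, a i w) (X (Suc i) w) / sqrt (real n))) = \<i> * of_real (S n w)"
      by (simp add: S_def sum_divide_distrib sum_distrib_left)
    moreover have "(\<Sum>i<n. complex_of_real (v (X i w, a i w) / (2 * real n))) = of_real (W n w / 2)"
      by (simp add: W sum_divide_distrib mult.commute)
    ultimately show ?thesis
      unfolding T_def f_def exp_sum[symmetric, OF finite_lessThan] sum.distrib by (simp only: exp_add exp_of_real)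
  qed
  have d: "(\<lambda>n. real n * d n) \<longlonglongrightarrow> 0"
  proof -
    have "(\<lambda>n. of_nat n * ((\<Sum>t\<in>UNIV. M $ z $ t *\<^sub>R f n z t) - 1)) \<longlonglongrightarrow> 0" for z
    proof -
      \<comment> \<open>Averaging \<open>?h\<close> under row z removes its diverging part by
        centring, and its limit is v z / 2 minus half the variance, hence 0: the tilt is chosen to
        cancel the second-order term. So one factor has mean 1 + o(1/n).\<close>
      let ?h = "\<lambda>n t. of_nat n * (f n z t - 1) - \<i> * of_real (sqrt (real n) * c z t)"
      have "(\<lambda>n. \<Sum>t\<in>UNIV. M $ z $ t *\<^sub>R ?h n t) \<longlonglongrightarrow> (\<Sum>t\<in>UNIV. M $ z $ t *\<^sub>R complex_of_real (v z / 2 - (c z t)\<^sup>2 / 2))"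
        unfolding f_def by (intro tendsto_intros exponential_increment_limit)
      also have "(\<Sum>t\<in>UNIV. M $ z $ t *\<^sub>R complex_of_real (v z / 2 - (c z t)\<^sup>2 / 2)) =
          of_real (v z / 2 * (\<Sum>t\<in>UNIV. M $ z $ t) - (\<Sum>t\<in>UNIV. M $ z $ t * (c z t)\<^sup>2) / 2)"
        by (simp add: scaleR_conv_of_real right_diff_distrib sum_subtractf sum_distrib_left sum_divide_distrib mult.commute)
      also have "\<dots> = 0" by (simp add: M v_def)
      also have "(\<lambda>n. \<Sum>t\<in>UNIV. M $ z $ t *\<^sub>R ?h n t) = (\<lambda>n. of_nat n * ((\<Sum>t\<in>UNIV. M $ z $ t *\<^sub>R f n z t) - 1))"
      proof
        fix n
        have "(\<Sum>t\<in>UNIV. M $ z $ t *\<^sub>R ?h n t) =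
            of_nat n * ((\<Sum>t\<in>UNIV. M $ z $ t *\<^sub>R f n z t) - of_real (\<Sum>t\<in>UNIV. M $ z $ t))
              - \<i> * of_real (sqrt (real n) * (\<Sum>t\<in>UNIV. M $ z $ t * c z t))"
          by (simp add: scaleR_conv_of_real right_diff_distrib sum_subtractf sum_distrib_left mult_ac)
        then show "(\<Sum>t\<in>UNIV. M $ z $ t *\<^sub>R ?h n t) = of_nat n * ((\<Sum>t\<in>UNIV. M $ z $ t *\<^sub>R f n z t) - 1)"
          by (simp add: M centred)
      qed
      finally show ?thesis .
    qed
    then have "(\<lambda>n. \<Sum>z\<in>UNIV. norm (of_nat n * ((\<Sum>t\<in>UNIV. M $ z $ t *\<^sub>R f n z t) - 1))) \<longlonglongrightarrow> (\<Sum>z\<in>(UNIV :: ('s \<times> 'a) set). 0)"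
      by (intro tendsto_sum tendsto_norm_zero)
    then show ?thesis by (simp add: d_def sum_distrib_left norm_mult)
  qed
  have ET: "(\<lambda>n. expectation (T n)) \<longlonglongrightarrow> 1"
  proof (rule LIM_zero_cancel, rule Lim_null_comparison)
    show "\<forall>\<^sub>F n in sequentially. norm (expectation (T n) - 1) \<le> real n * (exp (K / 2) * d n)"
      using eventually_gt_at_top[of 0]
    proof eventually_elim
      case (elim n)
      show ?case unfolding T_def
      \<comment> \<open>The modulus of a factor is exp (v z / (2 n)), as the imaginary exponent has
        modulus 1; its n-th power is at most exp (K / 2), uniformly in n.\<close>
      proof (rule tilted_product_mean[where B = "exp (K / (2 * real n))" and n = n])
        show "norm (f n z t) \<le> exp (K / (2 * real n))" for z t
          unfolding f_def using vK by (simp add: divide_right_mono)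
        show "1 \<le> exp (K / (2 * real n))" using v by (simp add: K_def sum_nonneg)
        show "exp (K / (2 * real n)) ^ n \<le> exp (K / 2)"
          using elim by (simp add: exp_of_nat_mult[symmetric])
        show "norm ((\<Sum>t\<in>UNIV. M $ z $ t *\<^sub>R f n z t) - 1) \<le> d n" for z
          unfolding d_def by (rule member_le_sum) auto
      qed simp
    qed
    have "(\<lambda>n. exp (K / 2) * (real n * d n)) \<longlonglongrightarrow> 0"
      by (rule tendsto_mult_right_zero[OF d])
    then show "(\<lambda>n. real n * (exp (K / 2) * d n)) \<longlonglongrightarrow> 0" by (simp add: mult_ac)
  qed
  \<comment> \<open>Mean-square convergence gives convergence in mean, by nonnegativity of the
    variance of the absolute error.\<close>
  have freq1: "(\<lambda>n. expectation (\<lambda>w. \<bar>real (visits X a n w (fst z) (snd z)) / real n - p z\<bar>)) \<longlonglongrightarrow> 0" for z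
  proof (rule Lim_null_comparison)
    let ?Y = "\<lambda>n w. \<bar>real (visits X a n w (fst z) (snd z)) / real n - p z\<bar>"
    show "\<forall>\<^sub>F n in sequentially. norm (expectation (?Y n)) \<le> sqrt (expectation (\<lambda>w. (real (visits X a n w (fst z) (snd z)) / real n - p z)\<^sup>2))"
    proof (rule always_eventually, rule allI)
      fix n
      have i: "integrable P (?Y n)" "integrable P (\<lambda>w. (?Y n w)\<^sup>2)"
        using integrable_visits[of "\<lambda>x. \<bar>x / real n - p z\<bar>" n z] integrable_visits[of "\<lambda>x. \<bar>x / real n - p z\<bar>\<^sup>2" n z] by auto
      have "0 \<le> variance (?Y n)" by (rule variance_positive)
      also have "\<dots> = expectation (\<lambda>w. (?Y n w)\<^sup>2) - (expectation (?Y n))\<^sup>2"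
        by (rule variance_eq[OF i])
      finally show "norm (expectation (?Y n)) \<le> sqrt (expectation (\<lambda>w. (real (visits X a n w (fst z) (snd z)) / real n - p z)\<^sup>2))"
        by (simp add: real_le_rsqrt)
    qed
    show "(\<lambda>n. sqrt (expectation (\<lambda>w. (real (visits X a n w (fst z) (snd z)) / real n - p z)\<^sup>2))) \<longlonglongrightarrow> 0"
      using tendsto_real_sqrt[OF visit_frequency_mean_square[OF C freq]] by simp
  qed
  have diff: "(\<lambda>n. expectation (\<lambda>w. iexp (S n w)) - expectation (T n) * of_real (exp (- s2 / 2))) \<longlonglongrightarrow> 0"
  proof (rule Lim_null_comparison)
    have "(\<lambda>n. exp (K / 2) / 2 * (\<Sum>z\<in>UNIV. v z * expectation (\<lambda>w. \<bar>real (visits X a n w (fst z) (snd z)) / real n - p z\<bar>)))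
        \<longlonglongrightarrow> exp (K / 2) / 2 * (\<Sum>z\<in>UNIV. v z * 0)"
      by (intro tendsto_intros freq1)
    then show "(\<lambda>n. exp (K / 2) / 2 * (\<Sum>z\<in>UNIV. v z * expectation (\<lambda>w. \<bar>real (visits X a n w (fst z) (snd z)) / real n - p z\<bar>)))
        \<longlonglongrightarrow> 0" by simp
    show "\<forall>\<^sub>F n in sequentially. norm (expectation (\<lambda>w. iexp (S n w)) - expectation (T n) * of_real (exp (- s2 / 2)))
        \<le> exp (K / 2) / 2 * (\<Sum>z\<in>UNIV. v z * expectation (\<lambda>w. \<bar>real (visits X a n w (fst z) (snd z)) / real n - p z\<bar>))"
    proof (rule always_eventually, rule allI)
      fix n
      let ?Y = "\<lambda>z w. \<bar>real (visits X a n w (fst z) (snd z)) / real n - p z\<bar>"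
      have SF: "S n w = (\<Sum>i<n. c (path X a 0 (Suc n) w ! i) (fst (path X a 0 (Suc n) w ! Suc i))) / sqrt (real n)" for w
        unfolding S_def by (intro arg_cong2[where f = "(/)"] sum.cong refl) (simp add: nth_path)
      have WF: "W n w = (\<Sum>i<n. v (path X a 0 (Suc n) w ! i)) / real n" for w
        unfolding W by (intro arg_cong2[where f = "(/)"] sum.cong refl) (simp add: nth_path)
      have int: "integrable P (\<lambda>w. G (S n w) (W n w))" for G :: "real \<Rightarrow> real \<Rightarrow> 'z::{banach, second_countable_topology}"
        unfolding SF WF by (rule integrable_path)
      have WK: "W n w \<le> K" for w
      proof -
        have "(\<Sum>i<n. v (X i w, a i w)) \<le> (\<Sum>i<n. K)" by (intro sum_mono vK)
        then show ?thesis unfolding W using vK v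
          by (cases "n = 0") (auto simp: divide_le_eq mult.commute K_def sum_nonneg)
      qed
      have "expectation (\<lambda>w. iexp (S n w)) - expectation (T n) * of_real (exp (- s2 / 2))
          = expectation (\<lambda>w. iexp (S n w)) - expectation (\<lambda>w. T n w * of_real (exp (- s2 / 2)))"
        by simp
      also have "\<dots> = expectation (\<lambda>w. iexp (S n w) - T n w * of_real (exp (- s2 / 2)))"
        unfolding T by (rule Bochner_Integration.integral_diff[symmetric]; rule int)
      \<comment> \<open>Since iexp S = T exp (-W/2), what remains is the bounded T times a
        difference of exponentials, which is at most |W - s2| / 2 and hence linear in the frequency
        errors.\<close>
      also have "\<dots> = expectation (\<lambda>w. T n w * of_real (exp (- (W n w / 2)) - exp (- (s2 / 2))))"
        by (intro Bochner_Integration.integral_cong refl)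
          (simp add: T right_diff_distrib of_real_mult[symmetric] exp_add[symmetric] mult.assoc del: of_real_mult of_real_exp)
      also have "norm \<dots> \<le> expectation (\<lambda>w. norm (T n w * of_real (exp (- (W n w / 2)) - exp (- (s2 / 2)))))"
        by (rule integral_norm_bound)
      also have "\<dots> \<le> expectation (\<lambda>w. exp (K / 2) / 2 * (\<Sum>z\<in>UNIV. v z * ?Y z w))"
      proof (rule integral_mono)
        show "integrable P (\<lambda>w. norm (T n w * of_real (exp (- (W n w / 2)) - exp (- (s2 / 2)))))"
          unfolding T by (rule int)
        show "integrable P (\<lambda>w. exp (K / 2) / 2 * (\<Sum>z\<in>UNIV. v z * ?Y z w))"
          by (intro integrable_mult_right Bochner_Integration.integrable_sum) (rule integrable_visits)
        fix w
        have "norm (T n w) \<le> exp (K / 2)"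
          unfolding T using WK[of w] by (simp add: norm_mult)
        moreover have "\<bar>exp (- (W n w / 2)) - exp (- (s2 / 2))\<bar> \<le> \<bar>W n w / 2 - s2 / 2\<bar>"
          using W_nonneg s2 by (intro abs_exp_neg_diff_le) auto
        moreover have "\<bar>W n w / 2 - s2 / 2\<bar> = \<bar>W n w - s2\<bar> / 2"
          by (metis abs_divide abs_numeral diff_divide_distrib)
        moreover have "\<bar>W n w - s2\<bar> \<le> (\<Sum>z\<in>UNIV. v z * ?Y z w)"
        proof -
          have "W n w - s2 = (\<Sum>z\<in>UNIV. v z * (real (visits X a n w (fst z) (snd z)) / real n - p z))"
            by (simp add: W_def s2_def right_diff_distrib sum_subtractf mult.commute)
          also have "\<bar>\<dots>\<bar> \<le> (\<Sum>z\<in>UNIV. \<bar>v z * (real (visits X a n w (fst z) (snd z)) / real n - p z)\<bar>)"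
            by (rule sum_abs)
          finally show ?thesis using v by (simp add: abs_mult)
        qed
        ultimately have "norm (T n w) * \<bar>exp (- (W n w / 2)) - exp (- (s2 / 2))\<bar>
            \<le> exp (K / 2) * ((\<Sum>z\<in>UNIV. v z * ?Y z w) / 2)"
          by (intro mult_mono) auto
        then show "norm (T n w * of_real (exp (- (W n w / 2)) - exp (- (s2 / 2)))) \<le> exp (K / 2) / 2 * (\<Sum>z\<in>UNIV. v z * ?Y z w)"
          unfolding norm_mult norm_of_real by simp
      qed
      also have "\<dots> = exp (K / 2) / 2 * (\<Sum>z\<in>UNIV. v z * expectation (?Y z))"
        using integrable_visits[of "\<lambda>x. \<bar>x / real n - p _\<bar>" n] by (simp add: Bochner_Integration.integral_sum)
      finally show "norm (expectation (\<lambda>w. iexp (S n w)) - expectation (T n) * of_real (exp (- s2 / 2)))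
        \<le> exp (K / 2) / 2 * (\<Sum>z\<in>UNIV. v z * expectation (?Y z))" .
    qed
  qed
  have "(\<lambda>n. (expectation (\<lambda>w. iexp (S n w)) - expectation (T n) * of_real (exp (- s2 / 2)))
      + expectation (T n) * of_real (exp (- s2 / 2))) \<longlonglongrightarrow> 0 + 1 * of_real (exp (- s2 / 2))"
    by (intro tendsto_intros diff ET)
  then show ?thesis by (simp add: S_def s2_def v_def)
qed

text \<open>Martingale increments are orthogonal: the cross term vanishes by
  \<open>expectation_step\<close> because every row average of c is 0.\<close>

lemma martingale_second_moment:
  fixes c :: "'s \<times> 'a \<Rightarrow> 's \<Rightarrow> real"
  assumes M: "\<And>z t. 0 \<le> M $ z $ t" "\<And>z. (\<Sum>t\<in>UNIV. M $ z $ t) = 1"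
    and centred: "\<And>z. (\<Sum>t\<in>UNIV. M $ z $ t * c z t) = 0"
    and B: "\<And>z t. \<bar>c z t\<bar> \<le> B"
  shows "expectation (\<lambda>w. (\<Sum>i<n. c (X i w, a i w) (X (Suc i) w))\<^sup>2) \<le> real n * B\<^sup>2"
proof (induction n)
  case 0
  then show ?case by simp
next
  case (Suc n)
  define F where "F h = (\<Sum>i<n. c (h ! i) (fst (h ! Suc i)))" for h
  define S where "S w = (\<Sum>i<n. c (X i w, a i w) (X (Suc i) w))" for w
  define D where "D w = c (X n w, a n w) (X (Suc n) w)" for w
  have SF: "S w = F (path X a 0 m w)" if "m \<ge> Suc n" for w m
    unfolding S_def F_def using that by (intro sum.cong refl) (simp add: nth_path)
  have DF: "D w = c (path X a 0 (Suc (Suc n)) w ! n) (fst (path X a 0 (Suc (Suc n)) w ! Suc n))" for w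
    by (simp add: D_def nth_path)
  have int: "integrable P (\<lambda>w. G (S w) (D w) :: real)" for G
    unfolding SF[OF order.refl[THEN le_SucI]] DF by (rule integrable_path)
  have "expectation (\<lambda>w. S w * D w) = expectation (\<lambda>w. S w * (\<Sum>t\<in>UNIV. M $ (X n w, a n w) $ t *\<^sub>R c (X n w, a n w) t))"
    unfolding SF[OF order.refl] D_def by (rule expectation_step)
  also have "\<dots> = 0" by (simp add: centred)
  finally have SD: "expectation (\<lambda>w. S w * D w) = 0" .
  have "expectation (\<lambda>w. (S w + D w)\<^sup>2) = expectation (\<lambda>w. (S w)\<^sup>2 + 2 * (S w * D w) + (D w)\<^sup>2)"
    by (simp add: power2_eq_square algebra_simps)
  also have "\<dots> = expectation (\<lambda>w. (S w)\<^sup>2) + expectation (\<lambda>w. (D w)\<^sup>2)"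
    using int[of "\<lambda>s d. s\<^sup>2"] int[of "\<lambda>s d. s * d"] int[of "\<lambda>s d. d\<^sup>2"] by (simp add: SD)
  also have "expectation (\<lambda>w. (D w)\<^sup>2) \<le> expectation (\<lambda>w. B\<^sup>2)"
    using int[of "\<lambda>s d. d\<^sup>2"] B by (intro integral_mono) (auto simp: D_def abs_le_square_iff[symmetric] intro: order_trans[OF _ abs_ge_self])
  finally show ?case using Suc by (simp add: S_def D_def prob_space algebra_simps)
qed

end

section \<open>Limit law of smooth functionals of the transition estimator\<close>

text \<open>Row sums may fall below 1 because \<open>M_hat\<close> has zero rows at unvisited pairs;
  the shape is rectangular so that M and the policy matrix are covered as well.\<close>

definition substochastic :: "real^'n^'m \<Rightarrow> bool" where
  "substochastic m \<longleftrightarrow> (\<forall>z t. 0 \<le> m $ z $ t) \<and> (\<forall>z. (\<Sum>t\<in>UNIV. m $ z $ t) \<le> 1)"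

definition vectorize :: "real^'n^'m \<Rightarrow> real^('m::finite \<times> 'n::finite)" where
  "vectorize m = (\<chi> x. m $ fst x $ snd x)"

lemma norm_vec_squared: "(norm (v :: real^'n))\<^sup>2 = (\<Sum>i\<in>UNIV. (v $ i)\<^sup>2)"
  by (simp add: norm_vec_def L2_set_def sum_nonneg)

lemma norm_iexp_diff_le: "norm (iexp x - iexp y) \<le> \<bar>x - y\<bar>"
proof -
  have "iexp x - iexp y = iexp y * (iexp (x - y) - 1)"
    by (simp add: right_diff_distrib exp_add[symmetric] algebra_simps)
  then have "norm (iexp x - iexp y) = norm (iexp (x - y) - 1)"
    by (simp add: norm_mult)
  also have "\<dots> \<le> \<bar>x - y\<bar>"
    using iexp_approx1[of "x - y" 0] by simp
  finally show ?thesis .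
qed

lemma norm_iexp_diff_le_2: "norm (iexp x - iexp y) \<le> 2"
  by (rule norm_triangle_le_diff) simp

text \<open>Each diagonal block is 1 / p z times a multinomial covariance, the Gram matrix of
  centred indicators in L^2 of row z. \<open>H\<close> lists these indicators, weighted by square
  roots of the row probabilities. The form G G^T is what \<open>normal_law_exists\<close> asks
  for.\<close>

lemma Lambda_bar_square_root:
  fixes M :: "real^'s^('s::finite \<times> 'a::finite)"
  assumes p: "\<And>z. p z > 0" and M: "\<And>z t. 0 \<le> M $ z $ t" "\<And>z. (\<Sum>t\<in>UNIV. M $ z $ t) = 1"
  shows "\<exists>G :: real^(('s \<times> 'a) \<times> 's)^(('s \<times> 'a) \<times> 's). Lambda_bar M p = G ** transpose G"
proof -
  define s where "s z t = sqrt (M $ z $ t)" for z t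
  have s: "s z t * s z t = M $ z $ t" for z t unfolding s_def using M by simp
  define H where "H z t u = s z u * (of_bool (u = t) - M $ z $ t)" for z t u
  define G :: "real^(('s \<times> 'a) \<times> 's)^(('s \<times> 'a) \<times> 's)"
    where "G = (\<chi> x y. of_bool (fst x = fst y) * H (fst x) (snd x) (snd y) / sqrt (p (fst x)))"
  have H: "(\<Sum>u\<in>UNIV. H z t u * H z t' u) = of_bool (t = t') * M $ z $ t - M $ z $ t * M $ z $ t'" for z t t'
  proof -
    have "H z t u * H z t' u = M $ z $ u * ((of_bool (u = t) - M $ z $ t) * (of_bool (u = t') - M $ z $ t'))" for u
      unfolding H_def s[of z u, symmetric] by (simp add: mult_ac)
    also have "\<dots> u = (if u = t then of_bool (t = t') * M $ z $ t - M $ z $ t * M $ z $ t' else 0)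
        - (if u = t' then M $ z $ t * M $ z $ t' else 0) + M $ z $ t * M $ z $ t' * M $ z $ u" for u
      by (auto simp: algebra_simps)
    finally show ?thesis
      by (simp add: sum.distrib sum_subtractf sum_distrib_left[symmetric] M)
  qed
  have "Lambda_bar M p $ x $ y = (G ** transpose G) $ x $ y" for x y
  proof -
    obtain z t w t' where xy: "x = (z, t)" "y = (w, t')" by (metis surj_pair)
    have "(G ** transpose G) $ x $ y = (\<Sum>v\<in>UNIV. \<Sum>u\<in>UNIV. G $ x $ (v, u) * G $ y $ (v, u))"
      by (simp add: matrix_matrix_mult_def transpose_def sum.cartesian_product case_prod_unfold flip: UNIV_Times_UNIV)
    also have "\<dots> = (\<Sum>v\<in>UNIV. if v = z then of_bool (z = w) * (\<Sum>u\<in>UNIV. H z t u * H z t' u) / (sqrt (p z) * sqrt (p w)) else 0)"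
      by (intro sum.cong refl) (auto simp: G_def xy sum_divide_distrib)
    also have "\<dots> = of_bool (z = w) * (\<Sum>u\<in>UNIV. H z t u * H z t' u) / (sqrt (p z) * sqrt (p w))" by simp
    also have "\<dots> = Lambda_bar M p $ x $ y"
      by (auto simp: Lambda_bar_def xy H real_sqrt_mult)
    finally show ?thesis by simp
  qed
  then show ?thesis by (intro exI[of _ G]) (simp add: vec_eq_iff)
qed

text \<open>The summand for z is the variance of b(z, .) under row z divided by p z, the shape in
  which the asymptotic variance of the martingale appears.\<close>

lemma Lambda_bar_quadratic_form:
  fixes M :: "real^'s^('s::finite \<times> 'a::finite)"
  assumes p: "\<And>z. p z > 0"
  shows "b \<bullet> (Lambda_bar M p *v b) =
    (\<Sum>z\<in>UNIV. ((\<Sum>t\<in>UNIV. M $ z $ t * (b $ (z, t))\<^sup>2) - (\<Sum>t\<in>UNIV. M $ z $ t * b $ (z, t))\<^sup>2) / p z)"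
proof -
  have row: "(Lambda_bar M p *v b) $ (z, t) = M $ z $ t * (b $ (z, t) - (\<Sum>t'\<in>UNIV. M $ z $ t' * b $ (z, t'))) / p z" for z t
  proof -
    have "(Lambda_bar M p *v b) $ (z, t) = (\<Sum>v\<in>UNIV. \<Sum>t'\<in>UNIV. Lambda_bar M p $ (z, t) $ (v, t') * b $ (v, t'))"
      by (simp add: matrix_vector_mult_def sum.cartesian_product case_prod_unfold flip: UNIV_Times_UNIV)
    also have "\<dots> = (\<Sum>v\<in>UNIV. if v = z then (\<Sum>t'\<in>UNIV. (of_bool (t = t') * M $ z $ t - M $ z $ t * M $ z $ t') / p z * b $ (z, t')) else 0)"
      using p by (intro sum.cong refl) (auto simp: Lambda_bar_def less_imp_le)
    also have "\<dots> = (\<Sum>t'\<in>UNIV. (if t' = t then M $ z $ t * b $ (z, t) / p z else 0) - M $ z $ t / p z * (M $ z $ t' * b $ (z, t')))"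
      by (simp, intro sum.cong) (auto simp: diff_divide_distrib algebra_simps)
    also have "\<dots> = M $ z $ t * (b $ (z, t) - (\<Sum>t'\<in>UNIV. M $ z $ t' * b $ (z, t'))) / p z"
      by (simp add: sum_subtractf sum_distrib_left[symmetric] sum_divide_distrib[symmetric] right_diff_distrib diff_divide_distrib)
    finally show ?thesis .
  qed
  have "b \<bullet> (Lambda_bar M p *v b) = (\<Sum>z\<in>UNIV. \<Sum>t\<in>UNIV. b $ (z, t) * (Lambda_bar M p *v b) $ (z, t))"
    by (simp add: inner_vec_def sum.cartesian_product case_prod_unfold flip: UNIV_Times_UNIV)
  also have "\<dots> = (\<Sum>z\<in>UNIV. ((\<Sum>t\<in>UNIV. M $ z $ t * (b $ (z, t))\<^sup>2) - (\<Sum>t\<in>UNIV. M $ z $ t * b $ (z, t))\<^sup>2) / p z)"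
  proof (rule sum.cong[OF refl])
    fix z
    define m where "m = (\<Sum>t'\<in>UNIV. M $ z $ t' * b $ (z, t'))"
    have "(\<Sum>t\<in>UNIV. b $ (z, t) * (Lambda_bar M p *v b) $ (z, t)) = (\<Sum>t\<in>UNIV. M $ z $ t * (b $ (z, t))\<^sup>2 / p z - m / p z * (M $ z $ t * b $ (z, t)))"
      unfolding row m_def[symmetric] by (intro sum.cong) (auto simp: diff_divide_distrib power2_eq_square algebra_simps)
    also have "\<dots> = ((\<Sum>t\<in>UNIV. M $ z $ t * (b $ (z, t))\<^sup>2) - m\<^sup>2) / p z"
      by (simp add: sum_subtractf sum_distrib_left[symmetric] m_def[symmetric] diff_divide_distrib sum_divide_distrib[symmetric] power2_eq_square)
    finally show "(\<Sum>t\<in>UNIV. b $ (z, t) * (Lambda_bar M p *v b) $ (z, t)) =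
      ((\<Sum>t\<in>UNIV. M $ z $ t * (b $ (z, t))\<^sup>2) - (\<Sum>t\<in>UNIV. M $ z $ t * b $ (z, t))\<^sup>2) / p z"
      unfolding m_def .
  qed
  finally show ?thesis .
qed

lemma sum_transitions: "(\<Sum>t\<in>UNIV. transitions X a n w s l t) = visits X a n w s (l :: 'a)"
  for X :: "nat \<Rightarrow> 'w \<Rightarrow> 's::finite"
proof -
  have "(\<Sum>t\<in>UNIV. transitions X a n w s l t) = (\<Sum>i<n. \<Sum>t\<in>UNIV. of_bool (X i w = s \<and> X (Suc i) w = t \<and> a i w = l))"
    unfolding transitions_def by (rule sum.swap)
  also have "\<dots> = visits X a n w s l"
    unfolding visits_def
  proof (rule sum.cong[OF refl])
    fix i
    have "(\<Sum>t\<in>UNIV. of_bool (X i w = s \<and> X (Suc i) w = t \<and> a i w = l)) =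
        (\<Sum>t\<in>UNIV. if X (Suc i) w = t then of_bool (X i w = s \<and> a i w = l) else 0 :: nat)"
      by (intro sum.cong) auto
    then show "(\<Sum>t\<in>UNIV. of_bool (X i w = s \<and> X (Suc i) w = t \<and> a i w = l)) = (of_bool (X i w = s \<and> a i w = l) :: nat)"
      by simp
  qed
  finally show ?thesis .
qed

lemma substochastic_M_hat: "substochastic (M_hat X a n w)"
proof -
  have "(\<Sum>t\<in>UNIV. real (transitions X a n w s l t)) = real (visits X a n w s l)" for s l
    by (simp add: sum_transitions flip: of_nat_sum)
  then have "(\<Sum>t\<in>UNIV. M_hat X a n w $ z $ t) \<le> 1" for z
    by (cases "visits X a n w (fst z) (snd z) = 0") (simp_all add: M_hat_def sum_divide_distrib[symmetric])
  then show ?thesis by (simp add: substochastic_def M_hat_def)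
qed

lemma matrix_vector_bounded:
  fixes L :: "real^'n^'m"
  obtains B where "0 \<le> B" "\<And>x. norm (L *v x) \<le> B * norm x"
proof -
  obtain B where "\<And>x. norm (L *v x) \<le> norm x * B"
    using bounded_linear.pos_bounded[OF matrix_vector_mul_bounded_linear[of L]] by blast
  then have "norm (L *v x) \<le> \<bar>B\<bar> * norm x" for x
    by (metis abs_ge_self mult.commute mult_left_mono norm_ge_zero order_trans)
  then show ?thesis using that[of "\<bar>B\<bar>"] by simp
qed

section \<open>Estimation error of the transition matrix\<close>

locale ergodic_controlled_chain = controlled_markov_chain P X a M
  for P :: "'w measure" and X :: "nat \<Rightarrow> 'w \<Rightarrow> 's::finite" and a :: "nat \<Rightarrow> 'w \<Rightarrow> 'a::finite"
    and M :: "real^'s^('s \<times> 'a)" +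
  fixes p :: "'s \<times> 'a \<Rightarrow> real" and C :: real
  assumes Delta_norm_le: "\<And>n. Delta_norm P X a n \<le> C" and C_nonneg: "0 \<le> C"
    and frequency: "\<And>z. (\<lambda>n. (\<Sum>j<n. visit_prob j z) / real n) \<longlonglongrightarrow> p z"
    and p_pos: "\<And>z. p z > 0"
begin

text \<open>A pair that is never visited would have limit frequency 0. By
  \<open>transition_nonneg_sum\<close> all rows of M are therefore stochastic.\<close>

lemma visited: "\<exists>i. visit_prob i z > 0"
proof (rule ccontr)
  assume "\<not> ?thesis"
  then have "visit_prob i z = 0" for i by (simp add: zero_less_measure_iff)
  then have "(\<lambda>n. 0 :: real) \<longlonglongrightarrow> p z" using frequency[of z] by simp
  then show False using p_pos[of z] by (simp add: LIMSEQ_const_iff)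
qed

lemma M_nonneg: "0 \<le> M $ z $ t" and M_sum: "(\<Sum>t\<in>UNIV. M $ z $ t) = 1"
  using visited[of z] transition_nonneg_sum by blast+

lemma M_le_1: "M $ z $ t \<le> 1"
  using member_le_sum[of t UNIV "\<lambda>t. M $ z $ t"] M_nonneg[of z] M_sum[of z] by simp

lemma substochastic_M: "substochastic M"
  by (simp add: substochastic_def M_nonneg M_sum)

text \<open>The coordinate at (z, t) is (N_{z,t} - M_{z,t} N_z) / sqrt n, the centred transition
  count.\<close>

definition noise :: "nat \<Rightarrow> 'w \<Rightarrow> real^(('s \<times> 'a) \<times> 's)" where
  "noise n w = (\<chi> x. (\<Sum>i<n. of_bool ((X i w, a i w) = fst x) * (of_bool (X (Suc i) w = snd x) - M $ fst x $ snd x)) / sqrt (real n))"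

definition frequency_error :: "nat \<Rightarrow> 'w \<Rightarrow> real" where
  "frequency_error n w = sqrt (\<Sum>z\<in>UNIV. (real (visits X a n w (fst z) (snd z)) / real n - p z)\<^sup>2)"

lemma frequency_error_nonneg: "0 \<le> frequency_error n w"
  by (simp add: frequency_error_def sum_nonneg)

lemma frequency_error_bound: "\<bar>real (visits X a n w (fst z) (snd z)) / real n - p z\<bar> \<le> frequency_error n w"
  unfolding frequency_error_def
  by (rule real_le_rsqrt, simp only: power2_abs, rule member_le_sum) auto

lemma noise_path: "noise n w = (\<chi> x. (\<Sum>i<n. of_bool (path X a 0 (Suc n) w ! i = fst x) *
    (of_bool (fst (path X a 0 (Suc n) w ! Suc i) = snd x) - M $ fst x $ snd x)) / sqrt (real n))"
  unfolding noise_def by (simp add: vec_eq_iff nth_path)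

lemma frequency_error_path: "frequency_error n w =
    sqrt (\<Sum>z\<in>UNIV. ((\<Sum>j<n. of_bool (path X a 0 (Suc n) w ! j = z)) / real n - p z)\<^sup>2)"
  unfolding frequency_error_def visits_eq_path[OF le_SucI[OF order_refl]] ..

text \<open>Evaluating the estimator on the coordinate process of lists exhibits it as a function of
  the finite history. As the space of histories is discrete, any function of the estimator is then
  measurable and integrable. The history has n + 1 entries because the last transition ends at
  X_n.\<close>

lemma M_hat_path: "M_hat X a n w = M_hat (\<lambda>i h. fst (h ! i)) (\<lambda>i h. snd (h ! i)) n (path X a 0 (Suc n) w)"
proof -
  let ?h = "path X a 0 (Suc n) w"
  have "visits X a n w s l = visits (\<lambda>i h. fst (h ! i)) (\<lambda>i h. snd (h ! i)) n ?h s l" for s l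
    unfolding visits_def by (intro sum.cong refl) (simp add: nth_path)
  moreover have "transitions X a n w s l t = transitions (\<lambda>i h. fst (h ! i)) (\<lambda>i h. snd (h ! i)) n ?h s l t" for s l t
    unfolding transitions_def by (intro sum.cong refl) (simp add: nth_path)
  ultimately show ?thesis by (simp only: M_hat_def)
qed

lemma measurable_path_fun: "(\<lambda>w. F (path X a 0 n w)) \<in> borel_measurable P"
  by (rule measurable_compose[OF measurable_path]) simp

lemma integrable_noise_error:
  fixes F :: "real^(('s \<times> 'a) \<times> 's) \<Rightarrow> real \<Rightarrow> real^'s^('s \<times> 'a) \<Rightarrow> 'b::{banach, second_countable_topology}"
  shows "integrable P (\<lambda>w. F (noise n w) (frequency_error n w) (M_hat X a n w))"
  unfolding noise_path frequency_error_path M_hat_path by (rule integrable_path)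

lemma frequency_error_mean_square: "(\<lambda>n. expectation (\<lambda>w. (frequency_error n w)\<^sup>2)) \<longlonglongrightarrow> 0"
proof -
  have "(\<lambda>n. \<Sum>z\<in>UNIV. expectation (\<lambda>w. (real (visits X a n w (fst z) (snd z)) / real n - p z)\<^sup>2)) \<longlonglongrightarrow> (\<Sum>z\<in>(UNIV :: ('s \<times> 'a) set). 0)"
    by (intro tendsto_sum visit_frequency_mean_square[OF Delta_norm_le C_nonneg frequency])
  moreover have "expectation (\<lambda>w. (frequency_error n w)\<^sup>2) = (\<Sum>z\<in>UNIV. expectation (\<lambda>w. (real (visits X a n w (fst z) (snd z)) / real n - p z)\<^sup>2))" for n
    unfolding frequency_error_def
    by (simp add: sum_nonneg) (intro Bochner_Integration.integral_sum integrable_visits)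
  ultimately show ?thesis by simp
qed

lemma noise_second_moment: "expectation (\<lambda>w. (norm (noise n w))\<^sup>2) \<le> real CARD(('s \<times> 'a) \<times> 's)"
proof -
  have "expectation (\<lambda>w. (noise n w $ x)\<^sup>2) \<le> 1" for x
  proof (cases "n = 0")
    case False
    define c where "c z t = of_bool (z = fst x) * (of_bool (t = snd x) - M $ fst x $ snd x)" for z t
    have "(\<Sum>t\<in>UNIV. M $ z $ t * c z t) = 0" for z
    proof -
      have "(\<Sum>t\<in>UNIV. M $ z $ t * c z t) = of_bool (z = fst x) * ((\<Sum>t\<in>UNIV. if t = snd x then M $ z $ t else 0)
          - M $ fst x $ snd x * (\<Sum>t\<in>UNIV. M $ z $ t))"
        unfolding sum_distrib_left sum_subtractf[symmetric] by (intro sum.cong) (auto simp: c_def algebra_simps)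
      then show ?thesis by (auto simp: M_sum)
    qed
    moreover have "\<bar>c z t\<bar> \<le> 1" for z t
      using M_nonneg[of "fst x" "snd x"] M_le_1[of "fst x" "snd x"] by (auto simp: c_def)
    ultimately have "expectation (\<lambda>w. (\<Sum>i<n. c (X i w, a i w) (X (Suc i) w))\<^sup>2) \<le> real n * 1\<^sup>2"
      by (intro martingale_second_moment M_nonneg M_sum)
    moreover have "(noise n w $ x)\<^sup>2 = (\<Sum>i<n. c (X i w, a i w) (X (Suc i) w))\<^sup>2 / real n" for w
      by (simp add: noise_def c_def power_divide)
    ultimately show ?thesis using False by (simp add: divide_le_eq)
  qed (simp add: noise_def)
  then have "(\<Sum>x\<in>UNIV. expectation (\<lambda>w. (noise n w $ x)\<^sup>2)) \<le> (\<Sum>x\<in>(UNIV :: (('s \<times> 'a) \<times> 's) set). 1)"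
    by (intro sum_mono)
  moreover have "expectation (\<lambda>w. (norm (noise n w))\<^sup>2) = (\<Sum>x\<in>UNIV. expectation (\<lambda>w. (noise n w $ x)\<^sup>2))"
    unfolding norm_vec_squared
    by (rule Bochner_Integration.integral_sum) (rule integrable_noise_error[of "\<lambda>v _ _. (v $ _)\<^sup>2"])
  ultimately show ?thesis by simp
qed

lemma noise_char:
  "(\<lambda>n. CLINT w|P. iexp (\<Sum>x\<in>UNIV. b x / p (fst x) * noise n w $ x))
    \<longlonglongrightarrow> of_real (exp (- ((\<chi> x. b x) \<bullet> (Lambda_bar M p *v (\<chi> x. b x))) / 2))"
proof -
  define \<beta> where "\<beta> z t = b (z, t) / p z" for z t
  define m where "m z = (\<Sum>t\<in>UNIV. M $ z $ t * \<beta> z t)" for z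
  \<comment> \<open>A linear combination of noise coordinates sums beta z (X_{i+1}) - m z along the
    path: the compensators M_{z,t} add up to the row mean m z, so the increments stay
    centred.\<close>
  define c where "c z t = \<beta> z t - m z" for z t
  have eq: "(\<Sum>x\<in>UNIV. b x / p (fst x) * noise n w $ x) = (\<Sum>i<n. c (X i w, a i w) (X (Suc i) w)) / sqrt (real n)" for n w
  proof -
    have "(\<Sum>x\<in>UNIV. b x / p (fst x) * noise n w $ x) = (\<Sum>z\<in>UNIV. \<Sum>t\<in>UNIV. \<beta> z t * noise n w $ (z, t))"
      by (simp add: \<beta>_def sum.cartesian_product case_prod_unfold flip: UNIV_Times_UNIV)
    also have "\<dots> = (\<Sum>z\<in>UNIV. \<Sum>t\<in>UNIV. \<Sum>i<n. \<beta> z t * (of_bool ((X i w, a i w) = z) * (of_bool (X (Suc i) w = t) - M $ z $ t)) / sqrt (real n))"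
      by (simp only: noise_def vec_lambda_beta fst_conv snd_conv sum_distrib_left sum_divide_distrib times_divide_eq_right)
    also have "\<dots> = (\<Sum>z\<in>UNIV. \<Sum>i<n. \<Sum>t\<in>UNIV. \<beta> z t * (of_bool ((X i w, a i w) = z) * (of_bool (X (Suc i) w = t) - M $ z $ t)) / sqrt (real n))"
      by (intro sum.cong refl sum.swap)
    also have "\<dots> = (\<Sum>i<n. \<Sum>z\<in>UNIV. \<Sum>t\<in>UNIV. \<beta> z t * (of_bool ((X i w, a i w) = z) * (of_bool (X (Suc i) w = t) - M $ z $ t)) / sqrt (real n))"
      by (rule sum.swap)
    also have "\<dots> = (\<Sum>i<n. c (X i w, a i w) (X (Suc i) w) / sqrt (real n))"
    proof (rule sum.cong[OF refl])
      fix i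
      define z where "z = (X i w, a i w)"
      have "(\<Sum>v\<in>UNIV. \<Sum>t\<in>UNIV. \<beta> v t * (of_bool (z = v) * (of_bool (X (Suc i) w = t) - M $ v $ t)) / sqrt (real n))
          = (\<Sum>v\<in>UNIV. if v = z then (\<Sum>t\<in>UNIV. \<beta> z t * (of_bool (X (Suc i) w = t) - M $ z $ t)) / sqrt (real n) else 0)"
        by (intro sum.cong refl) (auto simp: sum_divide_distrib)
      also have "\<dots> = (\<Sum>t\<in>UNIV. (if t = X (Suc i) w then \<beta> z t else 0) - M $ z $ t * \<beta> z t) / sqrt (real n)"
        by (simp, intro disjI2 sum.cong refl) (auto simp: algebra_simps)
      also have "\<dots> = c z (X (Suc i) w) / sqrt (real n)"
        by (simp add: sum_subtractf c_def m_def)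
      finally show "(\<Sum>v\<in>UNIV. \<Sum>t\<in>UNIV. \<beta> v t * (of_bool ((X i w, a i w) = v) * (of_bool (X (Suc i) w = t) - M $ v $ t)) / sqrt (real n))
        = c (X i w, a i w) (X (Suc i) w) / sqrt (real n)"
        unfolding z_def .
    qed
    finally show ?thesis by (simp add: sum_divide_distrib)
  qed
  have centred: "(\<Sum>t\<in>UNIV. M $ z $ t * c z t) = 0" for z
    by (simp add: c_def right_diff_distrib sum_subtractf sum_distrib_right[symmetric] M_sum m_def[symmetric])
  have var: "p z * (\<Sum>t\<in>UNIV. M $ z $ t * (c z t)\<^sup>2) =
      ((\<Sum>t\<in>UNIV. M $ z $ t * (b (z, t))\<^sup>2) - (\<Sum>t\<in>UNIV. M $ z $ t * b (z, t))\<^sup>2) / p z" for z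
  proof -
    have "(\<Sum>t\<in>UNIV. M $ z $ t * (c z t)\<^sup>2) = (\<Sum>t\<in>UNIV. M $ z $ t * (\<beta> z t)\<^sup>2 - 2 * m z * (M $ z $ t * \<beta> z t) + (m z)\<^sup>2 * M $ z $ t)"
      by (intro sum.cong) (auto simp: c_def power2_eq_square algebra_simps)
    also have "\<dots> = (\<Sum>t\<in>UNIV. M $ z $ t * (\<beta> z t)\<^sup>2) - (m z)\<^sup>2"
      by (simp add: sum.distrib sum_subtractf sum_distrib_left[symmetric] M_sum m_def[symmetric] power2_eq_square)
    also have "(\<Sum>t\<in>UNIV. M $ z $ t * (\<beta> z t)\<^sup>2) = (\<Sum>t\<in>UNIV. M $ z $ t * (b (z, t))\<^sup>2) / (p z)\<^sup>2"
      by (simp add: \<beta>_def power_divide sum_divide_distrib)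
    also have "m z = (\<Sum>t\<in>UNIV. M $ z $ t * b (z, t)) / p z"
      by (simp add: m_def \<beta>_def sum_divide_distrib)
    finally show ?thesis
      using p_pos[of z] by (simp add: power_divide diff_divide_distrib[symmetric]) (simp add: power2_eq_square)
  qed
  show ?thesis
    using martingale_clt_char[OF Delta_norm_le C_nonneg frequency M_nonneg M_sum centred]
    unfolding eq var Lambda_bar_quadratic_form[OF p_pos] by simp
qed

text \<open>The leading term of the scaled matrix error: the random denominators N_z / n are
  replaced by their limits.\<close>

definition scaled_noise :: "nat \<Rightarrow> 'w \<Rightarrow> real^(('s \<times> 'a) \<times> 's)" where
  "scaled_noise n w = (\<chi> x. noise n w $ x / p (fst x))"

text \<open>With a frequency error of at most this size, each visit frequency is still at least
  \<open>half_p_min\<close>, so all denominators stay away from 0.\<close>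

definition half_p_min :: real where
  "half_p_min = Min (range p) / 2"

lemma half_p_min_pos: "half_p_min > 0"
  unfolding half_p_min_def using p_pos by (simp add: Min_gr_iff)

lemma half_p_min_le: "2 * half_p_min \<le> p z"
  unfolding half_p_min_def by simp

text \<open>The scaled error is exactly noise divided by the observed frequency rho. The first bound
  uses rho >= \<open>half_p_min\<close>; the second uses 1/rho - 1/p = (p - rho) / (p rho).\<close>

lemma M_hat_error:
  assumes n: "n > 0" and e: "frequency_error n w \<le> half_p_min"
  shows "norm (sqrt (real n) *\<^sub>R vectorize (M_hat X a n w - M)) \<le> norm (noise n w) / half_p_min" (is "norm ?D \<le> _")
    and "norm (sqrt (real n) *\<^sub>R vectorize (M_hat X a n w - M) - scaled_noise n w)
      \<le> norm (noise n w) * frequency_error n w / half_p_min\<^sup>2"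
proof -
  define \<rho> where "\<rho> z = real (visits X a n w (fst z) (snd z)) / real n" for z
  have \<rho>: "half_p_min \<le> \<rho> z" for z
    using frequency_error_bound[of n w z] e half_p_min_le[of z] unfolding \<rho>_def by linarith
  have D: "?D $ x = noise n w $ x / \<rho> (fst x)" for x
  proof -
    obtain z t where x: "x = (z, t)" by (cases x)
    define N where "N = real (visits X a n w (fst z) (snd z))"
    have N: "N > 0" using \<rho>[of z] half_p_min_pos n unfolding \<rho>_def N_def
      by (metis divide_eq_0_iff less_le_trans not_less of_nat_0_less_iff of_nat_eq_0_iff less_irrefl gr0I)
    define R where "R = real (transitions X a n w (fst z) (snd z) t)"
    have "noise n w $ x = (R - M $ z $ t * N) / sqrt (real n)"
    proof -
      have "(\<Sum>i<n. of_bool ((X i w, a i w) = z) * (of_bool (X (Suc i) w = t) - M $ z $ t)) =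
          (\<Sum>i<n. real (of_bool (X i w = fst z \<and> X (Suc i) w = t \<and> a i w = snd z))
            - M $ z $ t * real (of_bool (X i w = fst z \<and> a i w = snd z)))"
        by (intro sum.cong) auto
      also have "\<dots> = R - M $ z $ t * N"
        unfolding R_def N_def transitions_def visits_def of_nat_sum sum_subtractf sum_distrib_left ..
      finally show ?thesis by (simp add: noise_def x)
    qed
    moreover have "?D $ x = sqrt (real n) * (R / N - M $ z $ t)"
      using N by (simp add: vectorize_def x M_hat_def N_def R_def)
    moreover have "\<rho> (fst x) = N / real n" by (simp add: \<rho>_def N_def x)
    moreover have "q * (R / N - m) = (R - m * N) / q / (N / (q * q))" if "q > 0" for q m :: real
      using N that by (simp add: field_simps)
    from this[of "sqrt (real n)"] have "sqrt (real n) * (R / N - m) = (R - m * N) / sqrt (real n) / (N / real n)" for m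
      using n by simp
    ultimately show ?thesis by simp
  qed
  have "norm ?D \<le> norm ((1 / half_p_min) *\<^sub>R noise n w)"
  proof (rule norm_le_componentwise_cart)
    fix x
    show "norm (?D $ x) \<le> norm (((1 / half_p_min) *\<^sub>R noise n w) $ x)"
      unfolding D using \<rho>[of "fst x"] half_p_min_pos by (simp add: abs_divide frac_le)
  qed
  then show "norm ?D \<le> norm (noise n w) / half_p_min" using half_p_min_pos by simp
  have "norm (?D - scaled_noise n w) \<le> norm ((frequency_error n w / half_p_min\<^sup>2) *\<^sub>R noise n w)"
  proof (rule norm_le_componentwise_cart)
    fix x :: "('s \<times> 'a) \<times> 's"
    define q where "q = p (fst x)"
    define r where "r = \<rho> (fst x)"
    have r: "half_p_min \<le> r" "half_p_min \<le> q" using \<rho> half_p_min_le[of "fst x"] half_p_min_pos by (auto simp: r_def q_def)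
    have "(?D - scaled_noise n w) $ x = noise n w $ x / r - noise n w $ x / q"
      by (simp only: vector_minus_component D scaled_noise_def vec_lambda_beta r_def q_def)
    also have "\<dots> = noise n w $ x * ((q - r) / (q * r))"
      using r half_p_min_pos by (simp add: field_simps)
    finally have "(?D - scaled_noise n w) $ x = noise n w $ x * ((q - r) / (q * r))" .
    moreover have "\<bar>(q - r) / (q * r)\<bar> \<le> frequency_error n w / (half_p_min * half_p_min)"
    proof -
      have "\<bar>q - r\<bar> \<le> frequency_error n w"
        using frequency_error_bound[of n w "fst x"] by (simp add: q_def r_def \<rho>_def abs_minus_commute)
      moreover have "half_p_min * half_p_min \<le> q * r" using r half_p_min_pos by (intro mult_mono) auto
      ultimately show ?thesis
        using r half_p_min_pos by (simp add: abs_divide abs_mult) (intro frac_le, auto)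
    qed
    ultimately have "\<bar>(?D - scaled_noise n w) $ x\<bar> \<le> \<bar>noise n w $ x\<bar> * (frequency_error n w / (half_p_min * half_p_min))"
      by (simp only: abs_mult) (rule mult_left_mono, auto)
    then show "norm ((?D - scaled_noise n w) $ x) \<le> norm (((frequency_error n w / half_p_min\<^sup>2) *\<^sub>R noise n w) $ x)"
      using frequency_error_nonneg[of n w] by (simp add: abs_mult power2_eq_square mult.commute)
  qed
  then show "norm (?D - scaled_noise n w) \<le> norm (noise n w) * frequency_error n w / half_p_min\<^sup>2"
    using frequency_error_nonneg[of n w] half_p_min_pos by (simp add: mult.commute)
qed

text \<open>Both remainders of the linearisation in mean: the quadratic one is small because the
  noise has bounded second moment, the product because the frequency error vanishes in mean
  square.\<close>

lemma noise_error_mean: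
  "(\<lambda>n. expectation (\<lambda>w. (norm (noise n w))\<^sup>2 / sqrt (real n) + norm (noise n w) * frequency_error n w)) \<longlonglongrightarrow> 0"
proof (rule tendsto_sandwich)
  let ?c = "real CARD(('s \<times> 'a) \<times> 's)"
  define r where "r n = expectation (\<lambda>w. (frequency_error n w)\<^sup>2)" for n
  \<comment> \<open>The weight for splitting the product: about sqrt (r n), so that r n / s n <= s n
    and s n tends to 0; the summand 1 / n keeps it positive.\<close>
  define s where "s n = sqrt (r n + 1 / real n)" for n
  have r: "0 \<le> r n" for n by (simp add: r_def)
  have int: "integrable P (\<lambda>w. G (noise n w) (frequency_error n w) :: real)" for G n
    by (rule integrable_noise_error[of "\<lambda>u e _. G u e"])
  show "\<forall>\<^sub>F n in sequentially. 0 \<le> expectation (\<lambda>w. (norm (noise n w))\<^sup>2 / sqrt (real n) + norm (noise n w) * frequency_error n w)"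
    by (simp add: frequency_error_nonneg)
  show "\<forall>\<^sub>F n in sequentially. expectation (\<lambda>w. (norm (noise n w))\<^sup>2 / sqrt (real n) + norm (noise n w) * frequency_error n w)
      \<le> ?c * (1 / sqrt (real n)) + (?c * s n + s n)"
    using eventually_gt_at_top[of 0]
  proof eventually_elim
    case (elim n)
    have s: "s n > 0" using elim r[of n] by (simp add: s_def add_nonneg_pos)
    have rs: "r n / s n \<le> s n"
    proof -
      have "r n \<le> s n * s n" using r[of n] by (simp add: s_def)
      then show ?thesis using s by (simp add: divide_le_eq)
    qed
    have "expectation (\<lambda>w. (norm (noise n w))\<^sup>2 / sqrt (real n) + norm (noise n w) * frequency_error n w)
        \<le> expectation (\<lambda>w. (norm (noise n w))\<^sup>2 / sqrt (real n) + (s n * (norm (noise n w))\<^sup>2 + (frequency_error n w)\<^sup>2 / s n))"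
    proof (rule integral_mono)
      fix w
      have "norm (noise n w) * frequency_error n w \<le> s n * (norm (noise n w))\<^sup>2 + (frequency_error n w)\<^sup>2 / s n"
        (is "?u * ?e \<le> _")
      proof -
        have "0 \<le> (s n * ?u - ?e)\<^sup>2 + s n * (?u * ?e)"
          using s frequency_error_nonneg[of n w] by simp
        also have "\<dots> = s n * (s n * ?u\<^sup>2 + ?e\<^sup>2 / s n - ?u * ?e)"
          using s by (simp add: power2_eq_square algebra_simps)
        finally show ?thesis using s by (simp add: zero_le_mult_iff)
      qed
      then show "(norm (noise n w))\<^sup>2 / sqrt (real n) + norm (noise n w) * frequency_error n w
          \<le> (norm (noise n w))\<^sup>2 / sqrt (real n) + (s n * (norm (noise n w))\<^sup>2 + (frequency_error n w)\<^sup>2 / s n)" by simp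
    qed (rule int[of "\<lambda>u e. (norm u)\<^sup>2 / sqrt (real n) + norm u * e"]
        int[of "\<lambda>u e. (norm u)\<^sup>2 / sqrt (real n) + (s n * (norm u)\<^sup>2 + e\<^sup>2 / s n)"])+
    also have "\<dots> = expectation (\<lambda>w. (norm (noise n w))\<^sup>2) / sqrt (real n) + (s n * expectation (\<lambda>w. (norm (noise n w))\<^sup>2) + r n / s n)"
      using int[of "\<lambda>u e. (norm u)\<^sup>2" n] int[of "\<lambda>u e. e\<^sup>2" n] by (simp add: r_def)
    also have "\<dots> \<le> ?c / sqrt (real n) + (s n * ?c + s n)"
      using noise_second_moment[of n] s rs by (intro add_mono divide_right_mono mult_left_mono) auto
    finally show ?case by (simp add: mult.commute)
  qed
  have n0: "(\<lambda>n. 1 / real n) \<longlonglongrightarrow> 0" "(\<lambda>n. 1 / sqrt (real n)) \<longlonglongrightarrow> 0"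
    by real_asymp+
  have "(\<lambda>n. s n) \<longlonglongrightarrow> sqrt (0 + 0)"
    unfolding s_def r_def by (intro tendsto_intros frequency_error_mean_square n0)
  then have "(\<lambda>n. ?c * (1 / sqrt (real n)) + (?c * s n + s n)) \<longlonglongrightarrow> ?c * 0 + (?c * 0 + 0)"
    by (intro tendsto_intros n0) auto
  then show "(\<lambda>n. ?c * (1 / sqrt (real n)) + (?c * s n + s n)) \<longlonglongrightarrow> 0" by simp
qed simp

lemma expectation_add_tendsto_zero:
  assumes "(\<lambda>n. expectation (F n)) \<longlonglongrightarrow> 0" "(\<lambda>n. expectation (G n)) \<longlonglongrightarrow> 0"
    and "\<And>n. integrable P (F n)" "\<And>n. integrable P (G n)"
  shows "(\<lambda>n. expectation (\<lambda>w. \<kappa> * F n w + \<mu> * G n w)) \<longlonglongrightarrow> (0 :: real)"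
proof -
  have "(\<lambda>n. \<kappa> * expectation (F n) + \<mu> * expectation (G n)) \<longlonglongrightarrow> \<kappa> * 0 + \<mu> * 0"
    by (intro tendsto_intros assms)
  then show ?thesis using assms(3,4) by simp
qed

text \<open>
  On the event that all visit frequencies are close to their limits, the scaled estimation error is the
  linear image of the scaled martingale noise up to a negligible remainder; elsewhere the crude bound
  \<open>2\<close> on the difference of two exponentials suffices.
\<close>

theorem estimator_limit:
  fixes \<Theta> :: "real^'s^('s \<times> 'a) \<Rightarrow> real^'k" and L :: "real^(('s \<times> 'a) \<times> 's)^'k"
  assumes expansion: "\<And>m. substochastic m \<Longrightarrow>
    norm (\<Theta> m - \<Theta> M - L *v vectorize (m - M)) \<le> K * (norm (vectorize (m - M)))\<^sup>2"
  shows "converges_to_normal P (\<lambda>n w. sqrt (real n) *\<^sub>R (\<Theta> (M_hat X a n w) - \<Theta> M)) 0 (L ** Lambda_bar M p ** transpose L)"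
    and "converges_in_probability P (\<lambda>n w. \<Theta> (M_hat X a n w)) (\<Theta> M)"
proof -
  define Y where "Y n w = sqrt (real n) *\<^sub>R (\<Theta> (M_hat X a n w) - \<Theta> M)" for n w
  define J where "J = \<bar>K\<bar>"
  have J: "0 \<le> J" by (simp add: J_def)
  have expand: "norm (\<Theta> m - \<Theta> M - L *v vectorize (m - M)) \<le> J * (norm (vectorize (m - M)))\<^sup>2"
    if "substochastic m" for m
  proof -
    have "K * (norm (vectorize (m - M)))\<^sup>2 \<le> J * (norm (vectorize (m - M)))\<^sup>2"
      unfolding J_def by (intro mult_right_mono) auto
    then show ?thesis using expansion[OF that] by linarith
  qed
  obtain B where B: "0 \<le> B" "\<And>x. norm (L *v x) \<le> B * norm x" using matrix_vector_bounded[of L] by blast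
  define U where "U n w = norm (noise n w)" for n w
  define e where "e = frequency_error"
  define Q where "Q = (J + B) / half_p_min\<^sup>2"
  note pm = half_p_min_pos
  have Q: "0 \<le> Q" using J B by (simp add: Q_def)
  have U0: "0 \<le> U n w" and e0: "0 \<le> e n w" for n w
    by (simp_all add: U_def e_def frequency_error_nonneg)
  have close: "norm (Y n w - L *v scaled_noise n w) \<le> Q * ((U n w)\<^sup>2 / sqrt (real n) + U n w * e n w)"
    if n: "n > 0" and good: "e n w \<le> half_p_min" for n w
  proof -
    define D where "D = vectorize (M_hat X a n w - M)"
    have sn: "sqrt (real n) > 0" using n by simp
    have 1: "norm (sqrt (real n) *\<^sub>R D) \<le> U n w / half_p_min"
      and 2: "norm (sqrt (real n) *\<^sub>R D - scaled_noise n w) \<le> U n w * e n w / half_p_min\<^sup>2"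
      using M_hat_error[OF n, of w] good unfolding D_def U_def e_def by auto
    \<comment> \<open>Taylor remainder plus denominator error. Scaling turns the quadratic remainder
      into |sqrt n D|^2 / sqrt n; Q serves as common constant for both.\<close>
    have "Y n w - L *v scaled_noise n w = sqrt (real n) *\<^sub>R (\<Theta> (M_hat X a n w) - \<Theta> M - L *v D)
        + L *v (sqrt (real n) *\<^sub>R D - scaled_noise n w)"
      by (simp add: Y_def scaleR_diff_right matrix_vector_mult_diff_distrib matrix_vector_mult_scaleR)
    also have "norm \<dots> \<le> norm (sqrt (real n) *\<^sub>R (\<Theta> (M_hat X a n w) - \<Theta> M - L *v D)) + norm (L *v (sqrt (real n) *\<^sub>R D - scaled_noise n w))"
      by (rule norm_triangle_ineq)
    also have "norm (sqrt (real n) *\<^sub>R (\<Theta> (M_hat X a n w) - \<Theta> M - L *v D)) \<le> sqrt (real n) * (J * (norm D)\<^sup>2)"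
      using expand[OF substochastic_M_hat, of X a n w] sn by (simp add: D_def)
    also have "sqrt (real n) * (J * (norm D)\<^sup>2) = J * (norm (sqrt (real n) *\<^sub>R D))\<^sup>2 / sqrt (real n)"
      using n by (simp add: power_mult_distrib field_simps)
    also have "\<dots> \<le> J * (U n w / half_p_min)\<^sup>2 / sqrt (real n)"
      using 1 J by (intro divide_right_mono mult_left_mono power_mono) auto
    also have "norm (L *v (sqrt (real n) *\<^sub>R D - scaled_noise n w)) \<le> B * (U n w * e n w / half_p_min\<^sup>2)"
      using B(2)[of "sqrt (real n) *\<^sub>R D - scaled_noise n w"] mult_left_mono[OF 2 B(1)] by linarith
    also have "J * (U n w / half_p_min)\<^sup>2 / sqrt (real n) + B * (U n w * e n w / half_p_min\<^sup>2)
        = J / half_p_min\<^sup>2 * ((U n w)\<^sup>2 / sqrt (real n)) + B / half_p_min\<^sup>2 * (U n w * e n w)"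
      by (simp add: power_divide)
    also have "\<dots> \<le> Q * ((U n w)\<^sup>2 / sqrt (real n)) + Q * (U n w * e n w)"
      unfolding Q_def using J B(1) U0 e0 pm by (intro add_mono mult_right_mono divide_right_mono) auto
    finally show ?thesis by (simp add: algebra_simps)
  qed
  have int: "integrable P (\<lambda>w. F (noise n w) (e n w) (M_hat X a n w))"
    for F :: "real^(('s \<times> 'a) \<times> 's) \<Rightarrow> real \<Rightarrow> real^'s^('s \<times> 'a) \<Rightarrow> 'z::{banach, second_countable_topology}" and n
    unfolding e_def by (rule integrable_noise_error)
  have err: "(\<lambda>n. expectation (\<lambda>w. \<kappa> * (e n w)\<^sup>2 + \<mu> * ((U n w)\<^sup>2 / sqrt (real n) + U n w * e n w))) \<longlonglongrightarrow> 0" for \<kappa> \<mu>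
    unfolding e_def U_def
    by (intro expectation_add_tendsto_zero frequency_error_mean_square noise_error_mean)
      (rule integrable_noise_error[of "\<lambda>u e _. e\<^sup>2"] integrable_noise_error[of "\<lambda>u e _. (norm u)\<^sup>2 / sqrt (real _) + norm u * e"])+
  have meas: "(\<lambda>w. F (M_hat X a n w)) \<in> borel_measurable P" for F :: "real^'s^('s \<times> 'a) \<Rightarrow> real^'k" and n
    unfolding M_hat_path by (rule measurable_path_fun)
  \<comment> \<open>The square root writes the limit covariance as R R^T with R = L G, which yields
    a normal law even when it is singular.\<close>
  obtain G :: "real^(('s \<times> 'a) \<times> 's)^(('s \<times> 'a) \<times> 's)" where G: "Lambda_bar M p = G ** transpose G"
    using Lambda_bar_square_root[of p M, OF p_pos M_nonneg M_sum] by blast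
  have "(L ** G) ** transpose (L ** G) = L ** Lambda_bar M p ** transpose L"
    by (simp add: G matrix_transpose_mul matrix_mul_assoc)
  with normal_law_exists[of "L ** G"] obtain N where N: "normal_law N 0 (L ** Lambda_bar M p ** transpose L)"
    by auto
  have "converges_in_distribution P Y N"
  proof (rule converges_in_distributionI_char)
    show "Y n \<in> borel_measurable P" for n
      unfolding Y_def by (rule meas)
    show "prob_space N" "sets N = sets borel" using N by (simp_all add: normal_law_def)
    fix u :: "real^'k"
    define b where "b = u v* L"
    have lin: "u \<bullet> (L *v scaled_noise n w) = (\<Sum>x\<in>UNIV. b $ x / p (fst x) * noise n w $ x)" for n w
      unfolding dot_lmul_matrix[of u L, symmetric] b_def[symmetric] by (simp add: inner_vec_def scaled_noise_def)
    have "(\<lambda>n. (CLINT w|P. iexp (u \<bullet> Y n w)) - (CLINT w|P. iexp (u \<bullet> (L *v scaled_noise n w)))) \<longlonglongrightarrow> 0"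
    \<comment> \<open>The first coefficient is Chebyshev in pointwise form: if e >
      \<open>half_p_min\<close>, then 2 <= 2 e^2 / \<open>half_p_min\<close>^2. The second comes
      from the Lipschitz bound for \<open>iexp\<close> on the good event.\<close>
    proof (rule Lim_null_comparison[OF _ err[of "2 / half_p_min\<^sup>2" "norm u * Q"]])
      show "\<forall>\<^sub>F n in sequentially. norm ((CLINT w|P. iexp (u \<bullet> Y n w)) - (CLINT w|P. iexp (u \<bullet> (L *v scaled_noise n w))))
          \<le> expectation (\<lambda>w. 2 / half_p_min\<^sup>2 * (e n w)\<^sup>2 + norm u * Q * ((U n w)\<^sup>2 / sqrt (real n) + U n w * e n w))"
        using eventually_gt_at_top[of 0]
      proof eventually_elim
        case (elim n)
        have "(CLINT w|P. iexp (u \<bullet> Y n w)) - (CLINT w|P. iexp (u \<bullet> (L *v scaled_noise n w)))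
            = (CLINT w|P. iexp (u \<bullet> Y n w) - iexp (u \<bullet> (L *v scaled_noise n w)))"
          unfolding Y_def scaled_noise_def
          by (rule Bochner_Integration.integral_diff[symmetric])
            (rule int[of "\<lambda>v e m. iexp (u \<bullet> (sqrt (real n) *\<^sub>R (\<Theta> m - \<Theta> M)))"]
              int[of "\<lambda>v e m. iexp (u \<bullet> (L *v (\<chi> x. v $ x / p (fst x))))"])+
        also have "norm \<dots> \<le> (\<integral>w. norm (iexp (u \<bullet> Y n w) - iexp (u \<bullet> (L *v scaled_noise n w))) \<partial>P)"
          by (rule integral_norm_bound)
        also have "\<dots> \<le> expectation (\<lambda>w. 2 / half_p_min\<^sup>2 * (e n w)\<^sup>2 + norm u * Q * ((U n w)\<^sup>2 / sqrt (real n) + U n w * e n w))"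
        proof (rule integral_mono)
          show "integrable P (\<lambda>w. norm (iexp (u \<bullet> Y n w) - iexp (u \<bullet> (L *v scaled_noise n w))))"
            unfolding Y_def scaled_noise_def
            by (rule int[of "\<lambda>v e m. norm (iexp (u \<bullet> (sqrt (real n) *\<^sub>R (\<Theta> m - \<Theta> M))) - iexp (u \<bullet> (L *v (\<chi> x. v $ x / p (fst x)))))"])
          show "integrable P (\<lambda>w. 2 / half_p_min\<^sup>2 * (e n w)\<^sup>2 + norm u * Q * ((U n w)\<^sup>2 / sqrt (real n) + U n w * e n w))"
            unfolding U_def
            by (rule int[of "\<lambda>v e m. 2 / half_p_min\<^sup>2 * e\<^sup>2 + norm u * Q * ((norm v)\<^sup>2 / sqrt (real n) + norm v * e)"])
          fix w
          have h0: "0 \<le> norm u * Q * ((U n w)\<^sup>2 / sqrt (real n) + U n w * e n w)"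
            using Q U0 e0 by (intro mult_nonneg_nonneg add_nonneg_nonneg divide_nonneg_nonneg) auto
          show "norm (iexp (u \<bullet> Y n w) - iexp (u \<bullet> (L *v scaled_noise n w)))
              \<le> 2 / half_p_min\<^sup>2 * (e n w)\<^sup>2 + norm u * Q * ((U n w)\<^sup>2 / sqrt (real n) + U n w * e n w)"
          proof (cases "e n w \<le> half_p_min")
            case True
            have "norm (iexp (u \<bullet> Y n w) - iexp (u \<bullet> (L *v scaled_noise n w))) \<le> \<bar>u \<bullet> (Y n w - L *v scaled_noise n w)\<bar>"
              unfolding inner_diff_right by (rule norm_iexp_diff_le)
            also have "\<dots> \<le> norm u * norm (Y n w - L *v scaled_noise n w)" by (rule Cauchy_Schwarz_ineq2)
            also have "\<dots> \<le> norm u * (Q * ((U n w)\<^sup>2 / sqrt (real n) + U n w * e n w))"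
              by (intro mult_left_mono close[OF elim True]) simp
            also have "\<dots> \<le> 2 / half_p_min\<^sup>2 * (e n w)\<^sup>2 + norm u * Q * ((U n w)\<^sup>2 / sqrt (real n) + U n w * e n w)"
              by (simp add: mult.assoc)
            finally show ?thesis .
          next
            case False
            then have "half_p_min\<^sup>2 \<le> (e n w)\<^sup>2" using pm by (intro power_mono) auto
            then have "2 \<le> 2 / half_p_min\<^sup>2 * (e n w)\<^sup>2" using pm by (simp add: field_simps)
            then show ?thesis
              using norm_iexp_diff_le_2[of "u \<bullet> Y n w" "u \<bullet> (L *v scaled_noise n w)"] h0 by linarith
          qed
        qed
        finally show ?case .
      qed
    qed
    moreover have "(\<lambda>n. CLINT w|P. iexp (u \<bullet> (L *v scaled_noise n w))) \<longlonglongrightarrow> (CLINT x|N. iexp (u \<bullet> x))"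
    proof -
      have "b \<bullet> (Lambda_bar M p *v b) = u \<bullet> ((L ** Lambda_bar M p ** transpose L) *v u)"
        by (simp add: b_def matrix_vector_mul_assoc[symmetric] dot_lmul_matrix)
      then show ?thesis
        using noise_char[of "($) b"] N unfolding lin normal_law_def
        by (simp add: exp_of_real[symmetric])
    qed
    ultimately show "(\<lambda>n. CLINT w|P. iexp (u \<bullet> Y n w)) \<longlonglongrightarrow> (CLINT x|N. iexp (u \<bullet> x))"
      by (rule Lim_transform[rotated])
  qed
  then show "converges_to_normal P (\<lambda>n w. sqrt (real n) *\<^sub>R (\<Theta> (M_hat X a n w) - \<Theta> M)) 0 (L ** Lambda_bar M p ** transpose L)"
    unfolding converges_to_normal_def Y_def using N by blast
  show "converges_in_probability P (\<lambda>n w. \<Theta> (M_hat X a n w)) (\<Theta> M)"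
    unfolding converges_in_probability_def
  proof (intro conjI allI impI meas)
    fix \<epsilon> :: real assume \<epsilon>: "\<epsilon> > 0"
    \<comment> \<open>Chosen so that on the good event a deviation above epsilon forces 1 < R (U^2 +
      1) / sqrt n; the indicator of the deviation then has a majorant whose mean tends to 0.\<close>
    define R where "R = (B / half_p_min + J / half_p_min\<^sup>2) / \<epsilon>"
    have R: "0 \<le> R" unfolding R_def using B(1) J pm \<epsilon> by simp
    let ?bad = "\<lambda>n. {w \<in> space P. dist (\<Theta> (M_hat X a n w)) (\<Theta> M) > \<epsilon>}"
    show "(\<lambda>n. \<P>(w in P. dist (\<Theta> (M_hat X a n w)) (\<Theta> M) > \<epsilon>)) \<longlonglongrightarrow> 0"
    proof (rule Lim_null_comparison)
      have "(\<lambda>n. expectation (\<lambda>w. 1 / half_p_min\<^sup>2 * (e n w)\<^sup>2 + R * ((U n w)\<^sup>2 / sqrt (real n) + U n w * e n w)) + R * (1 / sqrt (real n)))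
          \<longlonglongrightarrow> 0 + R * 0"
        by (intro tendsto_add tendsto_mult_left err) real_asymp
      then show "(\<lambda>n. expectation (\<lambda>w. 1 / half_p_min\<^sup>2 * (e n w)\<^sup>2 + R * ((U n w)\<^sup>2 / sqrt (real n) + U n w * e n w)) + R * (1 / sqrt (real n)))
          \<longlonglongrightarrow> 0" by simp
      show "\<forall>\<^sub>F n in sequentially. norm (\<P>(w in P. dist (\<Theta> (M_hat X a n w)) (\<Theta> M) > \<epsilon>))
          \<le> expectation (\<lambda>w. 1 / half_p_min\<^sup>2 * (e n w)\<^sup>2 + R * ((U n w)\<^sup>2 / sqrt (real n) + U n w * e n w)) + R * (1 / sqrt (real n))"
        using eventually_gt_at_top[of 0]
      proof eventually_elim
        case (elim n)
        have sn: "1 \<le> sqrt (real n)" "sqrt (real n) \<le> real n"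
          using elim real_sqrt_le_iff[of "real n" "(real n)\<^sup>2"] by (auto simp: power2_eq_square)
        have i: "integrable P (\<lambda>w. 1 / half_p_min\<^sup>2 * (e n w)\<^sup>2 + R * ((U n w)\<^sup>2 / sqrt (real n) + U n w * e n w))"
          unfolding U_def
          by (rule int[of "\<lambda>v e m. 1 / half_p_min\<^sup>2 * e\<^sup>2 + R * ((norm v)\<^sup>2 / sqrt (real n) + norm v * e)"])
        have bad: "?bad n \<in> events"
          using meas[of "\<lambda>m. \<Theta> m" n] by measurable
        have "\<P>(w in P. dist (\<Theta> (M_hat X a n w)) (\<Theta> M) > \<epsilon>) = expectation (indicator (?bad n))"
          using bad by simp
        also have "\<dots> \<le> expectation (\<lambda>w. 1 / half_p_min\<^sup>2 * (e n w)\<^sup>2 + R * ((U n w)\<^sup>2 / sqrt (real n) + U n w * e n w) + R * (1 / sqrt (real n)))"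
        proof (rule integral_mono)
          show "integrable P (indicator (?bad n) :: 'w \<Rightarrow> real)"
            using bad by (simp add: emeasure_eq_measure)
          show "integrable P (\<lambda>w. 1 / half_p_min\<^sup>2 * (e n w)\<^sup>2 + R * ((U n w)\<^sup>2 / sqrt (real n) + U n w * e n w) + R * (1 / sqrt (real n)))"
            by (intro Bochner_Integration.integrable_add i) simp
          fix w
          have nonneg: "0 \<le> 1 / half_p_min\<^sup>2 * (e n w)\<^sup>2" "0 \<le> R * ((U n w)\<^sup>2 / sqrt (real n) + U n w * e n w)" "0 \<le> R * (1 / sqrt (real n))"
            using R U0 e0 by (auto intro!: mult_nonneg_nonneg add_nonneg_nonneg divide_nonneg_nonneg)
          show "indicator (?bad n) w \<le> 1 / half_p_min\<^sup>2 * (e n w)\<^sup>2 + R * ((U n w)\<^sup>2 / sqrt (real n) + U n w * e n w) + R * (1 / sqrt (real n))"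
          proof (cases "w \<in> ?bad n")
            case w: True
            then have ind: "indicator (?bad n) w = (1 :: real)" by simp
            show ?thesis
            proof (cases "e n w \<le> half_p_min")
              case True
              define D where "D = vectorize (M_hat X a n w - M)"
              have "norm (sqrt (real n) *\<^sub>R D) \<le> U n w / half_p_min"
                using M_hat_error(1)[OF elim, of w] True unfolding D_def U_def e_def by auto
              then have "norm D * sqrt (real n) \<le> U n w / half_p_min"
                by (simp add: mult.commute)
              moreover have "sqrt (real n) > 0" using elim by simp
              ultimately have D: "norm D \<le> U n w / half_p_min / sqrt (real n)"
                by (simp only: pos_le_divide_eq)
              have "\<Theta> (M_hat X a n w) - \<Theta> M = (\<Theta> (M_hat X a n w) - \<Theta> M - L *v D) + L *v D" by simp
              then have "norm (\<Theta> (M_hat X a n w) - \<Theta> M) \<le> norm (\<Theta> (M_hat X a n w) - \<Theta> M - L *v D) + norm (L *v D)"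
                by (metis norm_triangle_ineq)
              also have "\<dots> \<le> J * (norm D)\<^sup>2 + B * norm D"
                using expand[OF substochastic_M_hat, of X a n w] B(2)[of D] by (auto simp: D_def intro: add_mono)
              also have "\<dots> \<le> J * (U n w / half_p_min / sqrt (real n))\<^sup>2 + B * (U n w / half_p_min / sqrt (real n))"
                using D J B(1) by (intro add_mono mult_left_mono power_mono) auto
              also have "\<dots> = J / half_p_min\<^sup>2 * ((U n w)\<^sup>2 / real n) + B / half_p_min * (U n w / sqrt (real n))"
                by (simp add: power_divide power_mult_distrib)
              also have "\<dots> \<le> J / half_p_min\<^sup>2 * (((U n w)\<^sup>2 + 1) / sqrt (real n)) + B / half_p_min * (((U n w)\<^sup>2 + 1) / sqrt (real n))"
              proof (intro add_mono mult_left_mono)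
                show "(U n w)\<^sup>2 / real n \<le> ((U n w)\<^sup>2 + 1) / sqrt (real n)"
                  using sn by (intro frac_le) auto
                \<comment> \<open>The linear term is absorbed into U^2 + 1, as the mean control is
                  for the second moment.\<close>
                have "U n w \<le> (U n w)\<^sup>2 + 1"
                  using sum_squares_ge_zero[of "U n w - 1" "U n w"] zero_le_power2[of "U n w - 1"] U0[of n w]
                  by (simp add: power2_eq_square algebra_simps)
                then show "U n w / sqrt (real n) \<le> ((U n w)\<^sup>2 + 1) / sqrt (real n)"
                  by (simp add: divide_right_mono)
              qed (use J B(1) pm in auto)
              also have "\<dots> = R * \<epsilon> * (((U n w)\<^sup>2 + 1) / sqrt (real n))"
              proof -
                have "R * \<epsilon> = J / half_p_min\<^sup>2 + B / half_p_min" using \<epsilon> by (simp add: R_def)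
                then show ?thesis by (simp only: distrib_right)
              qed
              finally have "\<epsilon> < R * \<epsilon> * (((U n w)\<^sup>2 + 1) / sqrt (real n))"
                using w by (simp add: dist_norm)
              then have "\<epsilon> * 1 < \<epsilon> * (R * (((U n w)\<^sup>2 + 1) / sqrt (real n)))"
                by (simp add: mult_ac)
              then have "1 < R * (((U n w)\<^sup>2 + 1) / sqrt (real n))"
                using \<epsilon> by (simp only: mult_less_cancel_left_pos)
              also have "\<dots> = R * ((U n w)\<^sup>2 / sqrt (real n)) + R * (1 / sqrt (real n))"
                by (simp add: add_divide_distrib distrib_left)
              also have "R * ((U n w)\<^sup>2 / sqrt (real n)) \<le> R * ((U n w)\<^sup>2 / sqrt (real n) + U n w * e n w)"
                using R U0[of n w] e0[of n w] by (intro mult_left_mono) auto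
              finally have "1 < R * ((U n w)\<^sup>2 / sqrt (real n) + U n w * e n w) + R * (1 / sqrt (real n))" by simp
              then show ?thesis unfolding ind using nonneg(1) by linarith
            next
              case False
              then have "half_p_min\<^sup>2 \<le> (e n w)\<^sup>2" using pm by (intro power_mono) auto
              then have "1 \<le> 1 / half_p_min\<^sup>2 * (e n w)\<^sup>2" using pm by (simp add: field_simps)
              then show ?thesis unfolding ind using nonneg(2,3) by linarith
            qed
          qed (use nonneg in simp)
        qed
        also have "\<dots> = expectation (\<lambda>w. 1 / half_p_min\<^sup>2 * (e n w)\<^sup>2 + R * ((U n w)\<^sup>2 / sqrt (real n) + U n w * e n w)) + R * (1 / sqrt (real n))"
          using i by (subst Bochner_Integration.integral_add) (simp_all add: prob_space)
        finally show ?case by simp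
      qed
    qed
  qed
qed

end

section \<open>Expansion of value, action-value and advantage\<close>

lemma
  fixes A :: "real^'n^'n"
  assumes "invertible A"
  shows matrix_inv_right_cancel: "A ** matrix_inv A = mat 1"
    and matrix_inv_left_cancel: "matrix_inv A ** A = mat 1"
  using assms unfolding invertible_def matrix_inv_def by (metis (mono_tags, lifting) someI_ex)+

lemma transpose_matrix_inv:
  fixes A :: "real^'n^'n"
  assumes A: "invertible A"
  shows "transpose (matrix_inv A) = matrix_inv (transpose A)"
proof -
  have AT: "invertible (transpose A)" using A by (simp add: transpose_invertible)
  have "transpose (matrix_inv A) ** transpose A = mat 1"
    by (simp add: matrix_transpose_mul[symmetric] matrix_inv_right_cancel[OF A] transpose_mat)
  then have "transpose (matrix_inv A) ** transpose A ** matrix_inv (transpose A) = matrix_inv (transpose A)"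
    by simp
  then show ?thesis
    by (simp add: matrix_mul_assoc[symmetric] matrix_inv_right_cancel[OF AT])
qed

section \<open>Resolvents of substochastic matrices\<close>

lemma substochastic_mult:
  fixes A :: "real^'n^'m" and B :: "real^'k^'n"
  assumes "substochastic A" "substochastic B"
  shows "substochastic (A ** B)"
  unfolding substochastic_def
proof (intro conjI allI)
  show "0 \<le> (A ** B) $ z $ t" for z t
    using assms by (auto simp: substochastic_def matrix_matrix_mult_def intro!: sum_nonneg)
  fix z
  have "(\<Sum>t\<in>UNIV. (A ** B) $ z $ t) = (\<Sum>k\<in>UNIV. A $ z $ k * (\<Sum>t\<in>UNIV. B $ k $ t))"
    unfolding matrix_matrix_mult_def vec_lambda_beta sum_distrib_left by (rule sum.swap)
  also have "\<dots> \<le> (\<Sum>k\<in>UNIV. A $ z $ k * 1)"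
    using assms by (intro sum_mono mult_left_mono) (auto simp: substochastic_def)
  also have "\<dots> \<le> 1" using assms by (simp add: substochastic_def)
  finally show "(\<Sum>t\<in>UNIV. (A ** B) $ z $ t) \<le> 1" .
qed

text \<open>Maximum principle: at a coordinate of largest modulus m, the equation x = y + alpha S x
  gives m <= |y| + alpha m. The dimension factor passes from the maximum norm to the Euclidean norm.
  The bound is the same for all S.\<close>

lemma contraction_solution_bound:
  fixes S :: "real^'n^'n"
  assumes S: "substochastic S" and \<alpha>: "0 \<le> \<alpha>" "\<alpha> < 1"
    and x: "(mat 1 - \<alpha> *\<^sub>R S) *v x = y"
  shows "norm x \<le> real CARD('n) * (norm y / (1 - \<alpha>))"
proof -
  define m where "m = Max (range (\<lambda>i. \<bar>x $ i\<bar>))"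
  have xm: "\<bar>x $ i\<bar> \<le> m" for i unfolding m_def by (intro Max_ge) auto
  have "m \<in> range (\<lambda>i. \<bar>x $ i\<bar>)" unfolding m_def by (intro Max_in) auto
  then obtain i where i: "m = \<bar>x $ i\<bar>" by blast
  have m: "0 \<le> m" by (simp add: i)
  have "x = y + \<alpha> *\<^sub>R (S *v x)"
    using x by (auto simp: matrix_vector_mult_diff_rdistrib scaleR_matrix_vector_assoc)
  from arg_cong[OF this, of "\<lambda>v. v $ i"]
  have xi: "x $ i = y $ i + \<alpha> * (\<Sum>j\<in>UNIV. S $ i $ j * x $ j)"
    by (simp add: matrix_vector_mult_def)
  have "m = \<bar>y $ i + \<alpha> * (\<Sum>j\<in>UNIV. S $ i $ j * x $ j)\<bar>"
    unfolding i by (rule arg_cong[OF xi])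
  also have "\<dots> \<le> \<bar>y $ i\<bar> + \<bar>\<alpha> * (\<Sum>j\<in>UNIV. S $ i $ j * x $ j)\<bar>"
    by (rule abs_triangle_ineq)
  also have "\<dots> = \<bar>y $ i\<bar> + \<alpha> * \<bar>\<Sum>j\<in>UNIV. S $ i $ j * x $ j\<bar>"
    using \<alpha> by (simp add: abs_mult)
  also have "\<bar>\<Sum>j\<in>UNIV. S $ i $ j * x $ j\<bar> \<le> (\<Sum>j\<in>UNIV. \<bar>S $ i $ j * x $ j\<bar>)" by (rule sum_abs)
  also have "\<dots> \<le> (\<Sum>j\<in>UNIV. S $ i $ j * m)"
    using S xm by (intro sum_mono) (auto simp: abs_mult substochastic_def intro!: mult_left_mono)
  also have "\<dots> = (\<Sum>j\<in>UNIV. S $ i $ j) * m" by (simp add: sum_distrib_right)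
  also have "\<dots> \<le> 1 * m" using S m by (intro mult_right_mono) (auto simp: substochastic_def)
  also have "\<bar>y $ i\<bar> \<le> norm y" by (rule component_le_norm_cart)
  finally have "m \<le> norm y + \<alpha> * m" using \<alpha> by (simp add: mult_left_mono)
  then have "m \<le> norm y / (1 - \<alpha>)" using \<alpha> by (simp add: field_simps)
  moreover have "norm x \<le> (\<Sum>i\<in>(UNIV :: 'n set). m)"
    using norm_le_l1_cart[of x] sum_mono[of UNIV "\<lambda>i. \<bar>x $ i\<bar>" "\<lambda>_. m"] xm by fastforce
  ultimately show ?thesis
    using mult_left_mono[of m "norm y / (1 - \<alpha>)" "real CARD('n)"] by simp
qed

lemma contraction_invertible:
  fixes S :: "real^'n^'n"
  assumes S: "substochastic S" and \<alpha>: "0 \<le> \<alpha>" "\<alpha> < 1"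
  shows "invertible (mat 1 - \<alpha> *\<^sub>R S)"
proof -
  have "x = y" if "(mat 1 - \<alpha> *\<^sub>R S) *v x = (mat 1 - \<alpha> *\<^sub>R S) *v y" for x y
  proof -
    have "(mat 1 - \<alpha> *\<^sub>R S) *v (x - y) = 0"
      using that by (simp add: matrix_vector_mult_diff_distrib)
    from contraction_solution_bound[OF S \<alpha> this] show ?thesis by simp
  qed
  then have "inj ((*v) (mat 1 - \<alpha> *\<^sub>R S))" by (intro injI)
  then show ?thesis
    by (simp add: invertible_left_inverse matrix_left_invertible_injective)
qed

text \<open>The norm of \<open>vectorize d\<close> is the Frobenius norm; Cauchy-Schwarz is applied
  row by row.\<close>

lemma norm_matrix_vector_le: "norm (d *v v) \<le> norm (vectorize d) * norm (v :: real^'n)"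
proof -
  have "(norm (d *v v))\<^sup>2 \<le> (\<Sum>i\<in>UNIV. (norm (d $ i))\<^sup>2 * (norm v)\<^sup>2)"
    unfolding norm_vec_squared[of "d *v v"]
  proof (rule sum_mono)
    fix i
    have "\<bar>(d *v v) $ i\<bar> \<le> norm (d $ i) * norm v"
      unfolding matrix_vector_mul_component by (rule Cauchy_Schwarz_ineq2)
    from power_mono[OF this abs_ge_zero, of 2]
    show "((d *v v) $ i)\<^sup>2 \<le> (norm (d $ i))\<^sup>2 * (norm v)\<^sup>2"
      by (simp add: power_mult_distrib)
  qed
  also have "\<dots> = (\<Sum>i\<in>UNIV. (norm (d $ i))\<^sup>2) * (norm v)\<^sup>2" by (simp add: sum_distrib_right)
  also have "(\<Sum>i\<in>UNIV. (norm (d $ i))\<^sup>2) = (norm (vectorize d))\<^sup>2"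
    by (simp add: norm_vec_squared vectorize_def sum.cartesian_product case_prod_unfold flip: UNIV_Times_UNIV)
  finally have "(norm (d *v v))\<^sup>2 \<le> (norm (vectorize d) * norm v)\<^sup>2"
    by (simp add: power_mult_distrib)
  then show ?thesis by (rule power2_le_imp_le) simp
qed

lemma matrix_mult_diff_right:
  fixes A :: "real^'n^'m" and B B' :: "real^'k^'n"
  shows "A ** B - A ** B' = A ** (B - B')"
proof -
  have "(A ** B - A ** B') $ i $ j = (A ** (B - B')) $ i $ j" for i j
    unfolding matrix_matrix_mult_def vector_minus_component vec_lambda_beta right_diff_distrib sum_subtractf ..
  then show ?thesis unfolding vec_eq_iff by blast
qed

lemma matrix_mult_diff_left:
  fixes A A' :: "real^'n^'m" and B :: "real^'k^'n"
  shows "A ** B - A' ** B = (A - A') ** B"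
proof -
  have "(A ** B - A' ** B) $ i $ j = ((A - A') ** B) $ i $ j" for i j
    unfolding matrix_matrix_mult_def vector_minus_component vec_lambda_beta left_diff_distrib sum_subtractf ..
  then show ?thesis unfolding vec_eq_iff by blast
qed

text \<open>
  With \<open>x m = (I - \<alpha> S m)\<^sup>-\<^sup>1 y\<close> one has \<open>x m - x M = \<alpha> (I - \<alpha> S M)\<^sup>-\<^sup>1 S(m - M) x m\<close>; inserting this
  identity into itself gives the expansion.
\<close>

lemma resolvent_expansion:
  fixes S :: "real^'b^'c \<Rightarrow> real^'n^'n" and M :: "real^'b^'c" and y :: "real^'n"
  assumes S: "\<And>m. substochastic m \<Longrightarrow> substochastic (S m)" "\<And>m m'. S m - S m' = S (m - m')"
    and B: "0 \<le> B" "\<And>d v. norm (S d *v v) \<le> B * norm (vectorize d) * norm v"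
    and \<alpha>: "0 \<le> \<alpha>" "\<alpha> < 1" and M: "substochastic M"
  defines "R \<equiv> matrix_inv (mat 1 - \<alpha> *\<^sub>R S M)" and "x \<equiv> \<lambda>m. matrix_inv (mat 1 - \<alpha> *\<^sub>R S m) *v y"
  shows "\<exists>K. \<forall>m. substochastic m \<longrightarrow>
    norm (x m - x M - \<alpha> *\<^sub>R (R *v (S (m - M) *v x M))) \<le> K * (norm (vectorize (m - M)))\<^sup>2"
proof -
  obtain b where b: "0 \<le> b" "\<And>v. norm (R *v v) \<le> b * norm v" using matrix_vector_bounded[of R] by blast
  have solves: "(mat 1 - \<alpha> *\<^sub>R S m) *v x m = y" if "substochastic m" for m
    using matrix_inv_right_cancel[OF contraction_invertible[OF S(1)[OF that] \<alpha>]]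
    by (simp add: x_def matrix_vector_mul_assoc)
  \<comment> \<open>Bounds the solutions for all substochastic m at once, which makes the constant
    of the remainder independent of m.\<close>
  define F where "F = real CARD('n) * (norm y / (1 - \<alpha>))"
  have F: "norm (x m) \<le> F" if "substochastic m" for m
    unfolding F_def using contraction_solution_bound[OF S(1)[OF that] \<alpha> solves[OF that]] .
  have diff: "x m - x M = \<alpha> *\<^sub>R (R *v (S (m - M) *v x m))" if m: "substochastic m" for m
  proof -
    \<comment> \<open>Both x m and x M solve their equations with the same right-hand side y, so the
      term for M may be exchanged for the one for m.\<close>
    have "(mat 1 - \<alpha> *\<^sub>R S M) *v (x m - x M) = (mat 1 - \<alpha> *\<^sub>R S M) *v x m - (mat 1 - \<alpha> *\<^sub>R S m) *v x m"
      by (simp add: matrix_vector_mult_diff_distrib solves m M)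
    also have "\<dots> = \<alpha> *\<^sub>R (S (m - M) *v x m)"
      by (simp add: S(2)[symmetric] matrix_vector_mult_diff_rdistrib scaleR_matrix_vector_assoc[symmetric] scaleR_diff_right)
    finally have "R *v ((mat 1 - \<alpha> *\<^sub>R S M) *v (x m - x M)) = \<alpha> *\<^sub>R (R *v (S (m - M) *v x m))"
      by (simp add: matrix_vector_mult_scaleR)
    then show ?thesis
      using matrix_inv_left_cancel[OF contraction_invertible[OF S(1)[OF M] \<alpha>]]
      by (simp add: matrix_vector_mul_assoc R_def)
  qed
  have step: "norm (\<alpha> *\<^sub>R (R *v (S d *v v))) \<le> b * B * norm (vectorize d) * norm v" for d v
  proof -
    have "norm (\<alpha> *\<^sub>R (R *v (S d *v v))) \<le> 1 * norm (R *v (S d *v v))"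
      using \<alpha> by (simp only: norm_scaleR) (intro mult_right_mono, auto)
    also have "\<dots> \<le> b * norm (S d *v v)" using b by simp
    also have "\<dots> \<le> b * (B * norm (vectorize d) * norm v)" using b(1) B(2) by (rule mult_left_mono[rotated])
    finally show ?thesis by (simp add: mult.assoc)
  qed
  have "norm (x m - x M - \<alpha> *\<^sub>R (R *v (S (m - M) *v x M))) \<le> (b * B)\<^sup>2 * F * (norm (vectorize (m - M)))\<^sup>2"
    if m: "substochastic m" for m
  proof -
    let ?d = "norm (vectorize (m - M))"
    have "x m - x M - \<alpha> *\<^sub>R (R *v (S (m - M) *v x M)) = \<alpha> *\<^sub>R (R *v (S (m - M) *v (x m - x M)))"
      unfolding diff[OF m] by (simp add: matrix_vector_mult_diff_distrib scaleR_diff_right flip: diff[OF m])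
    then have "norm (x m - x M - \<alpha> *\<^sub>R (R *v (S (m - M) *v x M))) \<le> b * B * ?d * norm (x m - x M)"
      using step by simp
    also have "\<dots> \<le> b * B * ?d * (b * B * ?d * norm (x m))"
      unfolding diff[OF m] using b(1) B(1) by (intro mult_left_mono step) auto
    also have "\<dots> \<le> b * B * ?d * (b * B * ?d * F)"
      using b(1) B(1) F[OF m] by (intro mult_left_mono) auto
    finally show ?thesis by (simp add: power2_eq_square mult_ac)
  qed
  then show ?thesis by blast
qed

text \<open>The identity (A (x) b^T) vec d = A d b for row-major vec: it turns a first-order term of
  the form A d b into a fixed matrix acting on the matrix error and so produces the Kronecker
  factors of the covariances.\<close>

lemma kronecker_row_vectorize:
  "kronecker_row A B *v vectorize d = A *v (d *v (\<chi> q. B $ 1 $ q))"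
  unfolding vec_eq_iff
proof (rule allI)
  fix i
  have "(kronecker_row A B *v vectorize d) $ i = (\<Sum>j\<in>UNIV. \<Sum>q\<in>UNIV. A $ i $ j * B $ 1 $ q * d $ j $ q)"
    by (simp add: matrix_vector_mult_def kronecker_row_def kronecker_def vectorize_def sum.cartesian_product case_prod_unfold flip: UNIV_Times_UNIV)
  also have "\<dots> = (A *v (d *v (\<chi> q. B $ 1 $ q))) $ i"
    by (simp add: matrix_vector_mult_def sum_distrib_left mult_ac)
  finally show "(kronecker_row A B *v vectorize d) $ i = (A *v (d *v (\<chi> q. B $ 1 $ q))) $ i" .
qed

lemma transpose_kronecker_row: "transpose (kronecker_row A B) = kronecker_col (transpose A) (transpose B)"
  by (simp add: vec_eq_iff transpose_def kronecker_row_def kronecker_col_def kronecker_def)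

lemma transpose_diff: "transpose (A - B) = transpose A - transpose (B :: real^'n^'m)"
  by (simp add: vec_eq_iff transpose_def)

lemma scaled_sandwich:
  fixes A :: "real^'n^'m"
  shows "(c *\<^sub>R A) ** G ** (c *\<^sub>R B) = c\<^sup>2 *\<^sub>R (A ** G ** B)"
  by (simp add: matrix_scalar_ac scalar_matrix_assoc[symmetric] power2_eq_square)

section \<open>Derivatives of the policy functionals and their covariances\<close>

context ergodic_controlled_chain
begin

context
  fixes \<alpha> :: real and Pm :: "real^('s \<times> 'a)^'s" and g :: "real^'s" and r :: "real^('s \<times> 'a)"
  assumes \<alpha>: "0 < \<alpha>" "\<alpha> < 1" and Pm: "substochastic Pm"
begin

text \<open>The derivative of the value at M, acting on the flattened direction: dV = alpha (I -
  alpha Pi M)^-1 Pi dM V.\<close>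

definition L_V :: "real^(('s \<times> 'a) \<times> 's)^'s" where
  "L_V = \<alpha> *\<^sub>R kronecker_row (matrix_inv (mat 1 - \<alpha> *\<^sub>R (Pm ** M)) ** Pm) (rowvector (V_fun \<alpha> Pm M g))"

text \<open>The derivative of the action value with the reward r held fixed: dQ = alpha (I - alpha M
  Pi)^-1 dM Pi Q.\<close>

definition L_Q :: "real^(('s \<times> 'a) \<times> 's)^('s \<times> 'a)" where
  "L_Q = \<alpha> *\<^sub>R kronecker_row (matrix_inv (mat 1 - \<alpha> *\<^sub>R (M ** Pm))) (rowvector (Q_fun \<alpha> Pm M r) ** transpose Pm)"

lemma V_expansion:
  "\<exists>K. \<forall>m. substochastic m \<longrightarrow>
    norm (V_fun \<alpha> Pm m g - V_fun \<alpha> Pm M g - L_V *v vectorize (m - M)) \<le> K * (norm (vectorize (m - M)))\<^sup>2"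
proof -
  obtain B where B: "0 \<le> B" "\<And>x. norm (Pm *v x) \<le> B * norm x" using matrix_vector_bounded[of Pm] by blast
  have "\<exists>K. \<forall>m. substochastic m \<longrightarrow>
    norm (matrix_inv (mat 1 - \<alpha> *\<^sub>R (Pm ** m)) *v g - matrix_inv (mat 1 - \<alpha> *\<^sub>R (Pm ** M)) *v g
      - \<alpha> *\<^sub>R (matrix_inv (mat 1 - \<alpha> *\<^sub>R (Pm ** M)) *v ((Pm ** (m - M)) *v (matrix_inv (mat 1 - \<alpha> *\<^sub>R (Pm ** M)) *v g))))
    \<le> K * (norm (vectorize (m - M)))\<^sup>2"
  proof (rule resolvent_expansion[where S = "\<lambda>m. Pm ** m" and B = B])
    show "Pm ** m - Pm ** m' = Pm ** (m - m')" for m m'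
      by (rule matrix_mult_diff_right)
    show "norm ((Pm ** d) *v v) \<le> B * norm (vectorize d) * norm v" for d v
    proof -
      have "norm ((Pm ** d) *v v) \<le> B * norm (d *v v)" using B(2) by (simp add: matrix_vector_mul_assoc[symmetric])
      also have "\<dots> \<le> B * (norm (vectorize d) * norm v)"
        using B(1) norm_matrix_vector_le by (rule mult_left_mono[rotated])
      finally show ?thesis by (simp add: mult.assoc)
    qed
  qed (use B \<alpha> Pm substochastic_M in \<open>auto intro: substochastic_mult\<close>)
  moreover have "L_V *v vectorize d = \<alpha> *\<^sub>R (matrix_inv (mat 1 - \<alpha> *\<^sub>R (Pm ** M)) *v ((Pm ** d) *v V_fun \<alpha> Pm M g))" for d
    by (simp add: L_V_def scaleR_matrix_vector_assoc[symmetric] kronecker_row_vectorize matrix_vector_mul_assoc[symmetric] rowvector_def)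
  ultimately show ?thesis by (simp only: V_fun_def)
qed

lemma Q_expansion:
  "\<exists>K. \<forall>m. substochastic m \<longrightarrow>
    norm (Q_fun \<alpha> Pm m r - Q_fun \<alpha> Pm M r - L_Q *v vectorize (m - M)) \<le> K * (norm (vectorize (m - M)))\<^sup>2"
proof -
  obtain B where B: "0 \<le> B" "\<And>x. norm (Pm *v x) \<le> B * norm x" using matrix_vector_bounded[of Pm] by blast
  have "\<exists>K. \<forall>m. substochastic m \<longrightarrow>
    norm (matrix_inv (mat 1 - \<alpha> *\<^sub>R (m ** Pm)) *v r - matrix_inv (mat 1 - \<alpha> *\<^sub>R (M ** Pm)) *v r
      - \<alpha> *\<^sub>R (matrix_inv (mat 1 - \<alpha> *\<^sub>R (M ** Pm)) *v (((m - M) ** Pm) *v (matrix_inv (mat 1 - \<alpha> *\<^sub>R (M ** Pm)) *v r))))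
    \<le> K * (norm (vectorize (m - M)))\<^sup>2"
  proof (rule resolvent_expansion[where S = "\<lambda>m. m ** Pm" and B = B])
    show "m ** Pm - m' ** Pm = (m - m') ** Pm" for m m' :: "real^'s^('s \<times> 'a)"
      by (rule matrix_mult_diff_left)
    show "norm ((d ** Pm) *v v) \<le> B * norm (vectorize d) * norm v" for d v
    proof -
      have "norm ((d ** Pm) *v v) \<le> norm (vectorize d) * norm (Pm *v v)"
        by (simp add: matrix_vector_mul_assoc[symmetric] norm_matrix_vector_le)
      also have "\<dots> \<le> norm (vectorize d) * (B * norm v)"
        using B(2) by (intro mult_left_mono) auto
      finally show ?thesis by (simp add: mult_ac)
    qed
  qed (use B \<alpha> Pm substochastic_M in \<open>auto intro: substochastic_mult\<close>)
  moreover have "L_Q *v vectorize d = \<alpha> *\<^sub>R (matrix_inv (mat 1 - \<alpha> *\<^sub>R (M ** Pm)) *v ((d ** Pm) *v Q_fun \<alpha> Pm M r))" for d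
  proof -
    have "(\<chi> q. (rowvector (Q_fun \<alpha> Pm M r) ** transpose Pm) $ (1 :: 1) $ q) = Pm *v Q_fun \<alpha> Pm M r"
      by (simp add: vec_eq_iff matrix_matrix_mult_def matrix_vector_mult_def rowvector_def transpose_def mult.commute)
    then show ?thesis
      by (simp add: L_Q_def scaleR_matrix_vector_assoc[symmetric] kronecker_row_vectorize matrix_vector_mul_assoc[symmetric])
  qed
  ultimately show ?thesis by (simp only: Q_fun_def)
qed

lemma A_expansion:
  "\<exists>K. \<forall>m. substochastic m \<longrightarrow>
    norm (A_fun \<alpha> Pm m g r - A_fun \<alpha> Pm M g r - (L_Q - K_mat ** L_V) *v vectorize (m - M)) \<le> K * (norm (vectorize (m - M)))\<^sup>2"
proof -
  obtain KV KQ where K: "\<And>m. substochastic m \<Longrightarrow> norm (V_fun \<alpha> Pm m g - V_fun \<alpha> Pm M g - L_V *v vectorize (m - M)) \<le> KV * (norm (vectorize (m - M)))\<^sup>2"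
    "\<And>m. substochastic m \<Longrightarrow> norm (Q_fun \<alpha> Pm m r - Q_fun \<alpha> Pm M r - L_Q *v vectorize (m - M)) \<le> KQ * (norm (vectorize (m - M)))\<^sup>2"
    using V_expansion Q_expansion by blast
  obtain B where B: "0 \<le> B" "\<And>x. norm ((K_mat :: real^'s^('s \<times> 'a)) *v x) \<le> B * norm x"
    using matrix_vector_bounded[of "K_mat :: real^'s^('s \<times> 'a)"] by blast
  have "norm (A_fun \<alpha> Pm m g r - A_fun \<alpha> Pm M g r - (L_Q - K_mat ** L_V) *v vectorize (m - M))
      \<le> (KQ + B * KV) * (norm (vectorize (m - M)))\<^sup>2" if m: "substochastic m" for m
  proof -
    let ?K = "K_mat :: real^'s^('s \<times> 'a)"
    let ?q = "Q_fun \<alpha> Pm m r - Q_fun \<alpha> Pm M r - L_Q *v vectorize (m - M)"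
    let ?v = "V_fun \<alpha> Pm m g - V_fun \<alpha> Pm M g - L_V *v vectorize (m - M)"
    have "A_fun \<alpha> Pm m g r - A_fun \<alpha> Pm M g r - (L_Q - K_mat ** L_V) *v vectorize (m - M) = ?q - ?K *v ?v"
      by (simp add: A_fun_def matrix_vector_mult_diff_distrib matrix_vector_mult_diff_rdistrib matrix_vector_mul_assoc)
    also have "norm \<dots> \<le> norm ?q + norm (?K *v ?v)" by (rule norm_triangle_ineq4)
    also have "\<dots> \<le> KQ * (norm (vectorize (m - M)))\<^sup>2 + B * (KV * (norm (vectorize (m - M)))\<^sup>2)"
      using K[OF m] B(2)[of ?v] mult_left_mono[OF K(1)[OF m] B(1)] by linarith
    finally show ?thesis by (simp add: algebra_simps)
  qed
  then show ?thesis by blast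
qed

lemma transpose_L_V: "transpose L_V = \<alpha> *\<^sub>R kronecker_col (transpose Pm ** matrix_inv (mat 1 - \<alpha> *\<^sub>R (transpose M ** transpose Pm)))
    (columnvector (V_fun \<alpha> Pm M g))"
proof -
  \<comment> \<open>Inverse and transpose are exchanged only for an invertible matrix, since
    \<open>matrix_inv\<close> is a choice otherwise.\<close>
  have "invertible (mat 1 - \<alpha> *\<^sub>R (Pm ** M))"
    using \<alpha> Pm substochastic_M by (intro contraction_invertible substochastic_mult) auto
  then have "transpose (matrix_inv (mat 1 - \<alpha> *\<^sub>R (Pm ** M))) = matrix_inv (mat 1 - \<alpha> *\<^sub>R (transpose M ** transpose Pm))"
    by (simp add: transpose_matrix_inv transpose_diff transpose_scalar transpose_mat matrix_transpose_mul)
  then show ?thesis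
    by (simp add: L_V_def transpose_scalar transpose_kronecker_row matrix_transpose_mul transpose_rowvector)
qed

lemma transpose_L_Q: "transpose L_Q = \<alpha> *\<^sub>R kronecker_col (matrix_inv (mat 1 - \<alpha> *\<^sub>R (transpose Pm ** transpose M)))
    (Pm ** columnvector (Q_fun \<alpha> Pm M r))"
proof -
  have "invertible (mat 1 - \<alpha> *\<^sub>R (M ** Pm))"
    using \<alpha> Pm substochastic_M by (intro contraction_invertible substochastic_mult) auto
  then have "transpose (matrix_inv (mat 1 - \<alpha> *\<^sub>R (M ** Pm))) = matrix_inv (mat 1 - \<alpha> *\<^sub>R (transpose Pm ** transpose M))"
    by (simp add: transpose_matrix_inv transpose_diff transpose_scalar transpose_mat matrix_transpose_mul)
  then show ?thesis
    by (simp add: L_Q_def transpose_scalar transpose_kronecker_row matrix_transpose_mul transpose_rowvector)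
qed

lemma Sigma_V_eq: "L_V ** Lambda_bar M p ** transpose L_V = Sigma_V \<alpha> Pm M p (V_fun \<alpha> Pm M g)"
  unfolding transpose_L_V unfolding L_V_def Sigma_V_def scaled_sandwich ..

lemma Sigma_Q_eq: "L_Q ** Lambda_bar M p ** transpose L_Q = Sigma_Q \<alpha> Pm M p (Q_fun \<alpha> Pm M r)"
  unfolding transpose_L_Q unfolding L_Q_def Sigma_Q_def scaled_sandwich ..

lemma Sigma_A_eq: "(L_Q - K_mat ** L_V) ** Lambda_bar M p ** transpose (L_Q - K_mat ** L_V)
    = Sigma_A \<alpha> Pm M p (V_fun \<alpha> Pm M g) (Q_fun \<alpha> Pm M r)"
  unfolding transpose_diff matrix_transpose_mul transpose_L_V transpose_L_Q
  unfolding L_V_def L_Q_def Sigma_A_def matrix_scalar_ac scalar_matrix_assoc[symmetric]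
    scaleR_diff_right[symmetric] scaleR_scaleR power2_eq_square ..

end

end

lemma substochastic_policy_matrix:
  assumes "\<forall>s. \<pi> s \<in> prob_simplex"
  shows "substochastic (policy_matrix \<pi>)"
proof -
  have "(\<Sum>sl\<in>UNIV. policy_matrix \<pi> $ s $ sl) = (\<Sum>v\<in>UNIV. \<Sum>l\<in>UNIV. if v = s then \<pi> s $ l else 0)" for s
    by (simp add: policy_matrix_def sum.cartesian_product case_prod_unfold flip: UNIV_Times_UNIV)
  also have "\<dots> s = (\<Sum>v\<in>UNIV. if v = s then (\<Sum>l\<in>UNIV. \<pi> s $ l) else 0)" for s
    by (intro sum.cong) auto
  finally show ?thesis
    using assms by (auto simp: substochastic_def policy_matrix_def prob_simplex_def)
qed

theorem theorem10:
  fixes P :: "'w measure"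
    and X :: "nat \<Rightarrow> 'w \<Rightarrow> 's::finite"
    and a :: "nat \<Rightarrow> 'w \<Rightarrow> 'a::finite"
    and M :: "real^'s^('s \<times> 'a)"
    and p :: "'s \<times> 'a \<Rightarrow> real"
    and \<pi> :: "'s \<Rightarrow> real^'a"
    and \<alpha> :: real
    and gt :: "'s \<Rightarrow> 'a \<Rightarrow> real"
    and rt :: "'s \<Rightarrow> 'a \<Rightarrow> 's \<Rightarrow> real"
    and Pm :: "real^('s \<times> 'a)^'s"
    and g V :: "real^'s"
    and r Q A :: "real^('s \<times> 'a)"
    and V_hat :: "nat \<Rightarrow> 'w \<Rightarrow> real^'s"
    and Q_hat A_hat :: "nat \<Rightarrow> 'w \<Rightarrow> real^('s \<times> 'a)"
  assumes chain: "controlled_markov_chain P X a M"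
    and return_times: "\<forall>s l. \<exists>\<beta> T. 0 < \<beta> \<and> \<beta> < 1 \<and> T \<in> O(\<lambda>i::nat. real i powr \<beta>) \<and>
      (\<forall>i\<ge>1. AE w in P. cond_return_time P X a s l i w \<le> ennreal (T i))"
    and mixing: "\<exists>C>1. \<forall>n. Delta_norm P X a n \<le> C"
    and frequencies: "\<forall>s l. (\<lambda>n. (\<Sum>i<n. \<P>(w in P. X i w = s \<and> a i w = l)) / real n)
      \<longlonglongrightarrow> p (s, l)"
    and frequencies_pos: "Min (range p) > 0"
    and policy: "\<forall>s. \<pi> s \<in> prob_simplex"
    and discount: "0 < \<alpha>" "\<alpha> < 1"
    and Pm: "Pm = policy_matrix \<pi>"
    and g: "g = state_reward \<pi> gt"
    and r: "r = action_reward M rt"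
    and V: "V = V_fun \<alpha> Pm M g"
    and Q: "Q = Q_fun \<alpha> Pm M r"
    and A: "A = A_fun \<alpha> Pm M g r"
    and V_hat: "\<forall>n w. V_hat n w = V_fun \<alpha> Pm (M_hat X a n w) g"
    and Q_hat: "\<forall>n w. Q_hat n w = Q_fun \<alpha> Pm (M_hat X a n w) r"
    and A_hat: "\<forall>n w. A_hat n w = A_fun \<alpha> Pm (M_hat X a n w) g r"
  shows "converges_to_normal P (\<lambda>n w. sqrt (real n) *\<^sub>R (V_hat n w - V)) 0 (Sigma_V \<alpha> Pm M p V)
    \<and> converges_to_normal P (\<lambda>n w. sqrt (real n) *\<^sub>R (Q_hat n w - Q)) 0 (Sigma_Q \<alpha> Pm M p Q)
    \<and> converges_to_normal P (\<lambda>n w. sqrt (real n) *\<^sub>R (A_hat n w - A)) 0 (Sigma_A \<alpha> Pm M p V Q)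
    \<and> converges_in_probability P V_hat V
    \<and> converges_in_probability P Q_hat Q
    \<and> converges_in_probability P A_hat A"
proof -
  interpret controlled_markov_chain P X a M by (rule chain)
  obtain C where C: "C > 1" "\<And>n. Delta_norm P X a n \<le> C"
    using mixing by blast
  interpret ergodic_controlled_chain P X a M p C
  proof
    show "Delta_norm P X a n \<le> C" for n by (rule C)
    show "0 \<le> C" using C by simp
    show "(\<lambda>n. (\<Sum>j<n. visit_prob j z) / real n) \<longlonglongrightarrow> p z" for z
      using frequencies[rule_format, of "fst z" "snd z"] by simp
    show "p z > 0" for z
      using frequencies_pos Min_le[of "range p" "p z"] by (meson finite finite_imageI less_le_trans rangeI)
  qed
  have S: "substochastic Pm"
    using policy unfolding Pm by (rule substochastic_policy_matrix)
  obtain KV KQ KA where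
    "\<And>m. substochastic m \<Longrightarrow> norm (V_fun \<alpha> Pm m g - V_fun \<alpha> Pm M g - L_V \<alpha> Pm g *v vectorize (m - M))
      \<le> KV * (norm (vectorize (m - M)))\<^sup>2"
    "\<And>m. substochastic m \<Longrightarrow> norm (Q_fun \<alpha> Pm m r - Q_fun \<alpha> Pm M r - L_Q \<alpha> Pm r *v vectorize (m - M))
      \<le> KQ * (norm (vectorize (m - M)))\<^sup>2"
    "\<And>m. substochastic m \<Longrightarrow> norm (A_fun \<alpha> Pm m g r - A_fun \<alpha> Pm M g r
        - (L_Q \<alpha> Pm r - K_mat ** L_V \<alpha> Pm g) *v vectorize (m - M))
      \<le> KA * (norm (vectorize (m - M)))\<^sup>2"
    using V_expansion[OF discount S, of g] Q_expansion[OF discount S, of r] A_expansion[OF discount S, of g r]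
    by blast
  \<comment> \<open>The sandwich of each derivative with \<open>Lambda_bar\<close> is the covariance
    in the claim, once the transposes are carried out and alpha is collected from both
    factors.\<close>
  from estimator_limit[OF this(1)] estimator_limit[OF this(2)] estimator_limit[OF this(3)]
  show ?thesis
    unfolding Sigma_V_eq[OF discount S] Sigma_Q_eq[OF discount S] Sigma_A_eq[OF discount S]
      V[symmetric] Q[symmetric] A[symmetric]
    using V_hat Q_hat A_hat by (simp add: fun_eq_iff[symmetric])
qed

end
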